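(* Consider the periodic Camassa–Holm equation on $\mathbb{T}=\mathbb{R}/2\pi\mathbb{Z}$, $$\partial_t u+u\,\partial_x u=-\partial_x(1-\partial_x^2)^{-1}\Big(u^2+\tfrac12(\partial_x u)^2\Big),\qquad u(0,x)=u_0(x).$$ For every sufficiently large $n\in\mathbb{Z}^+$ there exists a real-valued initial datum $u_0\in H^\infty(\mathbb{T})$ with $$\|u_0\|_{B^1_{\infty,1}(\mathbb{T})}\le \frac{1}{\log\log n}$$ such that, denoting by $u\in\mathcal{C}([0,T);H^\infty(\mathbb{T}))$ the solution of the periodic Camassa–Holm equation with initial datum $u_0$, there is a time $t_0\in\big(0,\frac{1}{\log n}\big]$ with $$\|u(t_0)\|_{B^1_{\infty,1}(\mathbb{T})}\ge \log\log n .$$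
   Context: Periodic Fourier transform: for $u$ on $\mathbb{T}$, $\widehat u(\xi)=\int_{\mathbb{T}}e^{-\mathrm{i}x\xi}u(x)\,dx$ for $\xi\in\mathbb{Z}$, and $u(x)=\frac1{2\pi}\sum_{\xi\in\mathbb{Z}}\widehat u(\xi)e^{\mathrm{i}x\xi}$. Fix a smooth function $\chi$ supported in the ball of radius $4/3$ and equal to $1$ on the ball of radius $3/4$; set $\varphi(\xi)=\chi(\xi/2)-\chi(\xi)$ and $\varphi_j(\xi)=\varphi(2^{-j}\xi)$. Periodic dyadic blocks: $\Delta_j u=0$ for $j\le -2$, $\Delta_{-1}u=\frac1{2\pi}\sum_{\xi\in\mathbb{Z}}\chi(\xi)\widehat u(\xi)e^{\mathrm{i}x\xi}$, and $\Delta_j u=\frac1{2\pi}\sum_{\xi\in\mathbb{Z}}\varphi_j(\xi)\widehat u(\xi)e^{\mathrm{i}x\xi}$ for $j\ge0$. The Besov norm is $\|f\|_{B^s_{p,r}(\mathbb{T})}=\big(\sum_{j\ge-1}2^{sjr}\|\Delta_jf\|^r_{L^p(\mathbb{T})}\big)^{1/r}$ for $r<\infty$ (with the usual supremum for $r=\infty$); in particular $\|f\|_{B^1_{\infty,1}(\mathbb{T})}=\sum_{j\ge-1}2^j\|\Delta_jf\|_{L^\infty(\mathbb{T})}$. *)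

theory Defs
  imports "HOL-Analysis.Analysis"
begin

text \<open>Functions on the torus T = R/2piZ are represented as 2pi-periodic functions on R.\<close>

definition smooth_fun :: "(real \<Rightarrow> real) \<Rightarrow> bool" where
  "smooth_fun f \<longleftrightarrow> (\<forall>k x. ((deriv ^^ k) f) differentiable (at x))"

definition periodic_2pi :: "(real \<Rightarrow> 'a) \<Rightarrow> bool" where
  "periodic_2pi f \<longleftrightarrow> (\<forall>x. f (x + 2 * pi) = f x)"

definition H_inf :: "(real \<Rightarrow> real) \<Rightarrow> bool" where
  "H_inf f \<longleftrightarrow> smooth_fun f \<and> periodic_2pi f"

definition fourier_coeff :: "(real \<Rightarrow> real) \<Rightarrow> int \<Rightarrow> complex" where
  "fourier_coeff f \<xi> = integral {0..2*pi} (\<lambda>x. cis (- x * of_int \<xi>) * complex_of_real (f x))"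

definition fourier_mult :: "(int \<Rightarrow> complex) \<Rightarrow> (real \<Rightarrow> real) \<Rightarrow> real \<Rightarrow> complex" where
  "fourier_mult m f x = (1 / (2 * pi)) * infsum (\<lambda>\<xi>. m \<xi> * fourier_coeff f \<xi> * cis (x * of_int \<xi>)) UNIV"

text \<open>The nonlocal operator  -d_x (1 - d_x^2)^{-1}, symbol  -i xi / (1 + xi^2).\<close>
definition CH_nonlocal :: "(real \<Rightarrow> real) \<Rightarrow> real \<Rightarrow> complex" where
  "CH_nonlocal = fourier_mult (\<lambda>\<xi>. - \<i> * of_int \<xi> / (1 + of_int \<xi> ^ 2))"

definition LP_cutoff :: "(real \<Rightarrow> real) \<Rightarrow> bool" where
  "LP_cutoff chi \<longleftrightarrow> smooth_fun chi \<and> (\<forall>\<xi>. \<bar>\<xi>\<bar> > 4/3 \<longrightarrow> chi \<xi> = 0)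
      \<and> (\<forall>\<xi>. \<bar>\<xi>\<bar> \<le> 3/4 \<longrightarrow> chi \<xi> = 1)"

definition LP_phi :: "(real \<Rightarrow> real) \<Rightarrow> real \<Rightarrow> real" where
  "LP_phi chi \<xi> = chi (\<xi> / 2) - chi \<xi>"

definition dyadic_block :: "(real \<Rightarrow> real) \<Rightarrow> int \<Rightarrow> (real \<Rightarrow> real) \<Rightarrow> real \<Rightarrow> complex" where
  "dyadic_block chi j f =
     (if j \<le> -2 then (\<lambda>x. 0)
      else if j = -1 then fourier_mult (\<lambda>\<xi>. complex_of_real (chi (of_int \<xi>))) f
      else fourier_mult (\<lambda>\<xi>. complex_of_real (LP_phi chi (2 powr (- real_of_int j) * of_int \<xi>))) f)"

text \<open>L^infinity norm (for continuous functions: supremum of the modulus), valued in ennreal.\<close>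
definition Linf_norm :: "(real \<Rightarrow> complex) \<Rightarrow> ennreal" where
  "Linf_norm g = (SUP x. ennreal (cmod (g x)))"

text \<open>B^1_{infty,1}(T) norm: sum_{j \<ge> -1} 2^j ||Delta_j f||_{L^infty}; with j = k - 1.
  Valued in ennreal so it is always defined (possibly infinite).\<close>
definition besov_1_inf_1 :: "(real \<Rightarrow> real) \<Rightarrow> (real \<Rightarrow> real) \<Rightarrow> ennreal" where
  "besov_1_inf_1 chi f = (\<Sum>k. ennreal (2 powr (real k - 1)) * Linf_norm (dyadic_block chi (int k - 1) f))"

definition CH_solution :: "real \<Rightarrow> (real \<Rightarrow> real) \<Rightarrow> (real \<Rightarrow> real \<Rightarrow> real) \<Rightarrow> bool" where
  "CH_solution T u0 u \<longleftrightarrow>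
     u 0 = u0 \<and>
     (\<forall>t\<in>{0..<T}. H_inf (u t)) \<and>
     (\<forall>k. continuous_on ({0..<T} \<times> UNIV) (\<lambda>(t, x). (deriv ^^ k) (u t) x)) \<and>
     (\<forall>t\<in>{0..<T}. \<forall>x. \<exists>ut.
        ((\<lambda>s. u s x) has_real_derivative ut) (at t within {0..<T}) \<and>
        complex_of_real (ut + u t x * deriv (u t) x) =
          CH_nonlocal (\<lambda>y. (u t y)\<^sup>2 + (deriv (u t) y)\<^sup>2 / 2) x)"

end

theory Submission
  imports Defs
begin

text \<open>Along the flow \<open>\<eta>\<close> of \<open>u\<close> put \<open>V = \<eta>_x\<close>, \<open>U = u(\<eta>)\<close>, \<open>W = u_x(\<eta>)\<close>. Then
  \<open>(W V)_t = (W^2 / 2 + U^2 - P) V\<close> with \<open>P = (1 - d_x^2)^(-1) (u^2 + u_x^2 / 2)\<close>, so up to errors of higher order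
  \<open>u_x(t) = u0' + t u0'^2 / 2 + const\<close>. The conjugate Poisson kernel \<open>hk r\<close> annihilates the constant, and
  \<open>20 * \<parallel>u\<parallel>\<close> in the Besov norm dominates the pairing of \<open>u_x\<close> with \<open>hk r\<close> uniformly in \<open>r < 1\<close>, because
  \<open>|D|\<close> costs a factor \<open>2^j\<close> on the block \<open>\<Delta>_j u\<close> by Bernstein's inequality. Take
  \<open>u0 = \<epsilon> / L * sin (L x) * (3 + s(x))\<close> with \<open>L\<close> huge: it occupies a single dyadic block, so its norm is
  \<open>O(\<epsilon>)\<close>, but \<open>u0'^2\<close> has the low-frequency part \<open>\<epsilon>^2 (3 + s)^2 / 2\<close>. With \<open>s\<close> a regularised sawtooth of height
  \<open>O(1)\<close> cut off at frequency \<open>M\<close>, this part pairs with \<open>hk r\<close> to at least \<open>c \<epsilon>^2 ln M\<close>, while all error terms are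
  \<open>O(t^2 \<epsilon>^3 ln M + t \<epsilon>^2 + 1)\<close>. Fix \<open>t \<epsilon>\<close> small and let \<open>M\<close> tend to infinity.\<close>

section \<open>Calculus on the circle\<close>

text \<open>The mechanism is the unboundedness of the Hilbert transform on L^infinity: the slope of
  the datum stays of size \<epsilon>, but the local mean of its square has a near-jump, and there
  the Hilbert transform reaches \<epsilon>^2 ln M. The error terms feel the same logarithm, because
  the flow distorts the kernel and a distorted kernel is no longer odd; they are smaller only by a
  factor t \<epsilon>. The frequency L comes last, after M. This order forces Lagrangian
  coordinates. Second derivatives of the datum have size \<epsilon> L, so the transport term u u_xx
  cannot be treated as an error; along the flow only bounds for u and u_x enter, uniformly in L. The
  kernel follows the particle that starts at 0, so that its singularity stays at x = 0 and every
  distortion is relative to |x|. The theorem speaks of every solution, so existence and uniqueness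
  are proved as well. For existence, the conservation law of m turns the flow into a closed equation
  for ln \<eta>_x whose right side is Lipschitz in the supremum norm, without loss of
  derivatives.\<close>

lemma ftc_real:
  fixes F f :: "real \<Rightarrow> real"
  assumes "a \<le> b" "\<And>x. (F has_real_derivative f x) (at x)"
  shows "(f has_integral F b - F a) {a..b}"
  using fundamental_theorem_of_calculus[of a b F f] assms
  by (meson DERIV_subset has_real_derivative_iff_has_vector_derivative subset_UNIV)

text \<open>\<open>exp (- C * t) * D t\<close> is nonincreasing. It serves twice: for the squared
  defect of the circumference and for the squared L^2 distance of two solutions.\<close>

lemma gronwall_zero:
  fixes D :: "real \<Rightarrow> real"
  assumes D0: "D 0 = 0" and nonneg: "\<And>t. t \<in> {0..T} \<Longrightarrow> 0 \<le> D t"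
    and der: "\<And>t. t \<in> {0..T} \<Longrightarrow> (D has_real_derivative D' t) (at t within {0..T})"
    and le: "\<And>t. t \<in> {0..T} \<Longrightarrow> D' t \<le> C * D t"
    and t: "t \<in> {0..T}"
  shows "D t = 0"
proof -
  define G where "G t = exp (- C * t) * D t" for t
  have G: "(G has_real_derivative exp (- C * t) * (D' t - C * D t)) (at t within {0..T})"
    if "t \<in> {0..T}" for t
  proof -
    have "((\<lambda>s. exp (- C * s)) has_real_derivative exp (- C * t) * (- C)) (at t within {0..T})"
      by (auto intro!: derivative_eq_intros)
    from DERIV_mult[OF this der[OF that]] show ?thesis
      unfolding G_def[abs_def] by (simp add: algebra_simps)
  qed
  have "G t \<le> G 0"
  proof (rule DERIV_nonpos_imp_decreasing_open[where f=G and a=0 and b=t])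
    show "0 \<le> t" using t by simp
    show "continuous_on {0..t} G"
      by (rule continuous_on_subset[OF DERIV_continuous_on[OF G]]) (use t in auto)
    fix s assume s: "0 < s" "s < t"
    then have "at s within {0..T} = at s" using t by (intro at_within_interior) auto
    with G[of s] s t have "(G has_real_derivative exp (- C * s) * (D' s - C * D s)) (at s)" by auto
    moreover have "exp (- C * s) * (D' s - C * D s) \<le> 0"
      using le[of s] s t by (intro mult_nonneg_nonpos) auto
    ultimately show "\<exists>y. (G has_real_derivative y) (at s) \<and> y \<le> 0" by blast
  qed
  then have "D t \<le> 0" using D0 by (simp add: G_def mult_le_0_iff)
  with nonneg[OF t] show ?thesis by simp
qed

lemma periodic_int:
  assumes "periodic_2pi f" shows "f (x + of_int k * (2 * pi)) = f x"
proof (induct k rule: int_induct[where k=0])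
  case (step1 i)
  have "f (x + of_int (i + 1) * (2 * pi)) = f (x + of_int i * (2 * pi) + 2 * pi)"
    by (simp add: algebra_simps)
  also have "\<dots> = f (x + of_int i * (2 * pi))" using assms by (simp only: periodic_2pi_def)
  finally show ?case using step1 by simp
next
  case (step2 i)
  have "f (x + of_int i * (2 * pi)) = f (x + of_int (i - 1) * (2 * pi) + 2 * pi)"
    by (simp add: algebra_simps)
  also have "\<dots> = f (x + of_int (i - 1) * (2 * pi))" using assms by (simp only: periodic_2pi_def)
  finally show ?case using step2 by simp
qed simp

lemma period_shift_exists: "\<exists>k::int. x + of_int k * (2 * pi) \<in> {a..a + 2 * pi}"
proof
  define y where "y = (x - a) / (2 * pi)"
  have "x = a + y * (2 * pi)" by (simp add: y_def)
  then have "x + of_int (- \<lfloor>y\<rfloor>) * (2 * pi) = a + (y - of_int \<lfloor>y\<rfloor>) * (2 * pi)"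
    by (simp add: algebra_simps)
  moreover have "0 \<le> (y - of_int \<lfloor>y\<rfloor>) * (2 * pi)"
    by (intro mult_nonneg_nonneg) auto
  moreover have "(y - of_int \<lfloor>y\<rfloor>) * (2 * pi) \<le> 1 * (2 * pi)"
    by (intro mult_right_mono) (linarith, simp)
  ultimately show "x + of_int (- \<lfloor>y\<rfloor>) * (2 * pi) \<in> {a..a + 2 * pi}" by simp
qed

lemma periodic_attained:
  assumes "periodic_2pi f" shows "\<exists>y\<in>{a..a + 2 * pi}. f y = f x"
  using period_shift_exists[of x a] periodic_int[OF assms] by metis

section \<open>Joint continuity in time and space\<close>

definition jcont :: "real set \<Rightarrow> (real \<Rightarrow> real \<Rightarrow> real) \<Rightarrow> bool" where
  "jcont S f \<longleftrightarrow> continuous_on (S \<times> UNIV) (\<lambda>(t, x). f t x)"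

lemma jcont_subset: "jcont S f \<Longrightarrow> S' \<subseteq> S \<Longrightarrow> jcont S' f"
  unfolding jcont_def by (rule continuous_on_subset) auto

lemma jcont_comp:
  assumes "jcont S f" "continuous_on X g" "continuous_on X h" "g ` X \<subseteq> S"
  shows "continuous_on X (\<lambda>z. f (g z) (h z))"
proof -
  have "continuous_on X ((\<lambda>(t, x). f t x) \<circ> (\<lambda>z. (g z, h z)))"
    by (rule continuous_on_compose[OF continuous_on_Pair[OF assms(2,3)]])
      (rule continuous_on_subset[OF assms(1)[unfolded jcont_def]], use assms(4) in auto)
  then show ?thesis by (simp add: o_def)
qed

lemma jcont_section: "jcont S f \<Longrightarrow> t \<in> S \<Longrightarrow> continuous_on X (f t)"
  using jcont_comp[of S f X "\<lambda>_. t" "\<lambda>x. x"] by (auto intro: continuous_intros)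

lemma jcont_time: "jcont S f \<Longrightarrow> continuous_on S (\<lambda>t. f t x)"
  using jcont_comp[of S f S "\<lambda>t. t" "\<lambda>_. x"] by (auto intro: continuous_intros)

text \<open>The interval of integration is fixed; moving domains are first shifted or rescaled onto
  one, which is why \<open>antider\<close> and \<open>conv\<close> are written over constant
  intervals.\<close>

lemma jcont_integral_param:
  fixes f :: "real \<Rightarrow> real \<Rightarrow> real \<Rightarrow> real"
  assumes "continuous_on ((S \<times> UNIV) \<times> {a..b}) (\<lambda>((t, x), s). f t x s)"
  shows "jcont S (\<lambda>t x. integral {a..b} (f t x))"
proof -
  have "continuous_on (S \<times> UNIV) (\<lambda>z. integral (cbox a b) (\<lambda>s. f (fst z) (snd z) s))"
    by (rule integral_continuous_on_param) (use assms in \<open>simp add: case_prod_unfold\<close>)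
  then show ?thesis by (simp add: jcont_def case_prod_unfold)
qed

lemma jcont_bounded:
  assumes "jcont {a..b} f" "\<And>t. t \<in> {a..b} \<Longrightarrow> periodic_2pi (f t)"
  shows "\<exists>B>0. \<forall>t\<in>{a..b}. \<forall>x. \<bar>f t x\<bar> \<le> B"
proof -
  have "compact ((\<lambda>(t, x). f t x) ` ({a..b} \<times> {0..0 + 2 * pi}))"
    by (intro compact_continuous_image continuous_on_subset[OF assms(1)[unfolded jcont_def]]
        compact_Times) auto
  then obtain B where B: "\<And>z. z \<in> (\<lambda>(t, x). f t x) ` ({a..b} \<times> {0..0 + 2 * pi}) \<Longrightarrow> \<bar>z\<bar> \<le> B"
    by (meson bounded_real compact_imp_bounded)
  have "\<bar>f t x\<bar> \<le> max B 1" if "t \<in> {a..b}" for t x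
  proof -
    obtain y where "y \<in> {0..0 + 2 * pi}" "f t y = f t x"
      using periodic_attained[OF assms(2)] \<open>t \<in> {a..b}\<close> by metis
    then have "f t x \<in> (\<lambda>(t, x). f t x) ` ({a..b} \<times> {0..0 + 2 * pi})"
      using that by (intro image_eqI[of _ _ "(t, y)"]) auto
    then show ?thesis using B[of "f t x"] by simp
  qed
  then show ?thesis by (intro exI[of _ "max B 1"]) auto
qed

lemma periodic_bounded:
  fixes f :: "real \<Rightarrow> real"
  assumes "continuous_on UNIV f" "periodic_2pi f"
  shows "\<exists>B>0. \<forall>x. \<bar>f x\<bar> \<le> B"
proof -
  have "jcont {0..0} (\<lambda>_. f)"
    unfolding jcont_def case_prod_unfold by (rule continuous_on_compose2[OF assms(1)]) (auto intro: continuous_intros)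
  from jcont_bounded[OF this] assms(2) show ?thesis by simp
qed

text \<open>The primitive vanishing at 0, for x of either sign and without oriented integrals.
  Rescaling to \<open>[0, 1]\<close> makes its joint continuity in a parameter an instance of
  \<open>jcont_integral_param\<close>.\<close>

definition antider :: "(real \<Rightarrow> real) \<Rightarrow> real \<Rightarrow> real" where
  "antider v x = x * integral {0..1} (\<lambda>r. v (x * r))"

lemma antider_0 [simp]: "antider v 0 = 0"
  by (simp add: antider_def)

lemma antider_eq:
  assumes "\<And>y. \<bar>y\<bar> \<le> \<bar>x\<bar> \<Longrightarrow> (F has_real_derivative v y) (at y)"
  shows "antider v x = F x - F 0"
proof -
  have "((\<lambda>r. x * v (x * r)) has_integral F (x * 1) - F (x * 0)) {0..1}"
  proof (rule fundamental_theorem_of_calculus)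
    fix r :: real assume "r \<in> {0..1}"
    then have r: "\<bar>x * r\<bar> \<le> \<bar>x\<bar>" by (simp add: abs_mult mult_left_le)
    have "((\<lambda>r. F (x * r)) has_real_derivative v (x * r) * x) (at r within {0..1})"
      by (rule DERIV_chain2[where f=F and g="\<lambda>r. x * r", OF assms[OF r]])
        (auto intro!: derivative_eq_intros)
    then show "((\<lambda>r. F (x * r)) has_vector_derivative x * v (x * r)) (at r within {0..1})"
      by (simp add: has_real_derivative_iff_has_vector_derivative mult.commute)
  qed simp
  then show ?thesis unfolding antider_def
    by (metis integral_mult_right integral_unique mult.right_neutral mult_zero_right)
qed

text \<open>Near x the function agrees with \<open>F y - F 0\<close> for a primitive
  \<open>F\<close> on a large compact interval, so the derivative of \<open>F\<close>
  transfers.\<close>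

lemma antider_deriv:
  assumes "continuous_on UNIV v"
  shows "(antider v has_real_derivative v x) (at x)"
proof -
  define R where "R = \<bar>x\<bar> + 1"
  obtain F where F: "\<And>y. y \<in> {-R-1..R+1} \<Longrightarrow> (F has_vector_derivative v y) (at y within {-R-1..R+1})"
    using antiderivative_continuous[of "-R-1" "R+1" v] assms
    by (metis continuous_on_subset subset_UNIV)
  have F': "(F has_real_derivative v y) (at y)" if "\<bar>y\<bar> \<le> R" for y
  proof -
    have "at y within {-R-1..R+1} = at y" using that by (intro at_within_interior) auto
    moreover have "y \<in> {-R-1..R+1}" using that by auto
    ultimately show ?thesis
      using F[of y] by (metis has_real_derivative_iff_has_vector_derivative)
  qed
  have "((\<lambda>y. F y - F 0) has_real_derivative v x) (at x)"
    using F'[of x] by (auto simp: R_def intro!: derivative_eq_intros)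
  moreover have "\<And>y. y \<in> {-R<..<R} \<Longrightarrow> F y - F 0 = antider v y"
    by (subst antider_eq[of _ F]) (auto intro!: F')
  moreover have "x \<in> {-R<..<R}" by (auto simp: R_def)
  ultimately show ?thesis
    using has_field_derivative_transform_within_open[of "\<lambda>y. F y - F 0" "v x" x "{-R<..<R}" "antider v"]
    by auto
qed

lemma antider_jcont:
  assumes "jcont S f" shows "jcont S (\<lambda>t. antider (f t))"
proof -
  have "jcont S (\<lambda>t x. integral {0..1} (\<lambda>r. f t (x * r)))"
    by (rule jcont_integral_param) (auto simp: case_prod_unfold intro!: jcont_comp[OF assms] continuous_intros)
  then show ?thesis unfolding jcont_def antider_def case_prod_unfold by (intro continuous_intros)
qed

text \<open>The boundary difference is kept because the lemma is applied to
  \<open>exp (A x) * n x\<close>, which a period multiplies by \<open>exp \<theta>\<close>.\<close>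

lemma integral_period_shift:
  fixes f :: "real \<Rightarrow> real"
  assumes "continuous_on UNIV f"
  shows "((\<lambda>x. integral {0..2 * pi} (\<lambda>s. f (x + s))) has_real_derivative f (x + 2 * pi) - f x) (at x)"
proof -
  have A: "(antider f has_real_derivative f y) (at y)" for y by (rule antider_deriv[OF assms])
  have "integral {0..2 * pi} (\<lambda>s. f (y + s)) = antider f (y + 2 * pi) - antider f y" for y
  proof -
    have "((\<lambda>s. f (y + s)) has_integral antider f (y + 2 * pi) - antider f (y + 0)) {0..2 * pi}"
      by (rule ftc_real) (use A in \<open>auto simp: add.commute[of y] DERIV_shift[symmetric]\<close>)
    then show ?thesis by (simp add: integral_unique)
  qed
  then show ?thesis using A by (auto intro!: derivative_intros simp: DERIV_shift[symmetric])
qed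

lemma integral_periodic:
  fixes f :: "real \<Rightarrow> real"
  assumes "continuous_on UNIV f" "periodic_2pi f"
  shows "integral {0..2 * pi} (\<lambda>s. f (x + s)) = integral {0..2 * pi} f"
proof -
  have "((\<lambda>x. integral {0..2 * pi} (\<lambda>s. f (x + s))) has_real_derivative 0) (at y)" for y
    using integral_period_shift[OF assms(1), of y] assms(2) by (simp add: periodic_2pi_def)
  from DERIV_isconst_all[OF allI[OF this], of x 0] show ?thesis by simp
qed

lemma leibniz_interval:
  fixes f :: "real \<Rightarrow> real \<Rightarrow> real"
  assumes "\<And>x s. x \<in> U \<Longrightarrow> s \<in> {a..b} \<Longrightarrow> ((\<lambda>x. f x s) has_real_derivative f' x s) (at x within U)"
    and "\<And>x. x \<in> U \<Longrightarrow> continuous_on {a..b} (f x)"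
    and "continuous_on (U \<times> {a..b}) (\<lambda>(x, s). f' x s)" and "x \<in> U" "convex U"
  shows "((\<lambda>x. integral {a..b} (f x)) has_real_derivative integral {a..b} (f' x)) (at x within U)"
  using leibniz_rule_field_derivative[of U a b f f' x] assms
  by (auto intro: integrable_continuous_real)

text \<open>Both \<open>G - antider v\<close> and \<open>G + antider v\<close> are nondecreasing.
  The varying majorant \<open>g\<close> carries the exponential weight of the Picard
  contraction.\<close>

lemma antider_bound:
  assumes v: "continuous_on UNIV v" and t: "0 \<le> t"
    and le: "\<And>s. 0 \<le> s \<Longrightarrow> s \<le> t \<Longrightarrow> \<bar>v s\<bar> \<le> g s"
    and G: "\<And>s. (G has_real_derivative g s) (at s)"
  shows "\<bar>antider v t\<bar> \<le> G t - G 0"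
proof -
  have "G 0 - antider v 0 \<le> G t - antider v t"
    by (rule DERIV_nonneg_imp_nondecreasing[OF t])
      (use le in \<open>force intro!: exI[of _ "g _ - v _"] derivative_intros G antider_deriv[OF v] dest: abs_le_D1\<close>)
  moreover have "G 0 + antider v 0 \<le> G t + antider v t"
    by (rule DERIV_nonneg_imp_nondecreasing[OF t])
      (use le in \<open>force intro!: exI[of _ "g _ + v _"] derivative_intros G antider_deriv[OF v] dest: abs_le_D2\<close>)
  ultimately show ?thesis by simp
qed

lemma antider_bound_const:
  assumes v: "continuous_on UNIV v" and t: "0 \<le> t"
    and le: "\<And>s. 0 \<le> s \<Longrightarrow> s \<le> t \<Longrightarrow> \<bar>v s\<bar> \<le> c"
  shows "\<bar>antider v t\<bar> \<le> c * t"
  using antider_bound[OF v t le, of "\<lambda>s. c * s"] by (auto intro!: derivative_eq_intros)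

section \<open>Green kernel of the circle\<close>

text \<open>Green's function of 1 - d_x^2 on the circle, over one period \<open>[0, 2 * pi]\<close>,
  and below it its derivative \<open>Ks\<close>. The values of \<open>Kc\<close> at the two ends
  agree, while those of \<open>Ks\<close> differ by 1; this unit jump is the delta function.\<close>

definition Kc :: "real \<Rightarrow> real" where "Kc y = cosh (y - pi) / (2 * sinh pi)"
definition Ks :: "real \<Rightarrow> real" where "Ks y = sinh (y - pi) / (2 * sinh pi)"

lemma sinh_pi_pos: "sinh pi > (0::real)"
  by (simp add: sinh_real_pos_iff)

lemma Kc_deriv: "(Kc has_real_derivative Ks y) (at y)"
  unfolding Kc_def[abs_def] Ks_def by (auto intro!: derivative_eq_intros simp: sinh_pi_pos less_imp_neq)

lemma Ks_deriv: "(Ks has_real_derivative Kc y) (at y)"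
  unfolding Ks_def[abs_def] Kc_def by (auto intro!: derivative_eq_intros simp: sinh_pi_pos less_imp_neq)

lemma Kc_exp: "Kc y = (exp (y - pi) + exp (pi - y)) / (4 * sinh pi)"
  by (simp add: Kc_def cosh_def minus_diff_eq)

lemma Ks_exp: "Ks y = (exp (y - pi) - exp (pi - y)) / (4 * sinh pi)"
  by (simp add: Ks_def sinh_def minus_diff_eq)

lemma Ks_2pi: "Ks (2 * pi) = 1 / 2" and Ks_0: "Ks 0 = - 1 / 2"
  using sinh_pi_pos by (simp_all add: Ks_def)

lemma Kc_2pi: "Kc (2 * pi) = Kc 0"
  by (simp add: Kc_def)

lemma Kc_pos: "Kc y > 0"
  using sinh_pi_pos by (simp add: Kc_def)

lemma Ks_bound: assumes "0 \<le> y" "y \<le> 2 * pi" shows "\<bar>Ks y\<bar> \<le> 1 / 2"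
proof -
  have m: "Ks x \<le> Ks z" if "x \<le> z" for x z
    by (rule DERIV_nonneg_imp_nondecreasing[OF that]) (use Ks_deriv Kc_pos less_imp_le in blast)
  show ?thesis using m[OF assms(1)] m[OF assms(2)] by (simp add: Ks_0 Ks_2pi)
qed

lemma continuous_Kc [continuous_intros]: "continuous_on X f \<Longrightarrow> continuous_on X (\<lambda>x. Kc (f x))"
  unfolding Kc_def by (intro continuous_intros) (simp_all add: sinh_pi_pos less_imp_neq[symmetric])

lemma continuous_Ks [continuous_intros]: "continuous_on X f \<Longrightarrow> continuous_on X (\<lambda>x. Ks (f x))"
  unfolding Ks_def by (intro continuous_intros) (simp_all add: sinh_pi_pos less_imp_neq[symmetric])

text \<open>The integral of \<open>g (A y - A x) * n y\<close> over the period \<open>[x, x + 2 * pi]\<close>: the argument of the kernel stays in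
  \<open>[0, 2 * pi]\<close> when \<open>A\<close> is a lift of a circle map, so \<open>Kc\<close> and \<open>Ks\<close> need no periodic extension.\<close>

definition conv :: "(real \<Rightarrow> real) \<Rightarrow> (real \<Rightarrow> real) \<Rightarrow> (real \<Rightarrow> real) \<Rightarrow> real \<Rightarrow> real" where
  "conv g A n x = integral {0..2 * pi} (\<lambda>s. g (A (x + s) - A x) * n (x + s))"

context
  fixes A V n :: "real \<Rightarrow> real" and \<theta> :: real
  assumes A: "\<And>x. (A has_real_derivative V x) (at x)"
    and period_A: "\<And>x. A (x + 2 * pi) = A x + \<theta>"
    and n: "continuous_on UNIV n" "periodic_2pi n"
begin

private lemma cont_A: "continuous_on UNIV A"
  by (rule DERIV_continuous_on[where D=V]) (use A in simp)

text \<open>Both kernels are combinations of two exponentials, and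
  \<open>exp (A (x + s) - A x)\<close> factors. What remains under the integral depends on x only
  through the moving window, so \<open>conv\<close> can be differentiated although \<open>n\<close>
  is merely continuous.\<close>

private definition "Jp x = integral {0..2 * pi} (\<lambda>s. exp (A (x + s)) * n (x + s))"
private definition "Jm x = integral {0..2 * pi} (\<lambda>s. exp (- A (x + s)) * n (x + s))"

private lemma Jp: "(Jp has_real_derivative exp (A x) * n x * (exp \<theta> - 1)) (at x)"
proof -
  have "continuous_on UNIV (\<lambda>x. exp (A x) * n x)" by (intro continuous_intros cont_A n)
  from integral_period_shift[OF this, of x] show ?thesis
    unfolding Jp_def[abs_def] period_A n(2)[unfolded periodic_2pi_def, rule_format]
    by (simp add: exp_add algebra_simps)
qed

private lemma Jm: "(Jm has_real_derivative exp (- A x) * n x * (exp (- \<theta>) - 1)) (at x)"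
proof -
  have "continuous_on UNIV (\<lambda>x. exp (- A x) * n x)" by (intro continuous_intros cont_A n)
  from integral_period_shift[OF this, of x] show ?thesis
    unfolding Jm_def[abs_def] period_A n(2)[unfolded periodic_2pi_def, rule_format]
    by (simp add: exp_add exp_diff exp_minus field_simps)
qed

private lemma conv_exp:
  "conv (\<lambda>y. a * exp (y - pi) + b * exp (pi - y)) A n x
     = a * exp (- pi - A x) * Jp x + b * exp (pi + A x) * Jm x"
proof -
  have *: "continuous_on UNIV (\<lambda>s. A (x + s))" "continuous_on UNIV (\<lambda>s. n (x + s))"
    by (rule continuous_on_compose2[OF cont_A] continuous_on_compose2[OF n(1)]; auto intro: continuous_intros)+
  have **: "continuous_on {0..2*pi} (\<lambda>s. A (x + s))" "continuous_on {0..2*pi} (\<lambda>s. n (x + s))"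
    using *[THEN continuous_on_subset, of "{0..2*pi}"] by auto
  have "conv (\<lambda>y. a * exp (y - pi) + b * exp (pi - y)) A n x =
    integral {0..2 * pi} (\<lambda>s. a * exp (- pi - A x) * (exp (A (x + s)) * n (x + s))
       + b * exp (pi + A x) * (exp (- A (x + s)) * n (x + s)))"
    unfolding conv_def by (rule integral_cong) (simp add: exp_add exp_diff exp_minus field_simps)
  also have "\<dots> = a * exp (- pi - A x) * Jp x + b * exp (pi + A x) * Jm x"
    unfolding Jp_def Jm_def
    by (subst integral_add) (auto intro!: integrable_continuous_real continuous_intros **)
  finally show ?thesis .
qed

text \<open>The factor \<open>A x\<close> in the kernel contributes \<open>- V x\<close> times the
  integral of the differentiated kernel, and the two ends of the window contribute the end values of
  the kernel. A general increment \<theta> is carried along because the circumference is not yet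
  known to be \<open>2 * pi\<close>.\<close>

lemma conv_Kc_deriv:
  "((conv Kc A n) has_real_derivative - V x * conv Ks A n x + (Kc \<theta> - Kc 0) * n x) (at x)"
proof -
  define c where "c = 1 / (4 * sinh pi :: real)"
  have Kc: "Kc = (\<lambda>y. c * exp (y - pi) + c * exp (pi - y))"
    by (auto simp: Kc_exp c_def field_simps)
  have Ks: "Ks = (\<lambda>y. c * exp (y - pi) + (- c) * exp (pi - y))"
    by (auto simp: Ks_exp c_def field_simps)
  show ?thesis
    unfolding Kc Ks conv_exp[abs_def]
    by (rule derivative_eq_intros A Jp Jm refl)+
      (simp add: exp_add exp_diff exp_minus field_simps)
qed

lemma conv_Ks_deriv:
  "((conv Ks A n) has_real_derivative - V x * conv Kc A n x + (Ks \<theta> - Ks 0) * n x) (at x)"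
proof -
  define c where "c = 1 / (4 * sinh pi :: real)"
  have Kc: "Kc = (\<lambda>y. c * exp (y - pi) + c * exp (pi - y))"
    by (auto simp: Kc_exp c_def field_simps)
  have Ks: "Ks = (\<lambda>y. c * exp (y - pi) + (- c) * exp (pi - y))"
    by (auto simp: Ks_exp c_def field_simps)
  show ?thesis
    unfolding Kc Ks conv_exp[abs_def]
    by (rule derivative_eq_intros A Jp Jm refl)+
      (simp add: exp_add exp_diff exp_minus field_simps)
qed

lemma conv_periodic: "periodic_2pi (conv g A n)"
proof -
  have "A (x + 2 * pi + s) - A (x + 2 * pi) = A (x + s) - A x"
    "n (x + 2 * pi + s) = n (x + s)" for x s
    using period_A[of "x + s"] period_A[of x] n(2)[unfolded periodic_2pi_def, rule_format, of "x + s"]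
    by (simp_all add: algebra_simps)
  then show ?thesis unfolding periodic_2pi_def conv_def by simp
qed

end

lemma antider_shift:
  assumes "continuous_on UNIV v" "periodic_2pi v"
  shows "antider v (x + 2 * pi) = antider v x + antider v (2 * pi)"
proof -
  have "((\<lambda>x. antider v (x + 2 * pi) - antider v x) has_real_derivative 0) (at y)" for y
  proof -
    have "((\<lambda>x. antider v (x + 2 * pi)) has_real_derivative v (y + 2 * pi)) (at y)"
      using antider_deriv[OF assms(1)] by (simp add: DERIV_shift[symmetric])
    from DERIV_diff[OF this antider_deriv[OF assms(1)]] show ?thesis
      using assms(2) by (simp add: periodic_2pi_def)
  qed
  from DERIV_isconst_all[OF allI[OF this], of x 0] show ?thesis by simp
qed

lemma conv_jcont:
  assumes "\<And>X f. continuous_on X f \<Longrightarrow> continuous_on X (\<lambda>x::(real \<times> real) \<times> real. g (f x))"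
    "jcont S A" "jcont S n"
  shows "jcont S (\<lambda>t. conv g (A t) (n t))"
  unfolding conv_def
  by (rule jcont_integral_param)
    (auto simp: case_prod_unfold intro!: assms(1) continuous_intros jcont_comp[OF assms(2)] jcont_comp[OF assms(3)])

section \<open>A truncated flow\<close>

definition clamp_abs :: "real \<Rightarrow> real \<Rightarrow> real" where
  "clamp_abs b y = max (- b) (min b y)"

lemma clamp_abs_bound: "0 \<le> b \<Longrightarrow> \<bar>clamp_abs b y\<bar> \<le> b"
  and clamp_abs_lipschitz: "\<bar>clamp_abs b y - clamp_abs b z\<bar> \<le> \<bar>y - z\<bar>"
  and clamp_abs_id: "\<bar>y\<bar> \<le> b \<Longrightarrow> clamp_abs b y = y"
  by (auto simp: clamp_abs_def max_def min_def)

lemma continuous_clamp_abs [continuous_intros]: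
  "continuous_on X f \<Longrightarrow> continuous_on X (\<lambda>x. clamp_abs b (f x))"
  unfolding clamp_abs_def by (intro continuous_intros)

text \<open>The Eulerian slope \<open>u_x\<close> at \<open>\<eta>(x)\<close>, as a function of \<open>l = ln \<eta>_x\<close> alone: it uses the
  conservation law \<open>m(\<eta>) \<eta>_x^2 = m0\<close> for \<open>m = u - u_xx\<close>.\<close>

definition slope :: "(real \<Rightarrow> real) \<Rightarrow> (real \<Rightarrow> real) \<Rightarrow> real \<Rightarrow> real" where
  "slope m0 l x = - conv Ks (antider (\<lambda>y. exp (l y))) (\<lambda>y. m0 y * exp (- l y)) x"

lemma exp_lipschitz:
  fixes x y :: real
  assumes "\<bar>x\<bar> \<le> 1" "\<bar>y\<bar> \<le> 1"
  shows "\<bar>exp x - exp y\<bar> \<le> 3 * \<bar>x - y\<bar>"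
proof -
  have e: "exp (1::real) \<le> 3" using exp_le by simp
  have "norm (exp x - exp y) \<le> 3 * norm (x - y)"
    by (rule field_differentiable_bound[where S="{-1..1}" and f'=exp])
      (use assms in \<open>auto intro!: derivative_eq_intros order_trans[OF _ e]\<close>)
  then show ?thesis by simp
qed

lemma exp_abs_le_3: "\<bar>x::real\<bar> \<le> 1 \<Longrightarrow> exp x \<le> 3"
  using exp_le exp_le_cancel_iff[of x 1] by linarith

lemma slope_lipschitz:
  assumes m0: "continuous_on UNIV m0" "periodic_2pi m0"
  shows "\<exists>L>0. \<forall>l1 l2 \<delta> x. continuous_on UNIV l1 \<longrightarrow> continuous_on UNIV l2 \<longrightarrow> (\<forall>y. \<bar>l1 y\<bar> \<le> 1)
    \<longrightarrow> (\<forall>y. \<bar>l2 y\<bar> \<le> 1) \<longrightarrow> (\<forall>y. \<bar>l1 y - l2 y\<bar> \<le> \<delta>) \<longrightarrow> \<bar>slope m0 l1 x - slope m0 l2 x\<bar> \<le> L * \<delta>"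
proof -
  obtain B where B: "B > 0" "\<And>x. \<bar>m0 x\<bar> \<le> B" using periodic_bounded[OF m0] by blast
  \<comment> \<open>Since \<open>exp l\<close> is at most 3 for \<open>l\<close> in
    \<open>[-1, 1]\<close>, increments of either antiderivative over a period stay in this
    interval.\<close>
  let ?I = "{-(6*pi)..6*pi}"
  have "bounded (Ks ` ?I)" "bounded (Kc ` ?I)"
    by (intro compact_imp_bounded compact_continuous_image continuous_intros; simp)+
  then obtain C1 C2 where C12: "\<And>y. y \<in> ?I \<Longrightarrow> \<bar>Ks y\<bar> \<le> C1" "\<And>y. y \<in> ?I \<Longrightarrow> \<bar>Kc y\<bar> \<le> C2"
    by (meson bounded_real imageI)
  define C where "C = max 1 (max C1 C2)"
  have C: "C > 0" "\<And>y. y \<in> ?I \<Longrightarrow> \<bar>Ks y\<bar> \<le> C" "\<And>y. y \<in> ?I \<Longrightarrow> \<bar>Kc y\<bar> \<le> C"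
    using C12 by (auto simp: C_def max_def)  (smt (verit))+
  \<comment> \<open>The first summand is the change of the kernel, whose argument moves by at most
    \<open>6 * pi * \<delta>\<close> against a density of size \<open>3 * B\<close>; the second is
    the change of the density.\<close>
  define L where "L = 2 * pi * (C * (6 * pi) * (3 * B) + C * (3 * B))"
  show ?thesis
  proof (intro exI[of _ L] conjI allI impI)
    show "L > 0" using B C unfolding L_def by (intro mult_pos_pos add_pos_pos) auto
    fix l1 l2 :: "real \<Rightarrow> real" and \<delta> x :: real
    assume c: "continuous_on UNIV l1" "continuous_on UNIV l2"
      and le1: "\<forall>y. \<bar>l1 y\<bar> \<le> 1" "\<forall>y. \<bar>l2 y\<bar> \<le> 1" and d: "\<forall>y. \<bar>l1 y - l2 y\<bar> \<le> \<delta>"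
    have d0: "\<delta> \<ge> 0" using d[rule_format, of 0] by linarith
    let ?A1 = "antider (\<lambda>y. exp (l1 y))" and ?A2 = "antider (\<lambda>y. exp (l2 y))"
    have A1: "(?A1 has_real_derivative exp (l1 y)) (at y)" for y
      by (intro antider_deriv continuous_intros c)
    have A2: "(?A2 has_real_derivative exp (l2 y)) (at y)" for y
      by (intro antider_deriv continuous_intros c)
    have incr: "\<bar>A (x + s) - A x\<bar> \<le> k * s" if "s \<ge> 0" and "\<And>y. (A has_real_derivative a y) (at y)"
      "\<And>y. \<bar>a y\<bar> \<le> k" for A a :: "real \<Rightarrow> real" and k s
      using field_differentiable_bound[of UNIV A a k "x + s" x] that by auto
    have integrand: "\<bar>Ks (?A1 (x + s) - ?A1 x) * (m0 (x + s) * exp (- l1 (x + s)))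
        - Ks (?A2 (x + s) - ?A2 x) * (m0 (x + s) * exp (- l2 (x + s)))\<bar>
        \<le> (C * (6 * pi) * (3 * B) + C * (3 * B)) * \<delta>" if s: "s \<in> {0..2 * pi}" for s
    proof -
      let ?a1 = "?A1 (x + s) - ?A1 x" and ?a2 = "?A2 (x + s) - ?A2 x"
      have s3: "3 * s \<le> 6 * pi" using s by simp
      have a1: "\<bar>?a1\<bar> \<le> 3 * s" using incr[OF _ A1, of s 3] s le1 exp_abs_le_3 by auto
      have a2: "\<bar>?a2\<bar> \<le> 3 * s" using incr[OF _ A2, of s 3] s le1 exp_abs_le_3 by auto
      have in12: "?a1 \<in> ?I" "?a2 \<in> ?I" using a1 a2 s3 by auto
      have D: "\<bar>(?A1 (x + s) - ?A2 (x + s)) - (?A1 x - ?A2 x)\<bar> \<le> (3 * \<delta>) * s"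
      proof (rule incr[of s "\<lambda>y. ?A1 y - ?A2 y" "\<lambda>y. exp (l1 y) - exp (l2 y)" "3 * \<delta>"])
        show "\<bar>exp (l1 y) - exp (l2 y)\<bar> \<le> 3 * \<delta>" for y
          using exp_lipschitz[of "l1 y" "l2 y"] le1 d by (smt (verit))
      qed (use s in \<open>auto intro!: derivative_intros A1 A2\<close>)
      also have "\<dots> \<le> 3 * \<delta> * (2 * pi)" using s d0 by (intro mult_left_mono) auto
      finally have D: "\<bar>?a1 - ?a2\<bar> \<le> 6 * pi * \<delta>" by (simp add: algebra_simps)
      have "norm (Ks ?a1 - Ks ?a2) \<le> C * norm (?a1 - ?a2)"
        by (rule field_differentiable_bound[where S="?I" and f'=Kc])
          (use in12 C in \<open>auto intro!: DERIV_subset[OF Ks_deriv]\<close>)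
      also have "\<dots> \<le> C * (6 * pi * \<delta>)" using D C(1) by (intro mult_left_mono) auto
      finally have K: "\<bar>Ks ?a1 - Ks ?a2\<bar> \<le> C * (6 * pi * \<delta>)" by simp
      have n1: "\<bar>m0 (x + s) * exp (- l1 (x + s))\<bar> \<le> B * 3"
        unfolding abs_mult using B exp_abs_le_3[of "- l1 (x + s)"] le1 by (intro mult_mono) auto
      have n12: "\<bar>m0 (x + s) * exp (- l1 (x + s)) - m0 (x + s) * exp (- l2 (x + s))\<bar> \<le> B * (3 * \<delta>)"
      proof -
        have "\<bar>exp (- l1 (x + s)) - exp (- l2 (x + s))\<bar> \<le> 3 * \<delta>"
          using exp_lipschitz[of "- l1 (x + s)" "- l2 (x + s)"] le1 d by (smt (verit))
        then have "\<bar>m0 (x + s)\<bar> * \<bar>exp (- l1 (x + s)) - exp (- l2 (x + s))\<bar> \<le> B * (3 * \<delta>)"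
          using B by (intro mult_mono) auto
        then show ?thesis by (simp add: abs_mult[symmetric] right_diff_distrib)
      qed
      have split: "Ks ?a1 * N1 - Ks ?a2 * N2 = (Ks ?a1 - Ks ?a2) * N1 + Ks ?a2 * (N1 - N2)" for N1 N2
        by (simp add: algebra_simps)
      have "\<bar>Ks ?a1 * N1 - Ks ?a2 * N2\<bar> \<le> C * (6 * pi * \<delta>) * (B * 3) + C * (B * (3 * \<delta>))"
        if "\<bar>N1\<bar> \<le> B * 3" "\<bar>N1 - N2\<bar> \<le> B * (3 * \<delta>)" for N1 N2
        unfolding split
        by (rule order_trans[OF abs_triangle_ineq], unfold abs_mult, intro add_mono mult_mono)
          (use that K C in12 d0 B in auto)
      from this[OF n1 n12] show ?thesis by (simp add: algebra_simps)
    qed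
    have cont: "continuous_on {0..2*pi} (\<lambda>s. Ks (antider (\<lambda>y. exp (l y)) (x + s) - antider (\<lambda>y. exp (l y)) x)
       * (m0 (x + s) * exp (- l (x + s))))" if l: "continuous_on UNIV l" for l
    proof -
      have A: "continuous_on UNIV (antider (\<lambda>y. exp (l y)))"
        by (rule DERIV_continuous_on[OF antider_deriv]) (intro continuous_intros l)
      show ?thesis
        by (intro continuous_intros continuous_on_compose2[OF A] continuous_on_compose2[OF l]
            continuous_on_compose2[OF m0(1)]) auto
    qed
    have "slope m0 l2 x - slope m0 l1 x = integral {0..2 * pi} (\<lambda>s.
        Ks (?A1 (x + s) - ?A1 x) * (m0 (x + s) * exp (- l1 (x + s)))
        - Ks (?A2 (x + s) - ?A2 x) * (m0 (x + s) * exp (- l2 (x + s))))"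
      unfolding slope_def conv_def
      by (subst integral_diff) (auto intro!: integrable_continuous_real cont c)
    also have "norm \<dots> \<le> ((C * (6 * pi) * (3 * B) + C * (3 * B)) * \<delta>) * (2 * pi - 0)"
      by (rule integral_bound) (use integrand cont c in \<open>auto intro!: continuous_on_diff\<close>)
    finally show "\<bar>slope m0 l1 x - slope m0 l2 x\<bar> \<le> L * \<delta>"
      by (simp add: L_def algebra_simps abs_minus_commute)
  qed
qed

lemma slope_jcont:
  assumes "jcont S l" "continuous_on UNIV m0"
  shows "jcont S (\<lambda>t. slope m0 (l t))"
proof -
  have e: "jcont S (\<lambda>t x. exp (l t x))" "jcont S (\<lambda>t x. m0 x * exp (- l t x))"
    using assms(1) unfolding jcont_def case_prod_unfold
    by (intro continuous_intros continuous_on_compose2[OF assms(2)]; auto)+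
  have "jcont S (\<lambda>t. conv Ks (antider (\<lambda>y. exp (l t y))) (\<lambda>y. m0 y * exp (- l t y)))"
    by (rule conv_jcont[OF _ antider_jcont[OF e(1)] e(2)]) (intro continuous_intros)
  then show ?thesis unfolding jcont_def slope_def case_prod_unfold by (intro continuous_intros)
qed

lemma slope_periodic:
  assumes "continuous_on UNIV l" "periodic_2pi l" "continuous_on UNIV m0" "periodic_2pi m0"
  shows "periodic_2pi (slope m0 l)"
proof -
  have "periodic_2pi (conv Ks (antider (\<lambda>y. exp (l y))) (\<lambda>y. m0 y * exp (- l y)))"
  proof (rule conv_periodic)
    show "antider (\<lambda>y. exp (l y)) (x + 2 * pi)
        = antider (\<lambda>y. exp (l y)) x + antider (\<lambda>y. exp (l y)) (2 * pi)" for x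
      by (rule antider_shift) (use assms in \<open>auto simp: periodic_2pi_def intro!: continuous_intros\<close>)
    show "(antider (\<lambda>y. exp (l y)) has_real_derivative exp (l x)) (at x)" for x
      by (intro antider_deriv continuous_intros assms)
  qed (use assms in \<open>auto simp: periodic_2pi_def intro!: continuous_intros\<close>)
  then show ?thesis by (simp add: periodic_2pi_def slope_def)
qed

text \<open>Clamping the slope makes the vector field globally Lipschitz, so that Picard iteration reaches \<open>T\<close> in one step.\<close>

lemma truncated_flow_exists:
  assumes m0: "continuous_on UNIV m0" "periodic_2pi m0" and b: "b > 0" and T: "T > 0" and bT: "b * T \<le> 1"
  shows "\<exists>l. jcont {0..T} l \<and> (\<forall>x. l 0 x = 0) \<and>
     (\<forall>t\<in>{0..T}. periodic_2pi (l t) \<and> (\<forall>x. \<bar>l t x\<bar> \<le> b * t \<and>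
        ((\<lambda>s. l s x) has_real_derivative clamp_abs b (slope m0 (l t) x)) (at t within {0..T})))"
proof -
  obtain \<Lambda> where \<Lambda>: "\<Lambda> > 0" and lip: "\<And>l1 l2 \<delta> x. continuous_on UNIV l1 \<Longrightarrow> continuous_on UNIV l2
      \<Longrightarrow> (\<And>y. \<bar>l1 y\<bar> \<le> 1) \<Longrightarrow> (\<And>y. \<bar>l2 y\<bar> \<le> 1) \<Longrightarrow> (\<And>y. \<bar>l1 y - l2 y\<bar> \<le> \<delta>)
      \<Longrightarrow> \<bar>slope m0 l1 x - slope m0 l2 x\<bar> \<le> \<Lambda> * \<delta>"
    using slope_lipschitz[OF m0] by metis
  \<comment> \<open>Exponential weight of the norm: the fixed point is sought for
    \<open>exp (- L * t) * l t x\<close>, and integrating the Lipschitz bound in time then gives the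
    contraction factor \<open>\<Lambda> / L = 1 / 2\<close> whatever \<open>T\<close> is.\<close>
  define L where "L = 2 * \<Lambda>"
  have L: "L > 0" using \<Lambda> by (simp add: L_def)
  \<comment> \<open>Freezing time outside \<open>[0, T]\<close> makes the iterates bounded
    continuous functions on the whole plane, as the complete space of type \<open>bcontfun\<close>
    requires.\<close>
  define \<tau> where "\<tau> t = max 0 (min T t)" for t
  have \<tau>: "\<tau> t \<in> {0..T}" for t using T by (auto simp: \<tau>_def)
  have \<tau>_id: "\<tau> t = t" if "t \<in> {0..T}" for t using that by (auto simp: \<tau>_def)
  have \<tau>_cont: "continuous_on X \<tau>" for X unfolding \<tau>_def by (intro continuous_intros)
  define lp where "lp p t x = exp (L * t) * apply_bcontfun p (t, x)" for p :: "(real \<times> real) \<Rightarrow>\<^sub>C real" and t x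
  have lp_cont: "jcont S (lp p)" for p S
    unfolding jcont_def lp_def case_prod_unfold
    by (intro continuous_intros continuous_on_compose2[OF continuous_on_apply_bcontfun[of UNIV p]]) auto
  \<comment> \<open>The bound 1 is the range on which \<open>slope\<close> is Lipschitz;
    \<open>b * T \<le> 1\<close> keeps the iteration inside it.\<close>
  define S where "S = {p. \<forall>t\<in>{0..T}. \<forall>x. \<bar>lp p t x\<bar> \<le> 1 \<and> lp p t (x + 2 * pi) = lp p t x}"
  define g where "g p s x = clamp_abs b (slope m0 (lp p (\<tau> s)) x)" for p s x
  have g_j: "jcont UNIV (g p)" for p
  proof -
    have "jcont UNIV (\<lambda>t. lp p (\<tau> t))"
      unfolding jcont_def case_prod_unfold
      by (rule jcont_comp[OF lp_cont]) (auto intro!: continuous_on_compose2[OF \<tau>_cont] continuous_intros)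
    from slope_jcont[OF this m0(1)] show ?thesis
      unfolding g_def jcont_def case_prod_unfold by (intro continuous_intros)
  qed
  have g_cont: "continuous_on UNIV (\<lambda>s. g p s x)" for p x using jcont_time[OF g_j] by simp
  define \<Phi> where "\<Phi> p t x = antider (\<lambda>s. g p s x) (\<tau> t)" for p t x
  have \<Phi>_bound: "\<bar>\<Phi> p t x\<bar> \<le> b * \<tau> t" for p t x
    unfolding \<Phi>_def by (rule antider_bound_const[OF g_cont]) (use \<tau>[of t] b in \<open>auto simp: g_def clamp_abs_bound\<close>)
  have \<Phi>_1: "\<bar>\<Phi> p t x\<bar> \<le> 1" for p t x
  proof -
    have "b * \<tau> t \<le> b * T" using b \<tau>[of t] by simp
    with \<Phi>_bound[of p t x] bT show ?thesis by linarith
  qed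
  have \<Phi>_j: "jcont UNIV (\<Phi> p)" for p
  proof -
    have "jcont UNIV (\<lambda>x s. g p s x)"
      unfolding jcont_def case_prod_unfold by (rule jcont_comp[OF g_j]) (auto intro!: continuous_intros)
    from antider_jcont[OF this] have "jcont UNIV (\<lambda>x t. antider (\<lambda>s. g p s x) t)" by simp
    then show ?thesis unfolding \<Phi>_def jcont_def[of _ "\<lambda>t x. antider (\<lambda>s. g p s x) (\<tau> t)"] case_prod_unfold
      by (rule jcont_comp) (auto intro!: continuous_on_compose2[OF \<tau>_cont] continuous_intros)
  qed
  define \<Psi> where "\<Psi> p = Bcontfun (\<lambda>z. exp (- L * \<tau> (fst z)) * \<Phi> p (fst z) (snd z))" for p
  have \<Psi>: "apply_bcontfun (\<Psi> p) (t, x) = exp (- L * \<tau> t) * \<Phi> p t x" for p t x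
  proof -
    have "(\<lambda>z. exp (- L * \<tau> (fst z)) * \<Phi> p (fst z) (snd z)) \<in> bcontfun"
    proof (rule bcontfun_normI)
      show "continuous_on UNIV (\<lambda>z. exp (- L * \<tau> (fst z)) * \<Phi> p (fst z) (snd z))"
        using \<Phi>_j[of p] unfolding jcont_def case_prod_unfold
        by (auto intro!: continuous_intros continuous_on_compose2[OF \<tau>_cont])
      fix z :: "real \<times> real"
      have "exp (- L * \<tau> (fst z)) \<le> 1" using L \<tau>[of "fst z"] by simp
      then show "norm (exp (- L * \<tau> (fst z)) * \<Phi> p (fst z) (snd z)) \<le> 1"
        using \<Phi>_1[of p "fst z" "snd z"] by (simp add: abs_mult mult_le_one)
    qed
    then show ?thesis unfolding \<Psi>_def by (simp add: Bcontfun_inverse)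
  qed
  have lp_\<Psi>: "lp (\<Psi> p) t x = \<Phi> p t x" if "t \<in> {0..T}" for p t x
    using \<tau>_id[OF that] by (simp add: lp_def \<Psi> exp_minus)
  have "\<exists>!p. p \<in> S \<and> \<Psi> p = p"
  proof (rule Banach_fix[where c="1/2"])
    have "closed S"
    proof -
      have ev: "continuous_on UNIV (\<lambda>p. apply_bcontfun p z)" for z :: "real \<times> real"
        by (rule continuous_on_apply_bcontfun[THEN continuous_on_compose2] | 
            rule lipschitz_on_continuous_on[of 1])
          (auto simp: lipschitz_on_def dist_bounded)
      have "S = (\<Inter>t\<in>{0..T}. \<Inter>x. {p. \<bar>lp p t x\<bar> \<le> 1} \<inter> {p. lp p t (x + 2 * pi) = lp p t x})"
        by (auto simp: S_def)
      also have "closed \<dots>" unfolding lp_def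
        by (intro closed_INT ballI closed_Int closed_Collect_le closed_Collect_eq continuous_intros
            ev continuous_on_compose2[OF ev]) auto
      finally show ?thesis .
    qed
    then show "complete S" by (simp add: complete_eq_closed)
    show "S \<noteq> {}" by (auto simp: S_def lp_def intro!: exI[of _ 0])
    show "\<Psi> ` S \<subseteq> S"
    proof safe
      fix p assume p: "p \<in> S"
      have "\<Phi> p t (x + 2 * pi) = \<Phi> p t x" for t x
      proof -
        have "g p s (x + 2 * pi) = g p s x" for s
        proof -
          have "periodic_2pi (lp p (\<tau> s))" using p \<tau>[of s] by (auto simp: S_def periodic_2pi_def)
          from slope_periodic[OF jcont_section[OF lp_cont[of UNIV]] this m0] show ?thesis
            by (simp add: g_def periodic_2pi_def)
        qed
        then show ?thesis by (simp add: \<Phi>_def)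
      qed
      then show "\<Psi> p \<in> S" using \<Phi>_1 by (auto simp: S_def lp_\<Psi>)
    qed
    show "dist (\<Psi> p) (\<Psi> q) \<le> 1 / 2 * dist p q" if pq: "p \<in> S" "q \<in> S" for p q
    proof (rule dist_bound, clarify)
      fix t x :: real
      let ?d = "dist p q"
      have gd: "\<bar>g p s x - g q s x\<bar> \<le> \<Lambda> * (exp (L * s) * ?d)" if "0 \<le> s" "s \<le> \<tau> t" for s
      proof -
        have s: "s \<in> {0..T}" using that \<tau>[of t] by auto
        have "\<bar>slope m0 (lp p s) x - slope m0 (lp q s) x\<bar> \<le> \<Lambda> * (exp (L * s) * ?d)"
        proof (rule lip)
          show "\<bar>lp p s y\<bar> \<le> 1" "\<bar>lp q s y\<bar> \<le> 1" for y using pq s by (auto simp: S_def)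
          show "\<bar>lp p s y - lp q s y\<bar> \<le> exp (L * s) * ?d" for y
            using dist_bounded[of p "(s, y)" q]
            by (simp add: lp_def right_diff_distrib[symmetric] abs_mult dist_real_def)
        qed (use jcont_section[OF lp_cont[of UNIV]] in auto)
        then show ?thesis unfolding g_def \<tau>_id[OF s]
          using clamp_abs_lipschitz order_trans by blast
      qed
      have "\<Phi> p t x - \<Phi> q t x = antider (\<lambda>s. g p s x - g q s x) (\<tau> t)"
      proof -
        have "((\<lambda>t. antider (\<lambda>s. g p s x) t - antider (\<lambda>s. g q s x) t) has_real_derivative g p y x - g q y x) (at y)" for y
          by (intro derivative_intros antider_deriv g_cont)
        from antider_eq[OF this] show ?thesis by (simp add: \<Phi>_def)
      qed
      also have "\<bar>\<dots>\<bar> \<le> \<Lambda> * ?d * exp (L * \<tau> t) / L - \<Lambda> * ?d * exp (L * 0) / L"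
        by (rule antider_bound[where g="\<lambda>s. \<Lambda> * (exp (L * s) * ?d)"])
          (use gd \<tau>[of t] L in \<open>auto intro!: continuous_intros g_cont derivative_eq_intros\<close>)
      also have "\<dots> \<le> 1 / 2 * ?d * exp (L * \<tau> t)"
        using \<Lambda> by (simp add: L_def divide_simps)
      finally have "\<bar>\<Phi> p t x - \<Phi> q t x\<bar> \<le> 1 / 2 * ?d * exp (L * \<tau> t)" .
      then have "exp (- L * \<tau> t) * \<bar>\<Phi> p t x - \<Phi> q t x\<bar> \<le> exp (- L * \<tau> t) * (1 / 2 * ?d * exp (L * \<tau> t))"
        by (intro mult_left_mono) auto
      also have "\<dots> = 1 / 2 * ?d" by (simp add: exp_minus)
      finally show "dist (apply_bcontfun (\<Psi> p) (t, x)) (apply_bcontfun (\<Psi> q) (t, x)) \<le> 1 / 2 * ?d"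
        by (simp add: \<Psi> dist_real_def right_diff_distrib[symmetric] abs_mult)
    qed
  qed auto
  then obtain p where p: "p \<in> S" "\<Psi> p = p" by blast
  have lp_eq: "lp p t x = antider (\<lambda>s. g p s x) t" if "t \<in> {0..T}" for t x
    using lp_\<Psi>[OF that, of p x] p(2) \<tau>_id[OF that] by (simp add: \<Phi>_def)
  show ?thesis
  proof (intro exI[of _ "lp p"] conjI ballI allI)
    show "jcont {0..T} (lp p)" by (rule lp_cont)
    show "lp p 0 x = 0" for x using lp_eq[of 0 x] T by simp
    fix t assume t: "t \<in> {0..T}"
    show "periodic_2pi (lp p t)" using p(1) t by (auto simp: S_def periodic_2pi_def)
    fix x
    show "\<bar>lp p t x\<bar> \<le> b * t" using \<Phi>_bound[of p t x] lp_\<Psi>[OF t, of p x] p(2) \<tau>_id[OF t] by simp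
    have "(antider (\<lambda>s. g p s x) has_real_derivative g p t x) (at t within {0..T})"
      using antider_deriv[OF g_cont] by (rule DERIV_subset) simp
    then show "((\<lambda>s. lp p s x) has_real_derivative clamp_abs b (slope m0 (lp p t) x)) (at t within {0..T})"
      unfolding g_def[of p t] \<tau>_id[OF t]
      by (rule has_field_derivative_transform_within[where d=1]) (use t lp_eq in auto)
  qed
qed

section \<open>Camassa-Holm in Lagrangian coordinates\<close>

text \<open>The case \<open>T = 0\<close> is admitted because the continuation argument of \<open>flow_exists\<close> starts there.\<close>

locale ch_flow =
  fixes T :: real and u0 u0' u0'' m0 :: "real \<Rightarrow> real" and l :: "real \<Rightarrow> real \<Rightarrow> real"
  assumes T: "0 \<le> T"
    and u0: "\<And>x. (u0 has_real_derivative u0' x) (at x)" "\<And>x. (u0' has_real_derivative u0'' x) (at x)"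
      "continuous_on UNIV u0''" "periodic_2pi u0" "periodic_2pi u0'" "periodic_2pi u0''"
    and m0_eq: "\<And>x. m0 x = u0 x - u0'' x"
    and l_j: "jcont {0..T} l" and l_0: "\<And>x. l 0 x = 0"
    and l_per: "\<And>t. t \<in> {0..T} \<Longrightarrow> periodic_2pi (l t)"
    and l_1: "\<And>t x. t \<in> {0..T} \<Longrightarrow> \<bar>l t x\<bar> \<le> 1"
    and l_t: "\<And>t x. t \<in> {0..T} \<Longrightarrow> ((\<lambda>s. l s x) has_real_derivative slope m0 (l t) x) (at t within {0..T})"
begin

text \<open>With \<eta> the flow: \<open>V\<close> is \<eta>_x, \<open>A\<close> is \<eta>
  normalised to vanish at 0, and \<open>n\<close> is m(\<eta>) \<eta>_x, equal to m0 / \<eta>_x by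
  the conservation law. \<open>U\<close>, \<open>W\<close>, \<open>F\<close>, \<open>P\<close> are
  u, u_x, u^2 + u_x^2 / 2 and (1 - d_x^2)^(-1) of the latter at \<eta>, and \<open>B\<close> is -
  P_x at \<eta>, the right side of the equation; the integrals are pulled back by the flow.\<close>

definition "V t x = exp (l t x)"
definition "A t = antider (V t)"
definition "n t x = m0 x * exp (- l t x)"
definition "U t = conv Kc (A t) (n t)"
definition "W t = slope m0 (l t)"
definition "F t x = (U t x)\<^sup>2 + (W t x)\<^sup>2 / 2"
definition "P t = conv Kc (A t) (\<lambda>x. F t x * V t x)"
definition "B t = conv Ks (A t) (\<lambda>x. F t x * V t x)"

lemma m0: "continuous_on UNIV m0" "periodic_2pi m0"
proof -
  have "continuous_on UNIV u0" using u0(1) by (intro DERIV_continuous_on) auto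
  then show "continuous_on UNIV m0" unfolding m0_eq[abs_def] by (intro continuous_intros u0)
  show "periodic_2pi m0" using u0 by (simp add: periodic_2pi_def m0_eq)
qed

lemma W_conv: "W t x = - conv Ks (A t) (n t) x"
  by (simp add: W_def slope_def A_def V_def[abs_def] n_def[abs_def])

lemma V_pos: "V t x > 0"
  by (simp add: V_def)

lemma V_j: "jcont {0..T} V"
  using l_j unfolding jcont_def V_def case_prod_unfold by (intro continuous_intros)

lemma n_j: "jcont {0..T} n"
  using l_j unfolding jcont_def n_def case_prod_unfold
  by (intro continuous_intros continuous_on_compose2[OF m0(1)]) auto

lemma A_j: "jcont {0..T} A"
  using antider_jcont[OF V_j] by (simp add: A_def[abs_def])

lemma W_j: "jcont {0..T} W"
  using slope_jcont[OF l_j m0(1)] by (simp add: W_def[abs_def])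

lemma U_j: "jcont {0..T} U"
  unfolding U_def[abs_def] by (rule conv_jcont[OF _ A_j n_j]) (intro continuous_intros)

lemma F_j: "jcont {0..T} F"
  using U_j W_j unfolding jcont_def F_def case_prod_unfold by (intro continuous_intros; simp)

lemma FV_j: "jcont {0..T} (\<lambda>t x. F t x * V t x)"
  using F_j V_j unfolding jcont_def case_prod_unfold by (intro continuous_intros)

lemma P_j: "jcont {0..T} P"
  unfolding P_def[abs_def] by (rule conv_jcont[OF _ A_j FV_j]) (intro continuous_intros)

lemma B_j: "jcont {0..T} B"
  unfolding B_def[abs_def] by (rule conv_jcont[OF _ A_j FV_j]) (intro continuous_intros)

lemma V_t: "t \<in> {0..T} \<Longrightarrow> ((\<lambda>s. V s x) has_real_derivative W t x * V t x) (at t within {0..T})"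
  unfolding V_def W_def by (rule derivative_eq_intros l_t refl | assumption)+ simp

lemma n_t: "t \<in> {0..T} \<Longrightarrow> ((\<lambda>s. n s x) has_real_derivative - W t x * n t x) (at t within {0..T})"
  unfolding n_def W_def by (rule derivative_eq_intros l_t refl | assumption)+ simp

context
  fixes t assumes t: "t \<in> {0..T}"
begin

lemma V_cont: "continuous_on X (V t)" by (rule jcont_section[OF V_j t])
lemma n_cont: "continuous_on X (n t)" by (rule jcont_section[OF n_j t])
lemma W_cont: "continuous_on X (W t)" by (rule jcont_section[OF W_j t])
lemma FV_cont: "continuous_on X (\<lambda>x. F t x * V t x)" by (rule jcont_section[OF FV_j t])

lemma V_per: "periodic_2pi (V t)" and n_per: "periodic_2pi (n t)"
  using l_per[OF t] m0(2) by (simp_all add: V_def n_def periodic_2pi_def)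

lemma A_x: "(A t has_real_derivative V t x) (at x)"
  unfolding A_def by (rule antider_deriv[OF V_cont])

lemma A_shift: "A t (x + 2 * pi) = A t x + A t (2 * pi)"
  unfolding A_def by (rule antider_shift[OF V_cont V_per])

lemma U_per: "periodic_2pi (U t)"
  unfolding U_def by (rule conv_periodic[OF A_x A_shift n_cont n_per])

lemma W_per: "periodic_2pi (W t)"
  unfolding W_def by (rule slope_periodic[OF jcont_section[OF l_j t] l_per[OF t] m0])

lemma FV_per: "periodic_2pi (\<lambda>x. F t x * V t x)"
  using U_per W_per V_per by (simp add: periodic_2pi_def F_def)

lemma U_x_raw: "(U t has_real_derivative W t x * V t x + (Kc (A t (2 * pi)) - Kc 0) * n t x) (at x)"
  using conv_Kc_deriv[OF A_x A_shift n_cont n_per, of x]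
  by (simp add: U_def W_conv mult.commute)

text \<open>This derivative becomes \<open>U t x - U t 0\<close> only after the circumference is
  known, since only then \<open>W * V\<close> is the derivative of \<open>U\<close>.\<close>

lemma A_t_raw: "((\<lambda>s. A s x) has_real_derivative antider (\<lambda>y. W t y * V t y) x) (at t within {0..T})"
proof -
  have "((\<lambda>s. integral {0..1} (\<lambda>r. V s (x * r))) has_real_derivative
      integral {0..1} (\<lambda>r. W t (x * r) * V t (x * r))) (at t within {0..T})"
  proof (rule leibniz_interval)
    show "continuous_on ({0..T} \<times> {0..1}) (\<lambda>(s, r). W s (x * r) * V s (x * r))"
      unfolding case_prod_unfold by (intro continuous_intros jcont_comp[OF W_j] jcont_comp[OF V_j]) auto
    show "continuous_on {0..1} (\<lambda>r. V s (x * r))" if "s \<in> {0..T}" for s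
      by (rule jcont_comp[OF V_j]) (use that in \<open>auto intro!: continuous_intros\<close>)
  qed (use t V_t in auto)
  then show ?thesis unfolding A_def antider_def by (intro DERIV_cmult)
qed

end

text \<open>Before the circumference \<open>\<theta> = A t (2 * pi)\<close> is known, the derivative of \<open>U\<close> carries the defect
  \<open>(Kc \<theta> - Kc 0) * n\<close>. Integrated over a period it turns into a differential equation for \<open>\<theta>\<close> of which
  \<open>2 * pi\<close> is a stationary solution.\<close>

lemma circumference: assumes "t \<in> {0..T}" shows "A t (2 * pi) = 2 * pi"
proof -
  define \<theta> where "\<theta> t = A t (2 * pi)" for t
  have "jcont {0..T} (\<lambda>t. antider (n t))" by (rule antider_jcont[OF n_j])
  then have "continuous_on {0..T} (\<lambda>t. antider (n t) (2 * pi))" "continuous_on {0..T} \<theta>"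
    using jcont_time[OF A_j] jcont_time by (auto simp: \<theta>_def[abs_def])
  then have "bounded ((\<lambda>t. antider (n t) (2 * pi)) ` {0..T})" "bounded (\<theta> ` {0..T})"
    by (auto intro!: compact_imp_bounded compact_continuous_image)
  then obtain N R where N: "\<And>t. t \<in> {0..T} \<Longrightarrow> \<bar>antider (n t) (2 * pi)\<bar> \<le> N"
    and R: "\<And>t. t \<in> {0..T} \<Longrightarrow> \<bar>\<theta> t\<bar> \<le> R"
    by (meson bounded_real imageI)
  define I where "I = {- max R (2 * pi)..max R (2 * pi)}"
  have "bounded (Ks ` I)"
    unfolding I_def by (intro compact_imp_bounded compact_continuous_image continuous_intros) simp
  then obtain C where C: "\<And>y. y \<in> I \<Longrightarrow> \<bar>Ks y\<bar> \<le> C" by (meson bounded_real imageI)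
  \<comment> \<open>\<open>Kc\<close> takes equal values at 0 and \<open>2 * pi\<close>, so the
    defect is Lipschitz in the distance from \<theta> to \<open>2 * pi\<close>. Hence the squared
    distance satisfies a linear differential inequality.\<close>
  have Clip: "\<bar>Kc (\<theta> t) - Kc 0\<bar> \<le> C * \<bar>\<theta> t - 2 * pi\<bar>" if "t \<in> {0..T}" for t
  proof -
    have "norm (Kc (\<theta> t) - Kc (2 * pi)) \<le> C * norm (\<theta> t - 2 * pi)"
    proof (rule field_differentiable_bound)
      show "convex I" unfolding I_def by simp
      show "\<theta> t \<in> I" "2 * pi \<in> I" using R[OF that] pi_gt_zero unfolding I_def max_def abs_le_iff atLeastAtMost_iff
        by (smt (verit))+
      show "(Kc has_field_derivative Ks y) (at y within I)" for y by (rule DERIV_subset[OF Kc_deriv]) simp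
      show "norm (Ks y) \<le> C" if "y \<in> I" for y using C[OF that] by simp
    qed
    then show ?thesis by (simp add: Kc_2pi)
  qed
  have \<theta>_t: "(\<theta> has_real_derivative - (Kc (\<theta> t) - Kc 0) * antider (n t) (2 * pi)) (at t within {0..T})"
    if t: "t \<in> {0..T}" for t
  proof -
    define c where "c = Kc (\<theta> t) - Kc 0"
    have c1: "antider (\<lambda>y. W t y * V t y + c * n t y) (2 * pi) = U t (2 * pi) - U t 0"
      by (rule antider_eq) (use U_x_raw[OF t] in \<open>simp add: c_def \<theta>_def\<close>)
    have "antider (\<lambda>y. W t y * V t y + c * n t y) (2 * pi)
        = antider (\<lambda>y. W t y * V t y) (2 * pi) + c * antider (n t) (2 * pi)"
    proof -
      have WV: "continuous_on UNIV (\<lambda>y. W t y * V t y)" by (intro continuous_intros W_cont V_cont t)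
      have "antider (\<lambda>y. W t y * V t y + c * n t y) (2 * pi)
        = (\<lambda>x. antider (\<lambda>y. W t y * V t y) x + c * antider (n t) x) (2 * pi)
          - (\<lambda>x. antider (\<lambda>y. W t y * V t y) x + c * antider (n t) x) 0"
        by (rule antider_eq) (auto intro!: derivative_eq_intros antider_deriv n_cont t WV)
      then show ?thesis by simp
    qed
    moreover have "U t (2 * pi) = U t 0" using U_per[OF t] unfolding periodic_2pi_def by (metis add_0)
    ultimately have "antider (\<lambda>y. W t y * V t y) (2 * pi) = - c * antider (n t) (2 * pi)" using c1 by simp
    with A_t_raw[OF t, of "2 * pi"] show ?thesis by (simp add: \<theta>_def[abs_def] c_def)
  qed
  have "(\<theta> t - 2 * pi)\<^sup>2 = 0"
  proof (rule gronwall_zero[where T=T and D="\<lambda>t. (\<theta> t - 2 * pi)\<^sup>2" and C="2 * \<bar>C\<bar> * \<bar>N\<bar>"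
        and D'="\<lambda>t. 2 * (\<theta> t - 2 * pi) * (- (Kc (\<theta> t) - Kc 0) * antider (n t) (2 * pi))"])
    have "antider (V 0) (2 * pi) = (\<lambda>x. x) (2 * pi) - (\<lambda>x. x) 0"
      by (rule antider_eq) (auto simp: V_def l_0)
    then show "(\<theta> 0 - 2 * pi)\<^sup>2 = 0" by (simp add: \<theta>_def A_def)
    show "((\<lambda>t. (\<theta> t - 2 * pi)\<^sup>2) has_real_derivative
        2 * (\<theta> t - 2 * pi) * (- (Kc (\<theta> t) - Kc 0) * antider (n t) (2 * pi))) (at t within {0..T})"
      if "t \<in> {0..T}" for t
      by (rule derivative_eq_intros \<theta>_t[OF that] refl)+ simp
    show "2 * (\<theta> t - 2 * pi) * (- (Kc (\<theta> t) - Kc 0) * antider (n t) (2 * pi))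
        \<le> 2 * \<bar>C\<bar> * \<bar>N\<bar> * (\<theta> t - 2 * pi)\<^sup>2" if t: "t \<in> {0..T}" for t
    proof -
      have "2 * (\<theta> t - 2 * pi) * (- (Kc (\<theta> t) - Kc 0) * antider (n t) (2 * pi))
          \<le> \<bar>2 * (\<theta> t - 2 * pi) * (- (Kc (\<theta> t) - Kc 0) * antider (n t) (2 * pi))\<bar>" by (rule abs_ge_self)
      also have "\<dots> = 2 * \<bar>\<theta> t - 2 * pi\<bar> * (\<bar>Kc (\<theta> t) - Kc 0\<bar> * \<bar>antider (n t) (2 * pi)\<bar>)"
        by (simp only: abs_mult abs_minus_cancel abs_numeral)
      also have "\<dots> \<le> 2 * \<bar>\<theta> t - 2 * pi\<bar> * ((\<bar>C\<bar> * \<bar>\<theta> t - 2 * pi\<bar>) * \<bar>N\<bar>)"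
      proof (intro mult_left_mono mult_mono)
        show "\<bar>Kc (\<theta> t) - Kc 0\<bar> \<le> \<bar>C\<bar> * \<bar>\<theta> t - 2 * pi\<bar>"
          by (rule order_trans[OF Clip[OF t]]) (simp add: mult_right_mono)
        show "\<bar>antider (n t) (2 * pi)\<bar> \<le> \<bar>N\<bar>" using N[OF t] by linarith
      qed auto
      also have "\<dots> = 2 * \<bar>C\<bar> * \<bar>N\<bar> * (\<theta> t - 2 * pi)\<^sup>2"
        by (simp add: power2_eq_square abs_mult_self_eq algebra_simps)
      finally show ?thesis .
    qed
  qed (use assms in auto)
  then show ?thesis by (simp add: \<theta>_def)
qed

context
  fixes t assumes t: "t \<in> {0..T}"
begin

lemma A_2pi: "A t (x + 2 * pi) = A t x + 2 * pi"
  using A_shift[OF t] circumference[OF t] by simp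

lemma U_x: "(U t has_real_derivative W t x * V t x) (at x)"
  using U_x_raw[OF t, of x] circumference[OF t] by (simp add: Kc_2pi)

text \<open>In Eulerian terms u_xx = u - m. The term \<open>- n t x\<close> comes from the jump of
  \<open>Ks\<close> across the period; the same jump puts \<open>F\<close> into
  \<open>B_x\<close>.\<close>

lemma W_x: "(W t has_real_derivative V t x * U t x - n t x) (at x)"
  using DERIV_minus[OF conv_Ks_deriv[OF A_x[OF t] A_2pi n_cont[OF t] n_per[OF t], of x]]
  by (simp add: U_def W_conv[abs_def] Ks_2pi Ks_0)

lemma B_x: "(B t has_real_derivative (F t x - P t x) * V t x) (at x)"
  unfolding B_def
  by (rule DERIV_cong[OF conv_Ks_deriv[OF A_x[OF t] A_2pi FV_cont[OF t] FV_per[OF t]]])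
    (simp add: P_def Ks_2pi Ks_0, simp add: algebra_simps)

lemma P_x: "(P t has_real_derivative - V t x * B t x) (at x)"
  using conv_Kc_deriv[OF A_x[OF t] A_2pi FV_cont[OF t] FV_per[OF t], of x]
  by (simp add: B_def P_def Kc_2pi)

lemma A_t: "((\<lambda>s. A s x) has_real_derivative U t x - U t 0) (at t within {0..T})"
  using A_t_raw[OF t, of x] antider_eq[of x "U t", OF U_x] by simp

lemma A_incr: assumes "s \<in> {0..2 * pi}" shows "A t (x + s) - A t x \<in> {0..2 * pi}"
proof -
  have mono: "A t y \<le> A t z" if "y \<le> z" for y z
    by (rule DERIV_nonneg_imp_nondecreasing[OF that]) (use A_x[OF t] V_pos less_imp_le in blast)
  show ?thesis using mono[of x "x + s"] mono[of "x + s" "x + 2 * pi"] assms by (simp add: A_2pi)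
qed

text \<open>The equation u_t + u u_x = - P_x in Lagrangian form. Differentiating the kernel integral
  in time gives an expression in \<open>n\<close>; integration by parts turns it into the integral
  of \<open>Ks\<close> against \<open>F * V\<close>.\<close>

lemma U_t: "((\<lambda>s. U s x) has_real_derivative B t x) (at t within {0..T})"
proof -
  let ?g = "\<lambda>s r. Ks (A s (x + r) - A s x) * (U s (x + r) - U s x) * n s (x + r)
      + Kc (A s (x + r) - A s x) * (- W s (x + r) * n s (x + r))"
  have "((\<lambda>s. integral {0..2*pi} (\<lambda>r. Kc (A s (x + r) - A s x) * n s (x + r)))
     has_real_derivative integral {0..2*pi} (?g t)) (at t within {0..T})"
  proof (rule leibniz_interval)
    fix s r assume s: "s \<in> {0..T}"
    have At: "((\<lambda>s. A s y) has_real_derivative U s y - U s 0) (at s within {0..T})" for y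
      using A_t_raw[OF s, of y] antider_eq[of y "U s" "\<lambda>y. W s y * V s y"]
        U_x_raw[OF s] circumference[OF s] by (simp add: Kc_2pi)
    show "((\<lambda>s. Kc (A s (x + r) - A s x) * n s (x + r)) has_real_derivative ?g s r) (at s within {0..T})"
      by (rule derivative_eq_intros DERIV_chain2[OF Kc_deriv] At n_t[OF s] refl)+ (simp add: algebra_simps)
  next
    show "continuous_on {0..2*pi} (\<lambda>r. Kc (A s (x + r) - A s x) * n s (x + r))" if "s \<in> {0..T}" for s
      by (intro continuous_intros jcont_comp[OF A_j] jcont_comp[OF n_j]) (use that in auto)
    show "continuous_on ({0..T} \<times> {0..2 * pi}) (\<lambda>(s, r). ?g s r)"
      unfolding case_prod_unfold
      by (intro continuous_intros jcont_comp[OF A_j] jcont_comp[OF n_j] jcont_comp[OF U_j] jcont_comp[OF W_j]) auto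
  qed (use t in auto)
  moreover have "integral {0..2*pi} (?g t) = B t x"
  proof -
    let ?h = "\<lambda>r. Ks (A t (x + r) - A t x) * (F t (x + r) * V t (x + r))"
    \<comment> \<open>Substituting \<open>n = V * U - W_x\<close> and \<open>U_x = W * V\<close>
      makes the difference of the integrands an exact derivative with this primitive. At both ends
      \<open>U t (x + r) - U t x\<close> vanishes, so the jump of \<open>Ks\<close> leaves no
      boundary term.\<close>
    define G where "G r = - Ks (A t (x + r) - A t x) * (U t (x + r) - U t x) * W t (x + r)
       + Kc (A t (x + r) - A t x) * ((W t (x + r))\<^sup>2 / 2)
       - U t x * (Kc (A t (x + r) - A t x) * U t (x + r))" for r
    have sh: "(f has_real_derivative d) (at (x + r)) \<Longrightarrow> ((\<lambda>r. f (x + r)) has_real_derivative d) (at r)" for f d r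
      by (simp add: add.commute[of x] DERIV_shift[symmetric])
    have "((\<lambda>r. ?g t r - ?h r) has_integral G (2 * pi) - G 0) {0..2*pi}"
    proof (rule ftc_real)
      fix r
      have dA: "((\<lambda>r. A t (x + r) - A t x) has_real_derivative V t (x + r)) (at r)"
        using DERIV_diff[OF sh[OF A_x[OF t]] DERIV_const] by simp
      have gen: "((\<lambda>r. - ks r * (uu r - u1) * ww r + kc r * ((ww r)\<^sup>2 / 2) - u1 * (kc r * uu r)) has_real_derivative
          - ks' * (uu r - u1) * ww r - ks r * uu' * ww r - ks r * (uu r - u1) * ww' + kc' * ((ww r)\<^sup>2 / 2)
          + kc r * (ww r * ww') - u1 * (kc' * uu r + kc r * uu')) (at r)"
        if "(kc has_real_derivative kc') (at r)" "(ks has_real_derivative ks') (at r)"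
          "(uu has_real_derivative uu') (at r)" "(ww has_real_derivative ww') (at r)"
        for kc ks uu ww :: "real \<Rightarrow> real" and kc' ks' uu' ww' u1
        by (auto intro!: derivative_eq_intros that simp: algebra_simps)
      show "(G has_real_derivative ?g t r - ?h r) (at r)" unfolding G_def[abs_def]
        by (rule DERIV_cong[OF gen[OF DERIV_chain2[OF Kc_deriv dA] DERIV_chain2[OF Ks_deriv dA] sh[OF U_x] sh[OF W_x]]])
          (simp add: F_def algebra_simps power2_eq_square)
    qed simp
    moreover have "G (2 * pi) = G 0"
      using A_2pi[of x] U_per[OF t] W_per[OF t]
      by (simp add: G_def periodic_2pi_def Kc_2pi)
    ultimately have "integral {0..2*pi} (\<lambda>r. ?g t r - ?h r) = 0" by (simp add: integral_unique)
    moreover have "integral {0..2*pi} (\<lambda>r. ?g t r - ?h r) = integral {0..2*pi} (?g t) - integral {0..2*pi} ?h"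
      by (intro integral_diff integrable_continuous_real continuous_intros jcont_comp[OF A_j] jcont_comp[OF n_j]
          jcont_comp[OF U_j] jcont_comp[OF W_j] jcont_comp[OF F_j] jcont_comp[OF V_j]) (use t in auto)
    ultimately show ?thesis by (simp add: B_def conv_def)
  qed
  ultimately show ?thesis by (simp add: U_def conv_def)
qed

end

lemma U_integral:
  assumes t: "t \<in> {0..T}" shows "((\<lambda>s. B s x) has_integral U t x - U 0 x) {0..t}"
proof (rule fundamental_theorem_of_calculus)
  fix s assume s: "s \<in> {0..t}"
  then have "((\<lambda>s. U s x) has_real_derivative B s x) (at s within {0..T})"
    using t by (intro U_t) auto
  then show "((\<lambda>s. U s x) has_vector_derivative B s x) (at s within {0..t})"
    using t has_real_derivative_iff_has_vector_derivative has_vector_derivative_within_subset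
    by (metis atLeastAtMost_iff atLeastatMost_subset_iff order_refl)
qed (use t in auto)

text \<open>The evolution of the slope is read off by differentiating \<open>U t x - U 0 x\<close>,
  the time integral of \<open>B\<close>, in x: \<open>U_x\<close> is \<open>W * V\<close> and
  \<open>B_x\<close> is \<open>(F - P) * V\<close>. A time derivative of the kernel integral for
  \<open>W\<close> is thereby avoided.\<close>

lemma WV_integral:
  assumes t: "t \<in> {0..T}"
  shows "((\<lambda>s. (F s x - P s x) * V s x) has_integral W t x * V t x - W 0 x * V 0 x) {0..t}"
proof -
  have t0: "0 \<in> {0..T}" using T by simp
  have st: "s \<in> {0..T}" if "s \<in> {0..t}" for s using that t by auto
  have "((\<lambda>x. integral {0..t} (\<lambda>s. B s x)) has_real_derivative
      integral {0..t} (\<lambda>s. (F s x - P s x) * V s x)) (at x within UNIV)"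
  proof (rule leibniz_interval)
    show "continuous_on (UNIV \<times> {0..t}) (\<lambda>(x, s). (F s x - P s x) * V s x)"
      unfolding case_prod_unfold
      by (intro continuous_intros jcont_comp[OF F_j] jcont_comp[OF P_j] jcont_comp[OF V_j]) (use st in auto)
    show "continuous_on {0..t} (\<lambda>s. B s x)" for x
      by (rule continuous_on_subset[OF jcont_time[OF B_j]]) (use st in auto)
  qed (use B_x st in auto)
  moreover have "integral {0..t} (\<lambda>s. B s x) = U t x - U 0 x" for x
    using U_integral[OF t] by (simp add: integral_unique)
  ultimately have "((\<lambda>x. U t x - U 0 x) has_real_derivative
      integral {0..t} (\<lambda>s. (F s x - P s x) * V s x)) (at x)" by simp
  from DERIV_unique[OF this DERIV_diff[OF U_x[OF t] U_x[OF t0]]]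
  have "integral {0..t} (\<lambda>s. (F s x - P s x) * V s x) = W t x * V t x - W 0 x * V 0 x" .
  moreover have "(\<lambda>s. (F s x - P s x) * V s x) integrable_on {0..t}"
    by (intro integrable_continuous_real continuous_intros jcont_comp[OF F_j] jcont_comp[OF P_j] jcont_comp[OF V_j])
      (use st in auto)
  ultimately show ?thesis by (metis integrable_integral)
qed

lemma V_0 [simp]: "V 0 x = 1" by (simp add: V_def l_0)

lemma A_0 [simp]: "A 0 x = x"
  using antider_eq[of x "\<lambda>x. x" "V 0"] by (simp add: A_def)

text \<open>Green's identity: two integrations by parts of \<open>u0 - u0''\<close> against
  \<open>Kc\<close>, where only the jump of \<open>Ks\<close> survives at the ends.\<close>

lemma U_0 [simp]: "U 0 x = u0 x"
proof -
  have sh: "(f has_real_derivative d) (at (x + r)) \<Longrightarrow> ((\<lambda>r. f (x + r)) has_real_derivative d) (at r)" for f d r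
    by (simp add: add.commute[of x] DERIV_shift[symmetric])
  have "((\<lambda>s. Kc s * m0 (x + s)) has_integral
     (\<lambda>s. Ks s * u0 (x + s) - Kc s * u0' (x + s)) (2 * pi) - (\<lambda>s. Ks s * u0 (x + s) - Kc s * u0' (x + s)) 0) {0..2*pi}"
  proof (rule ftc_real)
    fix r
    show "((\<lambda>s. Ks s * u0 (x + s) - Kc s * u0' (x + s)) has_real_derivative Kc r * m0 (x + r)) (at r)"
      by (rule DERIV_cong[OF DERIV_diff[OF DERIV_mult[OF Ks_deriv sh[OF u0(1)]] DERIV_mult[OF Kc_deriv sh[OF u0(2)]]]])
        (simp add: m0_eq algebra_simps)
  qed simp
  then show ?thesis
    using u0(4,5) by (simp add: U_def conv_def n_def l_0 integral_unique Ks_2pi Ks_0 Kc_2pi periodic_2pi_def)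
qed

lemma W_0 [simp]: "W 0 x = u0' x"
proof -
  have "(U 0 has_real_derivative W 0 x * V 0 x) (at x)" using T by (intro U_x) auto
  moreover have "U 0 = u0" by auto
  ultimately show ?thesis using DERIV_unique[OF u0(1)[of x]] by simp
qed

end

section \<open>Bounds on a short time interval\<close>

text \<open>The bounds with factor 2 are the bootstrap hypotheses; \<open>U_strict\<close> and
  \<open>W_strict\<close> recover them with factor 6/5. The condition
  \<open>e * T \<le> 1 / 100\<close> keeps \<eta>_x within six percent of 1.\<close>

locale ch_flow_bd = ch_flow +
  fixes e :: real
  assumes e: "0 < e" "e * T \<le> 1 / 100"
    and u0_le: "\<And>x. \<bar>u0 x\<bar> \<le> e" "\<And>x. \<bar>u0' x\<bar> \<le> e"
    and U_le: "\<And>t x. t \<in> {0..T} \<Longrightarrow> \<bar>U t x\<bar> \<le> 2 * e"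
    and W_le: "\<And>t x. t \<in> {0..T} \<Longrightarrow> \<bar>W t x\<bar> \<le> 2 * e"
    and l_le: "\<And>t x. t \<in> {0..T} \<Longrightarrow> \<bar>l t x\<bar> \<le> 2 * e * t"
begin

lemma et: "t \<in> {0..T} \<Longrightarrow> e * t \<le> 1 / 100"
  by (rule order_trans[OF mult_left_mono e(2)]) (use e in auto)

context
  fixes t assumes t: "t \<in> {0..T}"
begin

lemma V_near: "\<bar>V t x - 1\<bar> \<le> 6 * e * t"
  using exp_lipschitz[of "l t x" 0] l_1[OF t, of x] l_le[OF t, of x] by (simp add: V_def)

lemma V_le: "V t x \<le> 53 / 50" and V_ge: "47 / 50 \<le> V t x"
  using V_near[of x] et[OF t] by (auto simp: abs_le_iff)

lemma F_nonneg: "0 \<le> F t x" by (simp add: F_def)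

lemma F_le: "F t x \<le> 6 * e\<^sup>2"
proof -
  have "(U t x)\<^sup>2 \<le> (2 * e)\<^sup>2" "(W t x)\<^sup>2 \<le> (2 * e)\<^sup>2"
    by (rule abs_le_square_iff[THEN iffD1], use U_le[OF t, of x] W_le[OF t, of x] e in simp)+
  then show ?thesis by (simp add: F_def power_mult_distrib)
qed

lemma FV_le: "0 \<le> F t x * V t x" "F t x * V t x \<le> 6 * e\<^sup>2 * V t x"
  using F_nonneg F_le V_pos[of t x] by (auto intro!: mult_right_mono simp: less_imp_le)

lemma V_integral: "((\<lambda>s. V t (x + s)) has_integral 2 * pi) {0..2 * pi}"
proof -
  have "((\<lambda>s. V t (x + s)) has_integral (A t (x + 2 * pi) - A t (x + 0))) {0..2*pi}"
    by (rule ftc_real) (use A_x[OF t] in \<open>auto simp: add.commute[of x] DERIV_shift[symmetric]\<close>)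
  then show ?thesis by (simp add: A_2pi[OF t])
qed

text \<open>\<open>F\<close> is at most \<open>6 * e\<^sup>2\<close>, \<open>Ks\<close> at most 1/2,
  and \<open>V\<close> integrates to \<open>2 * pi\<close> over a period; 6 pi is below 20.\<close>

lemma B_le: "\<bar>B t x\<bar> \<le> 20 * e\<^sup>2"
proof -
  have "norm (B t x) \<le> integral {0..2*pi} (\<lambda>s. 3 * e\<^sup>2 * V t (x + s))"
    unfolding B_def conv_def
  proof (rule integral_norm_bound_integral)
    show "(\<lambda>s. Ks (A t (x + s) - A t x) * (F t (x + s) * V t (x + s))) integrable_on {0..2 * pi}"
      by (intro integrable_continuous_real continuous_intros jcont_comp[OF A_j] jcont_comp[OF F_j]
          jcont_comp[OF V_j]) (use t in auto)
    show "(\<lambda>s. 3 * e\<^sup>2 * V t (x + s)) integrable_on {0..2 * pi}"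
      using has_integral_mult_right[OF V_integral, of "3 * e\<^sup>2"] by blast
    fix s assume s: "s \<in> {0..2*pi}"
    have "\<bar>Ks (A t (x + s) - A t x)\<bar> * \<bar>F t (x + s) * V t (x + s)\<bar> \<le> 1 / 2 * (6 * e\<^sup>2 * V t (x + s))"
      using A_incr[OF t s, of x] FV_le[of "x + s"] by (intro mult_mono Ks_bound) auto
    then show "norm (Ks (A t (x + s) - A t x) * (F t (x + s) * V t (x + s))) \<le> 3 * e\<^sup>2 * V t (x + s)"
      by (simp add: abs_mult)
  qed
  also have "\<dots> = 3 * e\<^sup>2 * (2 * pi)" using V_integral by (simp add: integral_unique)
  also have "\<dots> = (6 * pi) * e\<^sup>2" by simp
  also have "\<dots> \<le> 20 * e\<^sup>2" using pi_approx by (intro mult_right_mono) auto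
  finally show ?thesis by simp
qed

text \<open>In the Lagrangian variable \<open>Kc\<close> is a probability kernel: it is positive,
  and its integral against \<open>V\<close> is the unit increment of \<open>Ks\<close>. So
  \<open>P\<close> inherits the bounds of \<open>F\<close>.\<close>

lemma P_nonneg: "0 \<le> P t x" and P_le: "P t x \<le> 6 * e\<^sup>2"
proof -
  have int: "(\<lambda>s. Kc (A t (x + s) - A t x) * (F t (x + s) * V t (x + s))) integrable_on {0..2 * pi}"
    by (intro integrable_continuous_real continuous_intros jcont_comp[OF A_j] jcont_comp[OF F_j]
        jcont_comp[OF V_j]) (use t in auto)
  have sh: "((\<lambda>s. A t (x + s) - A t x) has_real_derivative V t (x + s)) (at s)" for s
    using DERIV_diff[OF _ DERIV_const, of "\<lambda>s. A t (x + s)"] A_x[OF t, of "x + s"]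
    by (simp add: add.commute[of x] DERIV_shift[symmetric])
  have KV: "((\<lambda>s. Kc (A t (x + s) - A t x) * V t (x + s)) has_integral
      Ks (A t (x + 2 * pi) - A t x) - Ks (A t (x + 0) - A t x)) {0..2*pi}"
    by (rule ftc_real) (simp_all add: DERIV_chain2[OF Ks_deriv sh])
  then have KV: "((\<lambda>s. Kc (A t (x + s) - A t x) * V t (x + s)) has_integral 1) {0..2*pi}"
    by (simp add: A_2pi[OF t] Ks_2pi Ks_0)
  show "0 \<le> P t x" unfolding P_def conv_def
    by (rule integral_nonneg[OF int]) (use FV_le Kc_pos in \<open>auto intro!: mult_nonneg_nonneg simp: less_imp_le\<close>)
  have "P t x \<le> integral {0..2*pi} (\<lambda>s. 6 * e\<^sup>2 * (Kc (A t (x + s) - A t x) * V t (x + s)))"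
    unfolding P_def conv_def
  proof (rule integral_le[OF int])
    show "(\<lambda>s. 6 * e\<^sup>2 * (Kc (A t (x + s) - A t x) * V t (x + s))) integrable_on {0..2 * pi}"
      using has_integral_mult_right[OF KV, of "6 * e\<^sup>2"] by blast
    show "Kc (A t (x + s) - A t x) * (F t (x + s) * V t (x + s))
        \<le> 6 * e\<^sup>2 * (Kc (A t (x + s) - A t x) * V t (x + s))" for s
      using mult_left_mono[OF FV_le(2)[of "x + s"] less_imp_le[OF Kc_pos], of "A t (x + s) - A t x"]
      by (simp add: algebra_simps)
  qed
  also have "\<dots> = 6 * e\<^sup>2" using KV by (simp add: integral_unique)
  finally show "P t x \<le> 6 * e\<^sup>2" .
qed

lemma U_strict: "\<bar>U t x\<bar> \<le> 6 / 5 * e"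
proof -
  have "norm (U t x - U 0 x) \<le> 20 * e\<^sup>2 * measure lborel {0..t}"
    by (rule has_integral_bound_real[OF _ finite.emptyI U_integral[OF t]])
      (use ch_flow_bd.B_le[OF ch_flow_bd_axioms] t in auto)
  also have "\<dots> = 20 * e * (e * t)" using t by (simp add: power2_eq_square)
  also have "\<dots> \<le> 20 * e * (1 / 100)" using et[OF t] e by (intro mult_left_mono) auto
  finally have "\<bar>U t x - u0 x\<bar> \<le> 1 / 5 * e" by simp
  then show ?thesis using u0_le(1)[of x] by linarith
qed

end

lemma FPV_le: assumes t: "t \<in> {0..T}" shows "\<bar>(F t x - P t x) * V t x\<bar> \<le> 7 * e\<^sup>2"
proof -
  have "\<bar>F t x - P t x\<bar> * \<bar>V t x\<bar> \<le> 6 * e\<^sup>2 * (53 / 50)"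
    using F_nonneg[OF t, of x] F_le[OF t, of x] P_nonneg[OF t, of x] P_le[OF t, of x] V_le[OF t, of x] V_pos[of t x]
    by (intro mult_mono) auto
  also have "\<dots> \<le> 7 * e\<^sup>2" using e by simp
  finally show ?thesis by (simp add: abs_mult)
qed

lemma WV_near: assumes t: "t \<in> {0..T}" shows "\<bar>W t x * V t x - u0' x\<bar> \<le> 7 * e\<^sup>2 * t"
proof -
  have "norm (W t x * V t x - W 0 x * V 0 x) \<le> 7 * e\<^sup>2 * measure lborel {0..t}"
    by (rule has_integral_bound_real[OF _ finite.emptyI WV_integral[OF t]])
      (use FPV_le t in auto)
  then show ?thesis using t by simp
qed

text \<open>The growth over the whole interval costs at most 7/100, and dividing by
  \<open>V \<ge> 47 / 50\<close> still leaves less than 6/5.\<close>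

lemma W_strict: assumes t: "t \<in> {0..T}" shows "\<bar>W t x\<bar> \<le> 6 / 5 * e"
proof -
  have "7 * e\<^sup>2 * t = 7 * e * (e * t)" by (simp add: power2_eq_square)
  also have "\<dots> \<le> 7 * e * (1 / 100)" using et[OF t] e by (intro mult_left_mono) auto
  finally have "\<bar>W t x * V t x\<bar> \<le> 107 / 100 * e" using WV_near[OF t, of x] u0_le(2)[of x] by linarith
  moreover have "\<bar>W t x\<bar> * (47 / 50) \<le> \<bar>W t x\<bar> * V t x" using V_ge[OF t] by (intro mult_left_mono) auto
  ultimately have "\<bar>W t x\<bar> * (47 / 50) \<le> 107 / 100 * e" using V_pos[of t x] by (simp add: abs_mult)
  then show ?thesis using e by simp
qed

end

lemma le_at_right_end:
  fixes f :: "real \<Rightarrow> real"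
  assumes "continuous_on {a..b} f" "a < b" "\<And>s. s \<in> {a..<b} \<Longrightarrow> f s \<le> c"
  shows "f b \<le> c"
  using continuous_le_on_closure[of "{a..<b}" f b c] assms by auto

text \<open>Continuation: as long as the slope stays below \<open>2 * e\<close> the clamp is
  inactive and the truncated flow is the true one. At the first time where
  \<open>\<bar>U\<bar>\<close> or \<open>\<bar>W\<bar>\<close> reaches \<open>2 * e\<close> the
  strict bounds give at most \<open>6 / 5 * e\<close>, a contradiction.\<close>

lemma flow_exists:
  assumes T: "0 < T" and u0: "\<And>x. (u0 has_real_derivative u0' x) (at x)" "\<And>x. (u0' has_real_derivative u0'' x) (at x)"
      "continuous_on UNIV u0''" "periodic_2pi u0" "periodic_2pi u0'" "periodic_2pi u0''"
    and e: "0 < e" "e * T \<le> 1 / 100" and u0_le: "\<And>x. \<bar>u0 x\<bar> \<le> e" "\<And>x. \<bar>u0' x\<bar> \<le> e"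
  shows "\<exists>l. ch_flow_bd T u0 u0' u0'' (\<lambda>x. u0 x - u0'' x) l e"
proof -
  define m0 where "m0 = (\<lambda>x. u0 x - u0'' x)"
  have "continuous_on UNIV u0" using u0(1) by (intro DERIV_continuous_on) auto
  then have m0: "continuous_on UNIV m0" "periodic_2pi m0"
    using u0 by (auto simp: m0_def periodic_2pi_def intro!: continuous_intros)
  obtain l where l_j: "jcont {0..T} l" and l_0: "\<And>x. l 0 x = 0"
    and l_per: "\<And>t. t \<in> {0..T} \<Longrightarrow> periodic_2pi (l t)"
    and l_le: "\<And>t x. t \<in> {0..T} \<Longrightarrow> \<bar>l t x\<bar> \<le> 2 * e * t"
    and l_t: "\<And>t x. t \<in> {0..T} \<Longrightarrow>
       ((\<lambda>s. l s x) has_real_derivative clamp_abs (2 * e) (slope m0 (l t) x)) (at t within {0..T})"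
    using truncated_flow_exists[OF m0, of "2 * e" T] e T by auto
  have l_1: "\<bar>l t x\<bar> \<le> 1" if "t \<in> {0..T}" for t x
  proof -
    have "e * t \<le> 1 / 100" by (rule order_trans[OF mult_left_mono e(2)]) (use that e in auto)
    with l_le[OF that, of x] show ?thesis by linarith
  qed
  \<comment> \<open>The interval of length 0 supplies the initial values of \<open>U\<close> and
    \<open>W\<close>, needed before any bound on a positive interval is available.\<close>
  interpret Z: ch_flow 0 u0 u0' u0'' m0 l
  proof
    have "at t within {0..0} = bot" if "t \<in> {0..0}" for t :: real
      using that by (simp add: at_within_eq_bot_iff)
    then show "((\<lambda>s. l s x) has_real_derivative slope m0 (l t) x) (at t within {0..0})" if "t \<in> {0..0}" for t x
      using that by (simp only: has_field_derivative_iff) simp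
  qed (use u0 l_0 l_per l_1 T jcont_subset[OF l_j, of "{0..0}"] in \<open>auto simp: m0_def\<close>)
  define U where Udef: "U = ch_flow.U m0 l"
  define W where Wdef: "W = ch_flow.W m0 l"
  have W_eq: "W = (\<lambda>t. slope m0 (l t))" by (simp add: Wdef Z.W_def[abs_def])
  have U_eq: "U = (\<lambda>t. conv Kc (antider (\<lambda>y. exp (l t y))) (\<lambda>y. m0 y * exp (- l t y)))"
    by (simp add: Udef Z.U_def Z.A_def Z.V_def[abs_def] Z.n_def[abs_def] fun_eq_iff)
  have bd: "ch_flow t1 u0 u0' u0'' m0 l \<and> (\<forall>x. \<bar>U t1 x\<bar> \<le> 6 / 5 * e \<and> \<bar>W t1 x\<bar> \<le> 6 / 5 * e)
      \<and> ch_flow_bd t1 u0 u0' u0'' m0 l e"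
    if t1: "t1 \<in> {0..T}" and le: "\<And>t x. t \<in> {0..t1} \<Longrightarrow> \<bar>U t x\<bar> \<le> 2 * e"
      "\<And>t x. t \<in> {0..t1} \<Longrightarrow> \<bar>W t x\<bar> \<le> 2 * e" for t1
  proof -
    have sub: "{0..t1} \<subseteq> {0..T}" using t1 by auto
    interpret ch_flow t1 u0 u0' u0'' m0 l
    proof
      show "jcont {0..t1} l" by (rule jcont_subset[OF l_j sub])
      show "((\<lambda>s. l s x) has_real_derivative slope m0 (l t) x) (at t within {0..t1})" if "t \<in> {0..t1}" for t x
        using DERIV_subset[OF l_t sub, of t x] that sub le(2)[OF that, of x]
        by (simp add: W_eq clamp_abs_id subset_iff)
    qed (use t1 sub u0 l_0 l_per l_1 in \<open>auto simp: m0_def\<close>)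
    have "e * t1 \<le> 1 / 100" by (rule order_trans[OF mult_left_mono e(2)]) (use t1 e in auto)
    then interpret ch_flow_bd t1 u0 u0' u0'' m0 l e
      by unfold_locales (use e u0_le le[unfolded Udef Wdef] l_le sub in auto)
    have "t1 \<in> {0..t1}" using t1 by simp
    with U_strict W_strict show ?thesis
      using ch_flow_axioms ch_flow_bd_axioms by (auto simp: Udef Wdef)
  qed
  have e_j: "jcont {0..T} (\<lambda>t x. exp (l t x))" "jcont {0..T} (\<lambda>t x. m0 x * exp (- l t x))"
    using l_j unfolding jcont_def case_prod_unfold
    by (intro continuous_intros continuous_on_compose2[OF m0(1)]; auto)+
  have U_j: "jcont {0..T} U"
    unfolding U_eq by (rule conv_jcont[OF _ antider_jcont[OF e_j(1)] e_j(2)]) (intro continuous_intros)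
  have W_j: "jcont {0..T} W"
    using slope_jcont[OF l_j m0(1)] by (simp add: W_eq)
  have per: "periodic_2pi (U t)" "periodic_2pi (W t)" if t: "t \<in> {0..T}" for t
  proof -
    note c = jcont_section[OF l_j t]
    have ec: "continuous_on UNIV (\<lambda>y. exp (l t y))" "continuous_on UNIV (\<lambda>y. m0 y * exp (- l t y))"
      by (intro continuous_intros c m0)+
    have ep: "periodic_2pi (\<lambda>y. exp (l t y))" "periodic_2pi (\<lambda>y. m0 y * exp (- l t y))"
      using l_per[OF t] m0(2) by (simp_all add: periodic_2pi_def)
    show "periodic_2pi (U t)" unfolding U_eq
      by (rule conv_periodic[OF antider_deriv[OF ec(1)] antider_shift[OF ec(1) ep(1)] ec(2) ep(2)])
    show "periodic_2pi (W t)"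
      using slope_periodic[OF c l_per[OF t] m0] by (simp add: W_eq)
  qed
  define g where "g t x = max \<bar>U t x\<bar> \<bar>W t x\<bar>" for t x
  have g_j: "jcont {0..T} g"
    using U_j W_j unfolding g_def jcont_def case_prod_unfold by (intro continuous_intros)
  have g_per: "periodic_2pi (g t)" if "t \<in> {0..T}" for t
    using per[OF that] by (simp add: g_def periodic_2pi_def)
  have g_lt: "g t x < 2 * e" if t: "t \<in> {0..T}" for t x
  proof (rule ccontr)
    assume bad: "\<not> g t x < 2 * e"
    \<comment> \<open>Restricting x to one period makes the set of bad points compact, so a first
      bad time is attained.\<close>
    define Z where "Z = ({0..T} \<times> {0..0 + 2 * pi}) \<inter> (\<lambda>(t, x). g t x) -` {2 * e..}"
    have "compact Z"
    proof -
      have "closed Z" unfolding Z_def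
        by (intro continuous_closed_preimage continuous_on_subset[OF g_j[unfolded jcont_def]] closed_Times) auto
      moreover have "bounded Z"
        by (rule bounded_subset[of "{0..T} \<times> {0..0 + 2 * pi}"]) (auto simp: Z_def intro: bounded_Times)
      ultimately show ?thesis by (simp add: compact_eq_bounded_closed)
    qed
    then have "compact (fst ` Z)" by (intro compact_continuous_image continuous_intros)
    moreover have "fst ` Z \<noteq> {}"
    proof -
      obtain y where "y \<in> {0..0 + 2 * pi}" "g t y = g t x" using periodic_attained[OF g_per[OF t]] by metis
      then have "(t, y) \<in> Z" using bad t by (auto simp: Z_def)
      then show ?thesis by auto
    qed
    ultimately obtain t1 where t1: "t1 \<in> fst ` Z" "\<And>s. s \<in> fst ` Z \<Longrightarrow> t1 \<le> s"
      using compact_attains_inf by metis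
    then obtain x1 where x1: "t1 \<in> {0..T}" "g t1 x1 \<ge> 2 * e" by (auto simp: Z_def)
    have before: "g s y \<le> 2 * e" if s: "s \<in> {0..<t1}" for s y
    proof (rule ccontr)
      assume "\<not> g s y \<le> 2 * e"
      moreover obtain z where "z \<in> {0..0 + 2 * pi}" "g s z = g s y"
        using periodic_attained[OF g_per[of s], of 0 y] s x1(1) by auto
      ultimately have "(s, z) \<in> Z" using s x1(1) by (auto simp: Z_def)
      then have "s \<in> fst ` Z" by (rule image_eqI[rotated]) simp
      from t1(2)[OF this] s show False by simp
    qed
    have at: "g t1 y \<le> 2 * e" for y
    proof (cases "t1 = 0")
      case True
      show ?thesis using u0_le[of y] e by (simp add: g_def Udef Wdef True)
    next
      case False
      have "continuous_on {0..t1} (\<lambda>t. g t y)"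
        by (rule continuous_on_subset[OF jcont_time[OF g_j]]) (use x1 in auto)
      from le_at_right_end[OF this _ before] show ?thesis using False x1 by auto
    qed
    have "g s y \<le> 2 * e" if "s \<in> {0..t1}" for s y
      using before[of s y] at[of y] that by (cases "s = t1") auto
    then have "\<bar>U t1 x1\<bar> \<le> 6 / 5 * e \<and> \<bar>W t1 x1\<bar> \<le> 6 / 5 * e"
      using bd[OF x1(1)] by (simp add: g_def)
    then show False using x1(2) e by (auto simp: g_def)
  qed
  then have "ch_flow_bd T u0 u0' u0'' m0 l e"
    using bd[of T] T by (simp add: g_def less_imp_le)
  then show ?thesis unfolding m0_def by blast
qed

section \<open>Smoothness of the Eulerian solution\<close>

text \<open>Order k regularity in x, jointly continuous in time. Derivatives enter as witnesses
  instead of \<open>deriv\<close>, so that the explicit Lagrangian formulas can be supplied, and are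
  required only for times in \<open>S\<close>.\<close>

primrec reg :: "nat \<Rightarrow> real set \<Rightarrow> (real \<Rightarrow> real \<Rightarrow> real) \<Rightarrow> bool" where
  "reg 0 S f = jcont S f"
| "reg (Suc k) S f = (jcont S f \<and> (\<exists>g. reg k S g \<and> (\<forall>t\<in>S. \<forall>x. (f t has_real_derivative g t x) (at x))))"

lemma reg_jcont: "reg k S f \<Longrightarrow> jcont S f"
  by (cases k) auto

lemma reg_Suc_imp: "reg (Suc k) S f \<Longrightarrow> reg k S f"
  by (induct k arbitrary: f) auto

lemma reg_SucI:
  assumes "reg k S g" "\<And>t x. t \<in> S \<Longrightarrow> (f t has_real_derivative g t x) (at x)" "jcont S f"
  shows "reg (Suc k) S f"
  using assms by auto

lemma jcont_cong:
  assumes "\<And>t x. t \<in> S \<Longrightarrow> f t x = g t x" "jcont S f" shows "jcont S g"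
proof -
  have "continuous_on (S \<times> UNIV) (\<lambda>(t, x). f t x) \<longleftrightarrow> continuous_on (S \<times> UNIV) (\<lambda>(t, x). g t x)"
    by (rule continuous_on_cong) (use assms(1) in auto)
  then show ?thesis using assms(2) by (simp add: jcont_def)
qed

lemma reg_cong:
  assumes "\<And>t x. t \<in> S \<Longrightarrow> f t x = g t x" "reg k S f" shows "reg k S g"
proof (cases k)
  case 0
  then show ?thesis using jcont_cong[of S f g] assms by simp
next
  case (Suc j)
  have "f t = g t" if "t \<in> S" for t using assms(1)[OF that] by auto
  with Suc assms jcont_cong[of S f g] show ?thesis by auto
qed

lemma reg_add: "reg k S f \<Longrightarrow> reg k S g \<Longrightarrow> reg k S (\<lambda>t x. f t x + g t x)"
proof (induct k arbitrary: f g)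
  case 0
  then show ?case unfolding reg.simps jcont_def case_prod_unfold by (intro continuous_intros)
next
  case (Suc k)
  from Suc.prems obtain f' g' where fg: "reg k S f'" "reg k S g'"
    "\<And>t x. t \<in> S \<Longrightarrow> (f t has_real_derivative f' t x) (at x)"
    "\<And>t x. t \<in> S \<Longrightarrow> (g t has_real_derivative g' t x) (at x)" by auto
  show ?case
  proof (rule reg_SucI)
    show "reg k S (\<lambda>t x. f' t x + g' t x)" by (rule Suc.hyps[OF fg(1,2)])
    show "jcont S (\<lambda>t x. f t x + g t x)"
      using Suc.prems unfolding reg.simps jcont_def case_prod_unfold by (intro continuous_intros) auto
  qed (auto intro!: derivative_intros fg)
qed

lemma reg_mult: "reg k S f \<Longrightarrow> reg k S g \<Longrightarrow> reg k S (\<lambda>t x. f t x * g t x)"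
proof (induct k arbitrary: f g)
  case 0
  then show ?case unfolding reg.simps jcont_def case_prod_unfold by (intro continuous_intros)
next
  case (Suc k)
  from Suc.prems obtain f' g' where fg: "reg k S f'" "reg k S g'"
    "\<And>t x. t \<in> S \<Longrightarrow> (f t has_real_derivative f' t x) (at x)"
    "\<And>t x. t \<in> S \<Longrightarrow> (g t has_real_derivative g' t x) (at x)" by auto
  show ?case
  proof (rule reg_SucI)
    show "reg k S (\<lambda>t x. f' t x * g t x + g' t x * f t x)"
      by (intro reg_add Suc.hyps fg(1,2) reg_Suc_imp[OF Suc.prems(1)] reg_Suc_imp[OF Suc.prems(2)])
    show "jcont S (\<lambda>t x. f t x * g t x)"
      using Suc.prems unfolding reg.simps jcont_def case_prod_unfold by (intro continuous_intros) auto
  qed (auto intro!: DERIV_mult fg)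
qed

lemma jcont_const: "jcont S (\<lambda>_ _. c)"
  unfolding jcont_def case_prod_unfold by (intro continuous_intros)

lemma reg_const: "reg k S (\<lambda>_ _. c)"
proof (induct k arbitrary: c)
  case (Suc k)
  from Suc[of 0] show ?case by (rule reg_SucI) (auto intro: jcont_const)
qed (simp add: jcont_const)

lemma reg_cmult: "reg k S f \<Longrightarrow> reg k S (\<lambda>t x. c * f t x)"
  using reg_mult[OF reg_const] by simp

lemma reg_inverse:
  assumes "\<And>t x. t \<in> S \<Longrightarrow> f t x \<noteq> 0" "reg k S f"
  shows "reg k S (\<lambda>t x. inverse (f t x))"
  using assms(2)
proof (induct k)
  case 0
  then show ?case using assms(1) unfolding reg.simps jcont_def case_prod_unfold
    by (intro continuous_intros) auto
next
  case (Suc k)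
  from Suc.prems obtain f' where f: "reg k S f'" "\<And>t x. t \<in> S \<Longrightarrow> (f t has_real_derivative f' t x) (at x)"
    by auto
  show ?case
  proof (rule reg_SucI)
    show "reg k S (\<lambda>t x. (- 1) * (inverse (f t x) * f' t x * inverse (f t x)))"
      by (intro reg_cmult reg_mult f Suc.hyps reg_Suc_imp[OF Suc.prems])
    show "jcont S (\<lambda>t x. inverse (f t x))"
      using Suc.prems assms(1) unfolding reg.simps jcont_def case_prod_unfold
      by (intro continuous_intros) auto
  qed (use f assms(1) in \<open>auto intro!: derivative_eq_intros\<close>)
qed

text \<open>The substitution \<open>s = t * r\<close> moves the variable upper limit into the
  integrand; t = 0, where it degenerates, is treated apart.\<close>

lemma jcont_time_integral:
  assumes "jcont {0..T} f" shows "jcont {0..T} (\<lambda>t x. integral {0..t} (\<lambda>s. f s x))"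
proof -
  have "jcont {0..T} (\<lambda>t x. t * integral {0..1} (\<lambda>r. f (t * r) x))"
  proof -
    have "jcont {0..T} (\<lambda>t x. integral {0..1} (\<lambda>r. f (t * r) x))"
      by (rule jcont_integral_param)
        (auto simp: case_prod_unfold mult_left_le intro!: jcont_comp[OF assms] continuous_intros,
          meson mult_left_le order_trans)
    then show ?thesis unfolding jcont_def case_prod_unfold by (intro continuous_intros)
  qed
  moreover have "t * integral {0..1} (\<lambda>r. f (t * r) x) = integral {0..t} (\<lambda>s. f s x)" if t: "t \<in> {0..T}" for t x
  proof (cases "t = 0")
    case False
    have "((\<lambda>s. f s x) has_integral integral {0..t} (\<lambda>s. f s x)) {0..t}"
      by (intro integrable_integral integrable_continuous_real continuous_on_subset[OF jcont_time[OF assms]])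
        (use t in auto)
    from has_integral_affinity'[OF this[folded box_real], of t 0] False t
    have "((\<lambda>r. f (t * r) x) has_integral integral {0..t} (\<lambda>s. f s x) / t) {0..1}"
      by (simp add: divide_inverse mult.commute)
    then show ?thesis using False by (simp add: integral_unique)
  qed simp
  ultimately show ?thesis by (rule jcont_cong[rotated])
qed

lemma reg_time_integral:
  "reg k {0..T} f \<Longrightarrow> reg k {0..T} (\<lambda>t x. integral {0..t} (\<lambda>s. f s x))"
proof (induct k arbitrary: f)
  case (Suc k)
  from Suc.prems obtain f' where f: "reg k {0..T} f'" "\<And>t x. t \<in> {0..T} \<Longrightarrow> (f t has_real_derivative f' t x) (at x)"
    by auto
  show ?case
  proof (rule reg_SucI[OF Suc.hyps[OF f(1)]])
    fix t x assume t: "t \<in> {0..T}"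
    have "((\<lambda>x. integral {0..t} (\<lambda>s. f s x)) has_real_derivative integral {0..t} (\<lambda>s. f' s x)) (at x within UNIV)"
    proof (rule leibniz_interval)
      show "continuous_on (UNIV \<times> {0..t}) (\<lambda>(x, s). f' s x)"
        unfolding case_prod_unfold by (intro continuous_intros jcont_comp[OF reg_jcont[OF f(1)]]) (use t in auto)
      show "continuous_on {0..t} (\<lambda>s. f s x)" for x
        by (rule continuous_on_subset[OF jcont_time[OF reg_jcont[OF Suc.prems]]]) (use t in auto)
    qed (use f(2) t in auto)
    then show "((\<lambda>x. integral {0..t} (\<lambda>s. f s x)) has_real_derivative integral {0..t} (\<lambda>s. f' s x)) (at x)" by simp
  qed (rule jcont_time_integral[OF reg_jcont[OF Suc.prems]])
qed (simp add: jcont_time_integral)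

lemma smooth_fun_deriv: "smooth_fun f \<Longrightarrow> smooth_fun (deriv f)"
  unfolding smooth_fun_def by (metis comp_apply funpow_Suc_right)

lemma smooth_fun_has_deriv: "smooth_fun f \<Longrightarrow> (f has_real_derivative deriv f x) (at x)"
  unfolding smooth_fun_def using real_differentiable_def DERIV_imp_deriv
  by (metis funpow_0)

lemma smooth_fun_continuous: "smooth_fun f \<Longrightarrow> continuous_on X f"
  using smooth_fun_has_deriv DERIV_isCont continuous_at_imp_continuous_on by blast

lemma periodic_deriv: "periodic_2pi f \<Longrightarrow> periodic_2pi (deriv f)"
proof -
  assume p: "periodic_2pi f"
  have "(\<lambda>x. f (x + 2 * pi)) = f" using p by (auto simp: periodic_2pi_def)
  then have "(f has_real_derivative D) (at (x + 2 * pi)) \<longleftrightarrow> (f has_real_derivative D) (at x)" for x D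
    using DERIV_shift[of f D x "2 * pi"] by simp
  then show ?thesis by (simp add: periodic_2pi_def deriv_def)
qed

lemma reg_smooth: "smooth_fun f \<Longrightarrow> reg k S (\<lambda>_. f)"
proof (induct k arbitrary: f)
  case 0
  then show ?case unfolding reg.simps jcont_def case_prod_unfold
    by (intro continuous_on_compose2[OF smooth_fun_continuous[of f UNIV]]) (auto intro: continuous_intros)
next
  case (Suc k)
  show ?case
  proof (rule reg_SucI)
    show "reg k S (\<lambda>_. deriv f)" by (rule Suc.hyps[OF smooth_fun_deriv[OF Suc.prems]])
    show "jcont S (\<lambda>_. f)" unfolding jcont_def case_prod_unfold
      by (intro continuous_on_compose2[OF smooth_fun_continuous[of f UNIV]]) (auto intro: continuous_intros Suc.prems)
  qed (rule smooth_fun_has_deriv[OF Suc.prems])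
qed

lemma reg_higher_deriv:
  "reg (k + m) S f \<Longrightarrow> \<exists>g. reg m S g \<and> (\<forall>t\<in>S. (deriv ^^ k) (f t) = g t)"
proof (induct k arbitrary: f)
  case (Suc k)
  then obtain f' where f: "reg (k + m) S f'" "\<And>t x. t \<in> S \<Longrightarrow> (f t has_real_derivative f' t x) (at x)"
    by auto
  from Suc.hyps[OF f(1)] obtain g where g: "reg m S g" "\<forall>t\<in>S. (deriv ^^ k) (f' t) = g t" by blast
  have "deriv (f t) = f' t" if "t \<in> S" for t using f(2)[OF that] by (auto intro: DERIV_imp_deriv)
  with g show ?case by (auto simp: funpow_Suc_right simp del: funpow.simps)
qed auto

lemma reg_all_smooth:
  assumes "\<And>k. reg k S f"
  shows "t \<in> S \<Longrightarrow> smooth_fun (f t)" and "jcont S (\<lambda>t. (deriv ^^ k) (f t))"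
proof -
  show "smooth_fun (f t)" if t: "t \<in> S"
    unfolding smooth_fun_def
  proof (intro allI)
    fix k x
    obtain g where g: "reg 1 S g" "\<forall>t\<in>S. (deriv ^^ k) (f t) = g t"
      using reg_higher_deriv[OF assms[of "k + 1"]] by blast
    then obtain h where "(g t has_real_derivative h t x) (at x)" using t by (auto simp: One_nat_def)
    with g(2) t show "(deriv ^^ k) (f t) differentiable at x"
      by (auto simp: real_differentiable_def)
  qed
  obtain g where g: "reg 0 S g" "\<forall>t\<in>S. (deriv ^^ k) (f t) = g t"
    using reg_higher_deriv[of k 0 S f] assms[of "k + 0"] by blast
  show "jcont S (\<lambda>t. (deriv ^^ k) (f t))"
    by (rule jcont_cong[of S g]) (use g in auto)
qed

lemma DERIV_mult_zero:
  fixes f g :: "real \<Rightarrow> real"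
  assumes "(f has_real_derivative D) (at t within S)" "f t = 0" "continuous (at t within S) g"
  shows "((\<lambda>s. f s * g s) has_real_derivative D * g t) (at t within S)"
proof -
  have "((\<lambda>s. (f s - f t) / (s - t) * g s) \<longlongrightarrow> D * g t) (at t within S)"
    using assms by (intro tendsto_mult) (auto simp: has_field_derivative_iff continuous_within)
  then show ?thesis using assms(2) by (simp add: has_field_derivative_iff)
qed

section \<open>The flow map, its inverse and the Eulerian velocity\<close>

context ch_flow
begin

text \<open>\<open>A\<close> fixes the particle 0; adding the displacement of that particle restores
  the flow of u.\<close>

definition "\<eta> t x = integral {0..t} (\<lambda>s. U s 0) + A t x"

lemma \<eta>_j: "jcont {0..T} \<eta>"
proof -
  have "jcont {0..T} (\<lambda>t x. U t 0)"
    unfolding jcont_def case_prod_unfold by (intro jcont_comp[OF U_j] continuous_intros) auto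
  from jcont_time_integral[OF this] show ?thesis
    using A_j unfolding jcont_def \<eta>_def case_prod_unfold by (intro continuous_intros)
qed

lemma \<eta>_0 [simp]: "\<eta> 0 x = x"
  by (simp add: \<eta>_def)

context
  fixes t assumes t: "t \<in> {0..T}"
begin

lemma \<eta>_x: "(\<eta> t has_real_derivative V t x) (at x)"
  unfolding \<eta>_def[abs_def] using A_x[OF t] by (auto intro!: derivative_eq_intros)

lemma \<eta>_shift: "\<eta> t (x + 2 * pi) = \<eta> t x + 2 * pi"
  by (simp add: \<eta>_def A_2pi[OF t])

lemma \<eta>_diff: "\<eta> t x - \<eta> t y = A t x - A t y"
  by (simp add: \<eta>_def)

lemma \<eta>_t: "((\<lambda>s. \<eta> s x) has_real_derivative U t x) (at t within {0..T})"
proof -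
  have "((\<lambda>s. integral {0..s} (\<lambda>s. U s 0)) has_real_derivative U t 0) (at t within {0..T})"
    using integral_has_vector_derivative[OF jcont_time[OF U_j, of 0] t]
    by (simp add: has_real_derivative_iff_has_vector_derivative)
  from DERIV_add[OF this A_t[OF t, of x]] show ?thesis by (simp add: \<eta>_def[abs_def])
qed

text \<open>\<open>\<bar>l\<bar> \<le> 1\<close> bounds \<eta>_x below by \<open>exp (- 1)\<close>.
  This single inequality yields injectivity, surjectivity and the joint continuity of the
  inverse.\<close>

lemma \<eta>_expand: assumes "x \<le> y" shows "exp (- 1) * (y - x) \<le> \<eta> t y - \<eta> t x"
proof -
  have "\<eta> t x - exp (- 1) * x \<le> \<eta> t y - exp (- 1) * y"
    by (rule DERIV_nonneg_imp_nondecreasing[OF assms, where f="\<lambda>x. \<eta> t x - exp (- 1) * x"])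
      (use l_1[OF t] in \<open>auto intro!: exI[of _ "V t _ - exp (- 1)"] derivative_eq_intros \<eta>_x simp: V_def abs_le_iff\<close>)
  then show ?thesis by (simp add: algebra_simps)
qed

lemma \<eta>_expand_abs: "exp (- 1) * \<bar>y - x\<bar> \<le> \<bar>\<eta> t y - \<eta> t x\<bar>"
  using \<eta>_expand[of x y] \<eta>_expand[of y x] by (cases "x \<le> y") (auto simp: abs_if not_le)

lemma \<eta>_inj: "\<eta> t x = \<eta> t y \<longleftrightarrow> x = y"
  using \<eta>_expand_abs[of x y] by (auto simp: mult_le_0_iff)

lemma \<eta>_surj: "\<exists>x. \<eta> t x = y"
proof -
  define R where "R = exp 1 * \<bar>y - \<eta> t 0\<bar>"
  have R: "exp (- 1) * R = \<bar>y - \<eta> t 0\<bar>" "0 \<le> R" by (simp_all add: R_def exp_minus)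
  have "\<eta> t (- R) \<le> y" "y \<le> \<eta> t R"
    using \<eta>_expand[of "- R" 0] \<eta>_expand[of 0 R] R by (auto simp: abs_if split: if_splits)
  moreover have "isCont (\<eta> t) x" for x using \<eta>_x DERIV_isCont by blast
  ultimately show ?thesis using IVT[of "\<eta> t" "- R" y R] R(2) by auto
qed

end

definition "X t y = (THE x. \<eta> t x = y)"

lemma \<eta>_X: "t \<in> {0..T} \<Longrightarrow> \<eta> t (X t y) = y"
  unfolding X_def using theI'[of "\<lambda>x. \<eta> t x = y"] \<eta>_surj[of t y] \<eta>_inj[of t] by metis

lemma X_\<eta>: "t \<in> {0..T} \<Longrightarrow> X t (\<eta> t x) = x"
  using \<eta>_X \<eta>_inj by blast

text \<open>Expansion of the flow bounds the distance from \<open>X t y\<close> to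
  \<open>X t0 y0\<close> by e times the distance from y to \<open>\<eta> t (X t0 y0)\<close>, which
  is jointly continuous and vanishes at \<open>(t0, y0)\<close>.\<close>

lemma X_j: "jcont {0..T} X"
  unfolding jcont_def continuous_on_def
proof (clarsimp)
  fix t0 y0 assume t0: "0 \<le> t0" "t0 \<le> T"
  let ?S = "{0..T} \<times> (UNIV :: real set)"
  have c: "continuous_on ?S (\<lambda>z. exp 1 * (snd z - \<eta> (fst z) (X t0 y0)))"
    by (intro continuous_intros jcont_comp[OF \<eta>_j]) auto
  then have "((\<lambda>z. exp 1 * (snd z - \<eta> (fst z) (X t0 y0))) \<longlongrightarrow> exp 1 * (y0 - \<eta> t0 (X t0 y0))) (at (t0, y0) within ?S)"
    using t0 unfolding continuous_on_def by fastforce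
  then have lim: "((\<lambda>z. exp 1 * (snd z - \<eta> (fst z) (X t0 y0))) \<longlongrightarrow> 0) (at (t0, y0) within ?S)"
    using \<eta>_X[of t0 y0] t0 by simp
  have "((\<lambda>z. (case z of (t, y) \<Rightarrow> X t y) - X t0 y0) \<longlongrightarrow> 0) (at (t0, y0) within ?S)"
  proof (rule Lim_null_comparison[OF _ tendsto_norm_zero[OF lim]])
    show "\<forall>\<^sub>F z in at (t0, y0) within ?S. norm ((case z of (t, y) \<Rightarrow> X t y) - X t0 y0)
        \<le> norm (exp 1 * (snd z - \<eta> (fst z) (X t0 y0)))"
    proof (unfold eventually_at_filter, rule always_eventually, clarsimp)
      fix t y assume "0 \<le> t" "t \<le> T"
      then have "exp (- 1) * \<bar>X t y - X t0 y0\<bar> \<le> \<bar>y - \<eta> t (X t0 y0)\<bar>"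
        using \<eta>_expand_abs[of t "X t y" "X t0 y0"] \<eta>_X[of t y] by simp
      then show "\<bar>X t y - X t0 y0\<bar> \<le> \<bar>exp 1 * (y - \<eta> t (X t0 y0))\<bar>"
        using mult_left_mono[of "exp (- 1) * \<bar>X t y - X t0 y0\<bar>" "\<bar>y - \<eta> t (X t0 y0)\<bar>" "exp 1"]
        by (simp add: mult.assoc[symmetric] exp_minus_inverse abs_mult)
    qed
  qed
  then show "((\<lambda>(t, y). X t y) \<longlongrightarrow> X t0 y0) (at (t0, y0) within ?S)"
    using LIM_zero_iff by blast
qed

lemma X_y: assumes t: "t \<in> {0..T}" shows "(X t has_real_derivative inverse (V t (X t y))) (at y)"
proof (rule DERIV_inverse_function[where f="\<eta> t" and a="y - 1" and b="y + 1"])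
  show "isCont (X t) y" using jcont_section[OF X_j t, of UNIV] by (simp add: continuous_on_eq_continuous_at)
  show "V t (X t y) \<noteq> 0" using V_pos[of t] by (simp add: less_imp_neq[symmetric])
qed (use \<eta>_X[OF t] \<eta>_x[OF t] in auto)

text \<open>The x-derivatives of \<open>U\<close>, \<open>W\<close> and \<open>V\<close> are again
  expressions in \<open>U\<close>, \<open>W\<close>, \<open>V\<close>, \<open>m0\<close> and time
  integrals, so each round of the induction gains one derivative for all three at once.\<close>

lemma reg_flow:
  assumes "smooth_fun m0"
  shows "reg k {0..T} U \<and> reg k {0..T} W \<and> reg k {0..T} V"
proof (induct k)
  case 0
  then show ?case using U_j W_j V_j by simp
next
  case (Suc k)
  then have R: "reg k {0..T} U" "reg k {0..T} W" "reg k {0..T} V" by auto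
  have "reg k {0..T} (\<lambda>t x. inverse (V t x))"
    by (rule reg_inverse[OF _ R(3)]) (simp add: V_pos less_imp_neq[symmetric])
  then have n: "reg k {0..T} n"
    by (rule reg_cong[rotated, OF reg_mult[OF reg_smooth[OF assms, of k "{0..T}"]]]) (simp add: n_def V_def exp_minus)
  have WV: "reg k {0..T} (\<lambda>t x. W t x * V t x)" by (intro reg_mult R)
  have Wx: "reg k {0..T} (\<lambda>t x. V t x * U t x + (- 1) * n t x)" by (intro reg_add reg_cmult reg_mult R n)
  have Vx: "reg k {0..T} (\<lambda>t x. V t x * integral {0..t} (\<lambda>s. V s x * U s x + (- 1) * n s x))"
    by (intro reg_mult R reg_time_integral Wx)
  have "(V t has_real_derivative V t x * integral {0..t} (\<lambda>s. V s x * U s x + (- 1) * n s x)) (at x)"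
    if t: "t \<in> {0..T}" for t x
  proof -
    have st: "s \<in> {0..T}" if "s \<in> {0..t}" for s using that t by auto
    \<comment> \<open>\<open>V\<close> is differentiated through \<open>l\<close>, which as the time
      integral of \<open>W\<close> has the time integral of \<open>W_x\<close> as its
      x-derivative.\<close>
    have l: "integral {0..t} (\<lambda>s. W s x) = l t x" for x
    proof -
      have "((\<lambda>s. W s x) has_integral l t x - l 0 x) {0..t}"
      proof (rule fundamental_theorem_of_calculus)
        fix s assume s: "s \<in> {0..t}"
        from l_t[OF st[OF s]] show "((\<lambda>s. l s x) has_vector_derivative W s x) (at s within {0..t})"
          unfolding W_def using t has_real_derivative_iff_has_vector_derivative has_vector_derivative_within_subset
          by (metis atLeastAtMost_iff atLeastatMost_subset_iff order_refl)
      qed (use t in auto)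
      then show ?thesis by (simp add: integral_unique l_0)
    qed
    have "((\<lambda>x. integral {0..t} (\<lambda>s. W s x)) has_real_derivative
        integral {0..t} (\<lambda>s. V s x * U s x + (- 1) * n s x)) (at x within UNIV)"
    proof (rule leibniz_interval)
      show "continuous_on (UNIV \<times> {0..t}) (\<lambda>(x, s). V s x * U s x + (- 1) * n s x)"
        unfolding case_prod_unfold
        by (intro continuous_intros jcont_comp[OF V_j] jcont_comp[OF U_j] jcont_comp[OF n_j]) (use st in auto)
      show "continuous_on {0..t} (\<lambda>s. W s x)" for x
        by (rule continuous_on_subset[OF jcont_time[OF W_j]]) (use st in auto)
      show "((\<lambda>x. W s x) has_real_derivative V s x * U s x + (- 1) * n s x) (at x within UNIV)"
        if "s \<in> {0..t}" for x s using W_x[OF st[OF that]] by simp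
    qed auto
    then have "(l t has_real_derivative integral {0..t} (\<lambda>s. V s x * U s x + (- 1) * n s x)) (at x)"
      by (simp add: l)
    from DERIV_chain2[OF DERIV_exp this] show ?thesis by (simp add: V_def[abs_def])
  qed
  with Vx have V': "reg (Suc k) {0..T} V" using V_j by (intro reg_SucI) auto
  have "reg (Suc k) {0..T} U" by (rule reg_SucI[OF WV _ U_j]) (rule U_x)
  moreover have "reg (Suc k) {0..T} W" by (rule reg_SucI[OF Wx _ W_j]) (use W_x in simp)
  ultimately show ?case using V' by blast
qed

lemma reg_comp_X:
  assumes V: "\<And>k. reg k {0..T} V"
  shows "reg k {0..T} f \<Longrightarrow> reg k {0..T} (\<lambda>t y. f t (X t y))"
proof (induct k arbitrary: f)
  case 0
  then show ?case unfolding reg.simps unfolding jcont_def[of _ "\<lambda>t y. f t (X t y)"] case_prod_unfold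
    by (intro jcont_comp[of "{0..T}" f] jcont_comp[OF X_j] continuous_intros) auto
next
  case (Suc k)
  then obtain g where g: "reg k {0..T} g" "\<And>t x. t \<in> {0..T} \<Longrightarrow> (f t has_real_derivative g t x) (at x)"
    by auto
  have "reg k {0..T} (\<lambda>t x. g t x * inverse (V t x))"
    by (intro reg_mult g reg_inverse V) (simp add: V_pos less_imp_neq[symmetric])
  from Suc.hyps[OF this] show ?case
  proof (rule reg_SucI)
    show "jcont {0..T} (\<lambda>t y. f t (X t y))"
      unfolding jcont_def case_prod_unfold
      by (intro jcont_comp[OF reg_jcont[OF Suc.prems]] jcont_comp[OF X_j] continuous_intros) auto
  qed (rule DERIV_chain2[OF g(2) X_y])
qed

definition "u t y = U t (X t y)"

lemma u_\<eta>: "t \<in> {0..T} \<Longrightarrow> u t (\<eta> t x) = U t x"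
  by (simp add: u_def X_\<eta>)

lemma u_0: "u 0 = u0"
proof
  have "0 \<in> {0..T}" using T by simp
  from u_\<eta>[OF this] show "u 0 y = u0 y" for y by simp
qed

lemma u_x: "t \<in> {0..T} \<Longrightarrow> (u t has_real_derivative W t (X t y)) (at y)"
  unfolding u_def[abs_def]
  by (rule DERIV_cong[OF DERIV_chain2[OF U_x X_y]]) (use V_pos[of t] in \<open>auto simp: less_imp_neq[symmetric]\<close>)

lemma u_periodic: assumes t: "t \<in> {0..T}" shows "periodic_2pi (u t)"
proof -
  have "X t (y + 2 * pi) = X t y + 2 * pi" for y
    using \<eta>_inj[OF t] \<eta>_X[OF t] \<eta>_shift[OF t] by metis
  then show ?thesis using U_per[OF t] by (simp add: periodic_2pi_def u_def)
qed

lemma reg_u: "smooth_fun m0 \<Longrightarrow> reg k {0..T} u"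
  unfolding u_def[abs_def] by (rule reg_comp_X) (use reg_flow in auto)

text \<open>The inverse flow is never differentiated in time. With the particle x that is at y at
  time t, \<open>u s y\<close> equals \<open>U s x\<close> minus the displacement
  \<open>\<eta> s x - y\<close> times the mean \<open>I s\<close> of u_x over it; the displacement
  vanishes at s = t.\<close>

lemma u_t:
  assumes t: "t \<in> {0..T}"
  shows "((\<lambda>s. u s y) has_real_derivative B t (X t y) - W t (X t y) * u t y) (at t within {0..T})"
proof -
  define x where "x = X t y"
  have y: "y = \<eta> t x" by (simp add: x_def \<eta>_X[OF t])
  define I where "I s = integral {0..1} (\<lambda>r. W s (X s (y + (\<eta> s x - y) * r)))" for s
  have cW: "jcont {0..T} (\<lambda>s y. W s (X s y))"
    unfolding jcont_def case_prod_unfold by (intro jcont_comp[OF W_j] jcont_comp[OF X_j] continuous_intros) auto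
  have Iu: "(\<eta> s x - y) * I s = U s x - u s y" if s: "s \<in> {0..T}" for s
  proof -
    have "antider (\<lambda>z. W s (X s (y + z))) (\<eta> s x - y) = u s (y + (\<eta> s x - y)) - u s (y + 0)"
      by (rule antider_eq[where F="\<lambda>z. u s (y + z)"])
        (use u_x[OF s] in \<open>auto simp: add.commute[of y] DERIV_shift[symmetric]\<close>)
    then show ?thesis by (simp add: antider_def I_def u_\<eta>[OF s])
  qed
  have "continuous_on {0..T} I"
  proof -
    have "jcont {0..T} (\<lambda>s z. integral {0..1} (\<lambda>r. W s (X s (y + (\<eta> s x - y) * r))))"
      by (rule jcont_integral_param)
        (auto simp: case_prod_unfold intro!: jcont_comp[OF cW] jcont_comp[OF \<eta>_j] continuous_intros)
    from jcont_time[OF this] show ?thesis by (simp add: I_def[abs_def])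
  qed
  then have "continuous (at t within {0..T}) I" using t by (simp add: continuous_on_eq_continuous_within)
  with \<eta>_t[OF t, of x] have "((\<lambda>s. (\<eta> s x - y) * I s) has_real_derivative U t x * I t) (at t within {0..T})"
    by (intro DERIV_mult_zero) (auto simp: y intro!: derivative_eq_intros)
  moreover have "I t = W t x" by (simp add: I_def x_def \<eta>_X[OF t])
  ultimately have "((\<lambda>s. U s x - (\<eta> s x - y) * I s) has_real_derivative B t x - U t x * W t x) (at t within {0..T})"
    by (intro DERIV_diff U_t[OF t]) simp
  then have "((\<lambda>s. u s y) has_real_derivative B t x - U t x * W t x) (at t within {0..T})"
    by (rule has_field_derivative_transform_within[where d=1]) (use t Iu in auto)
  then show ?thesis by (simp add: x_def u_def mult.commute)
qed

text \<open>The substitution \<open>z = A t (x + r) - A t x\<close> carries one period onto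
  \<open>[0, 2 * pi]\<close> because the circumference is exact; it is carried out by comparing
  primitives.\<close>

lemma B_eulerian:
  assumes t: "t \<in> {0..T}"
  shows "B t (X t y) = conv Ks (\<lambda>x. x) (\<lambda>y. (u t y)\<^sup>2 + (deriv (u t) y)\<^sup>2 / 2) y"
proof -
  define f where "f z = (u t z)\<^sup>2 + (deriv (u t) z)\<^sup>2 / 2" for z
  have d: "deriv (u t) z = W t (X t z)" for z using u_x[OF t] by (rule DERIV_imp_deriv)
  have f: "f z = F t (X t z)" for z by (simp add: f_def F_def d u_def)
  have fc: "continuous_on UNIV f" unfolding f
    by (rule jcont_comp[OF F_j]) (use t in \<open>auto intro!: continuous_intros jcont_comp[OF X_j]\<close>)
  define x where "x = X t y"
  define h where "h z = Ks z * f (y + z)" for z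
  have hc: "continuous_on UNIV h" unfolding h_def
    by (intro continuous_intros continuous_on_compose2[OF fc]) auto
  note H = antider_deriv[OF hc]
  have "((\<lambda>z. h z) has_integral antider h (2 * pi) - antider h 0) {0..2*pi}"
    by (rule ftc_real[OF _ H]) simp
  moreover have "((\<lambda>r. Ks (A t (x + r) - A t x) * (F t (x + r) * V t (x + r))) has_integral
      antider h (A t (x + 2 * pi) - A t x) - antider h (A t (x + 0) - A t x)) {0..2*pi}"
  proof (rule ftc_real)
    fix r
    have "((\<lambda>r. A t (x + r)) has_real_derivative V t (x + r)) (at r)"
      using A_x[OF t, of "x + r"] by (simp add: add.commute[of x] DERIV_shift[symmetric])
    then have "((\<lambda>r. A t (x + r) - A t x) has_real_derivative V t (x + r)) (at r)"
      by (auto intro!: derivative_eq_intros)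
    from DERIV_chain2[OF H this]
    have "((\<lambda>r. antider h (A t (x + r) - A t x)) has_real_derivative
      h (A t (x + r) - A t x) * V t (x + r)) (at r)" .
    moreover have "f (y + (A t (x + r) - A t x)) = F t (x + r)"
    proof -
      have "y + (A t (x + r) - A t x) = \<eta> t (x + r)"
        using \<eta>_diff[of t "x + r" x] t \<eta>_X[OF t, of y] by (simp add: x_def)
      then show ?thesis by (simp add: f X_\<eta>[OF t])
    qed
    ultimately show "((\<lambda>r. antider h (A t (x + r) - A t x)) has_real_derivative
      Ks (A t (x + r) - A t x) * (F t (x + r) * V t (x + r))) (at r)" by (simp add: h_def mult.assoc)
  qed simp
  then have "B t x = antider h (2 * pi) - antider h 0"
    unfolding B_def conv_def A_2pi[OF t] by (simp add: integral_unique)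
  ultimately show ?thesis
    unfolding x_def conv_def h_def f_def by (simp add: integral_unique)
qed

end

section \<open>Fourier series\<close>

lemma fourier_coeff_bound:
  assumes "continuous_on UNIV f" "\<And>x. \<bar>f x\<bar> \<le> B"
  shows "norm (fourier_coeff f \<xi>) \<le> B * (2 * pi)"
proof -
  have "norm (fourier_coeff f \<xi>) \<le> B * (2 * pi - 0)"
    unfolding fourier_coeff_def
    by (rule integral_bound)
      (auto simp: norm_mult assms(2) intro!: continuous_intros continuous_on_subset[OF assms(1)])
  then show ?thesis by simp
qed

lemma integral_periodic_complex:
  fixes f :: "real \<Rightarrow> complex"
  assumes c: "continuous_on UNIV f" and p: "periodic_2pi f"
  shows "integral {0..2 * pi} (\<lambda>s. f (x + s)) = integral {0..2 * pi} f"
proof (rule complex_eqI)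
  have i: "f integrable_on {0..2*pi}" "(\<lambda>s. f (x + s)) integrable_on {0..2*pi}"
    by (intro integrable_continuous_real continuous_on_compose2[OF c] continuous_intros; simp)+
  have per: "periodic_2pi (\<lambda>s. Re (f s))" "periodic_2pi (\<lambda>s. Im (f s))" using p by (simp_all add: periodic_2pi_def)
  note r = integral_linear[OF i(1) bounded_linear_Re] integral_linear[OF i(2) bounded_linear_Re]
    integral_linear[OF i(1) bounded_linear_Im] integral_linear[OF i(2) bounded_linear_Im]
  show "Re (integral {0..2 * pi} (\<lambda>s. f (x + s))) = Re (integral {0..2 * pi} f)"
    using integral_periodic[OF _ per(1), of x] c r by (auto simp: o_def intro!: continuous_intros)
  show "Im (integral {0..2 * pi} (\<lambda>s. f (x + s))) = Im (integral {0..2 * pi} f)"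
    using integral_periodic[OF _ per(2), of x] c r by (auto simp: o_def intro!: continuous_intros)
qed

lemma cis_2pi_int: "cis (2 * pi * of_int k) = 1"
  by (simp add: cis_multiple_2pi)

lemma periodic_cis: "periodic_2pi (\<lambda>x. cis (x * of_int k))" "periodic_2pi (\<lambda>x. cis (- x * of_int k))"
proof -
  have *: "cis ((x + 2 * pi) * of_int k) = cis (x * of_int k)" for x and k :: int
  proof -
    have "cis ((x + 2 * pi) * of_int k) = cis (x * of_int k) * cis (2 * pi * of_int k)"
      unfolding cis_mult distrib_right ..
    then show ?thesis by (simp only: cis_2pi_int mult_1_right)
  qed
  show "periodic_2pi (\<lambda>x. cis (x * of_int k))" unfolding periodic_2pi_def using * by blast
  show "periodic_2pi (\<lambda>x. cis (- x * of_int k))" unfolding periodic_2pi_def using *[of _ "- k"]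
    by (simp only: of_int_minus mult_minus_right mult_minus_left) simp
qed

lemma cis_has_deriv:
  "((\<lambda>x. cis (x * a)) has_vector_derivative (\<i> * of_real a * cis (x * a))) (at x within S)"
proof -
  have "((\<lambda>x. exp (\<i> * of_real a * of_real x)) has_vector_derivative (\<i> * of_real a * exp (\<i> * of_real a * of_real x))) (at x within S)"
    by (rule has_vector_derivative_real_field) (auto intro!: derivative_eq_intros)
  then show ?thesis by (simp add: cis_conv_exp mult_ac)
qed

lemma integral_cis:
  "integral {0..2 * pi} (\<lambda>x. cis (x * of_int k)) = (if k = 0 then 2 * pi else 0)"
proof (cases "k = 0")
  case False
  have "((\<lambda>x. cis (x * of_int k)) has_integral
      cis (2 * pi * of_int k) / (\<i> * of_int k) - cis (0 * of_int k) / (\<i> * of_int k)) {0..2*pi}"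
  proof (rule fundamental_theorem_of_calculus)
    fix x
    show "((\<lambda>x. cis (x * of_int k) / (\<i> * of_int k)) has_vector_derivative cis (x * of_int k)) (at x within {0..2*pi})"
      using has_vector_derivative_divide[OF cis_has_deriv[of "of_int k" x "{0..2*pi}"], of "\<i> * of_int k"] False by simp
  qed simp
  then show ?thesis using False by (simp add: integral_unique cis_2pi_int)
qed (simp add: scaleR_conv_of_real)

lemma fourier_coeff_deriv:
  assumes f: "\<And>x. (f has_real_derivative f' x) (at x)" and c: "continuous_on UNIV f'" and p: "periodic_2pi f"
  shows "fourier_coeff f' \<xi> = \<i> * of_int \<xi> * fourier_coeff f \<xi>"
proof -
  have cf: "continuous_on UNIV f" using f DERIV_isCont continuous_at_imp_continuous_on by blast
  have "((\<lambda>x. cis (- x * of_int \<xi>) * of_real (f' x) + (- \<i> * of_int \<xi>) * (cis (- x * of_int \<xi>) * of_real (f x)))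
     has_integral cis (- (2 * pi) * of_int \<xi>) * of_real (f (2 * pi)) - cis (- 0 * of_int \<xi>) * of_real (f 0)) {0..2*pi}"
  proof (rule fundamental_theorem_of_calculus)
    fix x
    have 1: "((\<lambda>x. complex_of_real (f x)) has_vector_derivative complex_of_real (f' x)) (at x within {0..2*pi})"
      using DERIV_subset[OF f[of x]] by (intro has_vector_derivative_of_real) simp
    have 2: "((\<lambda>x. cis (- x * of_int \<xi>)) has_vector_derivative (- \<i> * of_int \<xi> * cis (- x * of_int \<xi>))) (at x within {0..2*pi})"
      using cis_has_deriv[of "- of_int \<xi>" x] by simp
    show "((\<lambda>x. cis (- x * of_int \<xi>) * complex_of_real (f x)) has_vector_derivative
        (cis (- x * of_int \<xi>) * of_real (f' x) + (- \<i> * of_int \<xi>) * (cis (- x * of_int \<xi>) * of_real (f x)))) (at x within {0..2*pi})"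
      using has_vector_derivative_mult[OF 2 1] by (simp add: mult_ac)
  qed simp
  moreover have "f (2 * pi) = f 0" "cis (- (2 * pi) * of_int \<xi>) = 1"
    using p[unfolded periodic_2pi_def, rule_format, of 0] cis_2pi_int[of "- \<xi>"] by simp_all
  ultimately have "integral {0..2*pi} (\<lambda>x. cis (- x * of_int \<xi>) * of_real (f' x) + (- \<i> * of_int \<xi>) * (cis (- x * of_int \<xi>) * of_real (f x))) = 0"
    by (simp add: integral_unique)
  moreover have "integral {0..2*pi} (\<lambda>x. cis (- x * of_int \<xi>) * of_real (f' x) + (- \<i> * of_int \<xi>) * (cis (- x * of_int \<xi>) * of_real (f x)))
     = fourier_coeff f' \<xi> + (- \<i> * of_int \<xi>) * fourier_coeff f \<xi>"
    unfolding fourier_coeff_def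
    by (subst integral_add)
      (auto intro!: integrable_continuous_real continuous_intros continuous_on_subset[OF c] continuous_on_subset[OF cf])
  ultimately show ?thesis by simp
qed

text \<open>Shifting by half a wavelength reverses the sign of the exponential, so twice the
  integral equals that of the increment of \<open>h\<close>, small by uniform continuity.\<close>

lemma riemann_lebesgue_bound:
  fixes h :: "real \<Rightarrow> complex"
  assumes c: "continuous_on UNIV h" and p: "periodic_2pi h" and \<epsilon>: "\<epsilon> > 0"
  shows "\<exists>N::nat. \<forall>\<xi>::int. \<bar>\<xi>\<bar> \<ge> int N \<longrightarrow> norm (integral {0..2*pi} (\<lambda>x. cis (- x * of_int \<xi>) * h x)) < \<epsilon>"
proof -
  have "uniformly_continuous_on {0..4*pi} h"
    by (intro compact_uniformly_continuous continuous_on_subset[OF c]) auto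
  then obtain d where d: "d > 0" "\<And>x y. x \<in> {0..4*pi} \<Longrightarrow> y \<in> {0..4*pi} \<Longrightarrow> dist y x < d \<Longrightarrow> dist (h y) (h x) < \<epsilon> / pi / 2"
    unfolding uniformly_continuous_on_def using \<epsilon> pi_gt_zero by (metis divide_pos_pos zero_less_numeral)
  obtain N :: nat where N: "pi / d < of_nat N" using reals_Archimedean2 by blast
  have N0: "N > 0" using N d by (metis divide_pos_pos gr0I less_asym of_nat_0 pi_gt_zero)
  have main: "norm (integral {0..2*pi} (\<lambda>x. cis (- x * of_int \<xi>) * h x)) < \<epsilon>" if \<xi>: "\<bar>\<xi>\<bar> \<ge> int N" for \<xi> :: int
  proof -
    have \<xi>0: "\<xi> \<noteq> 0" using \<xi> N0 by auto
    define s where "s = pi / \<bar>of_int \<xi>\<bar>"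
    have s: "0 < s" "s < d" "s \<le> pi"
    proof -
      have a: "real N \<le> \<bar>of_int \<xi>\<bar>" using \<xi> by linarith
      show "0 < s" using \<xi>0 by (simp add: s_def)
      have "pi < d * \<bar>of_int \<xi>\<bar>" using N d a by (simp add: pos_divide_less_eq) (smt (verit) mult.commute mult_left_mono)
      then show "s < d" using \<xi>0 by (simp add: s_def pos_divide_less_eq)
      have "1 \<le> \<bar>real_of_int \<xi>\<bar>" using \<xi>0 by linarith
      then show "s \<le> pi" by (simp add: s_def pos_divide_le_eq)
    qed
    let ?I = "integral {0..2*pi} (\<lambda>x. cis (- x * of_int \<xi>) * h x)"
    have "cis (- s * of_int \<xi>) = -1"
      using \<xi>0 by (cases "\<xi> > 0") (simp_all add: s_def cis.ctr complex_eq_iff)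
    then have shift: "cis (- (s + x) * of_int \<xi>) = - cis (- x * of_int \<xi>)" for x
    proof -
      have "cis (- (s + x) * of_int \<xi>) = cis (- s * of_int \<xi>) * cis (- x * of_int \<xi>)"
        by (simp add: cis_mult algebra_simps)
      with \<open>cis (- s * of_int \<xi>) = -1\<close> show ?thesis by simp
    qed
    have cc: "continuous_on X (\<lambda>x. h (s + x))" "continuous_on X h" for X
      by (intro continuous_on_compose2[OF c] continuous_intros; simp)+
    have "?I = integral {0..2*pi} (\<lambda>x. cis (- (s + x) * of_int \<xi>) * h (s + x))"
      by (rule integral_periodic_complex[symmetric])
        (use periodic_cis(2)[of \<xi>] p in \<open>auto simp: periodic_2pi_def intro!: continuous_intros c\<close>)
    also have "\<dots> = - integral {0..2*pi} (\<lambda>x. cis (- x * of_int \<xi>) * h (s + x))"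
      unfolding shift by simp
    finally have "2 * ?I = ?I - integral {0..2*pi} (\<lambda>x. cis (- x * of_int \<xi>) * h (s + x))" by simp
    also have "\<dots> = integral {0..2*pi} (\<lambda>x. cis (- x * of_int \<xi>) * (h x - h (s + x)))"
      by (subst integral_diff[symmetric])
        (auto simp: right_diff_distrib intro!: integrable_continuous_real continuous_intros cc)
    also have "norm \<dots> \<le> \<epsilon> / pi / 2 * (2 * pi - 0)"
    proof (rule integral_bound)
      fix x assume "x \<in> {0..2*pi}"
      then have "dist (h x) (h (s + x)) < \<epsilon> / pi / 2" using s by (intro d(2)) (auto simp: dist_real_def)
      then show "norm (cis (- x * of_int \<xi>) * (h x - h (s + x))) \<le> \<epsilon> / pi / 2"
        by (simp add: norm_mult dist_norm)
    qed (auto intro!: continuous_intros cc)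
    finally have "2 * norm ?I \<le> \<epsilon>" by (simp add: norm_mult)
    then show ?thesis using \<epsilon> by simp
  qed
  then show ?thesis by blast
qed

text \<open>The singularities at multiples of \<open>2 * pi\<close> are removable with value g'(0) /
  i. The quotient makes the Fourier coefficients of \<open>g - g 0\<close> telescope in
  \<open>fourier_inversion\<close>.\<close>

lemma difference_quotient_continuous:
  fixes g :: "real \<Rightarrow> real"
  assumes g: "\<And>x. (g has_real_derivative g' x) (at x)" and g': "continuous_on UNIV g'" and p: "periodic_2pi g"
  defines "h \<equiv> \<lambda>y. if cis y = 1 then complex_of_real (g' 0) / \<i> else complex_of_real (g y - g 0) / (cis y - 1)"
  shows "continuous_on UNIV h" "periodic_2pi h" "(cis y - 1) * h y = complex_of_real (g y - g 0)"
proof -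
  have cg: "isCont g x" for x using g DERIV_isCont by blast
  have per_eq: "g y = g 0" "g' y = g' 0" if y: "cis y = 1" for y
  proof -
    obtain k :: int where k: "y = of_int k * (2 * pi)"
      using arg_cong[OF y, of Re] cos_one_2pi_int[of y] by (auto simp: mult.assoc)
    show "g y = g 0" using periodic_int[OF p, of 0 k] k by simp
    have "(\<lambda>x. g (x + of_int k * (2 * pi))) = g" using periodic_int[OF p] by auto
    then have "(g has_real_derivative g' y) (at 0)"
      using g[of "0 + of_int k * (2 * pi)"] DERIV_shift[of g "g' y" 0 "of_int k * (2 * pi)"] k by simp
    then show "g' y = g' 0" using g[of 0] DERIV_unique by blast
  qed
  show "(cis y - 1) * h y = complex_of_real (g y - g 0)"
    using per_eq(1)[of y] by (simp add: h_def)
  show "periodic_2pi h" using p periodic_cis(1)[of 1] by (simp add: periodic_2pi_def h_def)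
  show "continuous_on UNIV h"
    unfolding continuous_on_eq_continuous_at[OF open_UNIV]
  proof
    fix y
    have ccis: "continuous_on UNIV cis" by (intro continuous_intros)
    then have cis: "isCont cis y" by (simp add: continuous_on_eq_continuous_at)
    show "isCont h y"
    proof (cases "cis y = 1")
      case False
      have "isCont (\<lambda>y. complex_of_real (g y - g 0) / (cis y - 1)) y"
        using False cg by (intro continuous_intros cis) auto
      moreover have "eventually (\<lambda>z. cis z \<noteq> 1) (nhds y)"
      proof -
        have "open (cis -` (- {1}))" by (rule open_vimage[OF open_Compl[OF closed_singleton] ccis])
        moreover have "y \<in> cis -` (- {1})" using False by simp
        ultimately have "eventually (\<lambda>z. z \<in> cis -` (- {1})) (nhds y)" by (rule eventually_nhds_in_open)
        then show ?thesis by simp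
      qed
      then have "eventually (\<lambda>z. h z = complex_of_real (g z - g 0) / (cis z - 1)) (nhds y)"
        by (rule eventually_mono) (simp add: h_def)
      ultimately show ?thesis by (simp add: isCont_cong)
    next
      case True
      have 1: "((\<lambda>z. complex_of_real ((g z - g y) / (z - y))) \<longlongrightarrow> complex_of_real (g' y)) (at y)"
        using g[of y] by (intro tendsto_of_real) (simp add: has_field_derivative_iff)
      have "((\<lambda>z. Complex ((cos z - cos y) / (z - y)) ((sin z - sin y) / (z - y))) \<longlongrightarrow> Complex (- sin y) (cos y)) (at y)"
        using DERIV_cos[of y] DERIV_sin[of y] by (intro tendsto_Complex) (simp_all add: has_field_derivative_iff)
      moreover have "Complex (- sin y) (cos y) = \<i>"
        using True by (simp add: complex_eq_iff)
      moreover have "Complex ((cos z - cos y) / (z - y)) ((sin z - sin y) / (z - y)) = (cis z - 1) / of_real (z - y)" for z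
        using True by (simp add: complex_eq_iff)
      ultimately have 2: "((\<lambda>z. (cis z - 1) / of_real (z - y)) \<longlongrightarrow> \<i>) (at y)" by simp
      have "eventually (\<lambda>z. (cis z - 1) / of_real (z - y) \<noteq> 0) (at y)"
        by (rule tendsto_imp_eventually_ne[OF 2]) simp
      then have ev: "eventually (\<lambda>z. complex_of_real ((g z - g y) / (z - y)) / ((cis z - 1) / of_real (z - y)) = h z) (at y)"
        by (rule eventually_mono) (auto simp: h_def per_eq[OF True])
      have "((\<lambda>z. complex_of_real ((g z - g y) / (z - y)) / ((cis z - 1) / of_real (z - y))) \<longlongrightarrow> complex_of_real (g' y) / \<i>) (at y)"
        by (intro tendsto_divide 1 2) simp
      then have "(h \<longlongrightarrow> complex_of_real (g' y) / \<i>) (at y)"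
        using ev by (rule Lim_transform_eventually)
      then show ?thesis using True per_eq[OF True] by (simp add: isCont_def h_def)
    qed
  qed
qed

lemma summable_on_int_inverse_square: "(\<lambda>\<xi>::int. C / (1 + of_int \<xi> ^ 2) :: real) summable_on UNIV"
proof -
  have "summable (\<lambda>n. 1 / real n ^ 2)" using inverse_power_summable[of 2, where 'a=real] by (simp add: divide_inverse)
  then have "summable (\<lambda>n. 1 / (1 + real n ^ 2))"
    by (rule summable_comparison_test'[where N=1]) (auto intro!: divide_left_mono mult_pos_pos add_pos_pos)
  then have n: "(\<lambda>n::nat. 1 / (1 + real n ^ 2)) summable_on UNIV"
    by (subst summable_on_UNIV_nonneg_real_iff) auto
  have 1: "(\<lambda>\<xi>::int. 1 / (1 + of_int \<xi> ^ 2) :: real) summable_on range int"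
    using n by (subst summable_on_reindex) (auto simp: o_def)
  have 2: "(\<lambda>\<xi>::int. 1 / (1 + of_int \<xi> ^ 2) :: real) summable_on range (\<lambda>n. - int n)"
    using n by (subst summable_on_reindex) (auto simp: o_def inj_on_def)
  have "range int \<union> range (\<lambda>n. - int n) = UNIV" by (auto, metis int_cases2 rangeI)
  with summable_on_union[OF 1 2] have "(\<lambda>\<xi>::int. 1 / (1 + of_int \<xi> ^ 2) :: real) summable_on UNIV" by simp
  from summable_on_cmult_right[OF this, of C] show ?thesis by simp
qed

lemma has_sum_symmetric_limit:
  assumes "(f has_sum S) (UNIV :: int set)"
  shows "(\<lambda>M. sum f {- int M..int M}) \<longlonglongrightarrow> S"
proof -
  have "filterlim (\<lambda>M. {- int M..int M}) (finite_subsets_at_top UNIV) sequentially"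
    unfolding filterlim_finite_subsets_at_top
  proof safe
    fix X :: "int set" assume X: "finite X"
    then obtain K where K: "\<And>x. x \<in> X \<Longrightarrow> \<bar>x\<bar> \<le> K" using finite_abs_int_segment by (metis bdd_above.E finite_imageI bdd_above_finite imageI)
    show "\<forall>\<^sub>F M in sequentially. finite {- int M..int M} \<and> X \<subseteq> {- int M..int M} \<and> {- int M..int M} \<subseteq> UNIV"
      by (rule eventually_sequentiallyI[of "nat K"]) (use K in fastforce)
  qed
  from filterlim_compose[OF assms[unfolded has_sum_def] this] show ?thesis by simp
qed

text \<open>Two derivatives give quadratic decay of the coefficients, hence absolute summability.
  The sum is identified through its symmetric partial sums, which telescope up to two terms that
  vanish by Riemann-Lebesgue.\<close>

theorem fourier_inversion:
  assumes f: "\<And>x. (f has_real_derivative f' x) (at x)" "\<And>x. (f' has_real_derivative f'' x) (at x)"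
    and c: "continuous_on UNIV f''" and p: "periodic_2pi f" "periodic_2pi f'" "periodic_2pi f''"
  shows "(\<lambda>\<xi>. norm (fourier_coeff f \<xi>)) summable_on UNIV"
    and "((\<lambda>\<xi>. fourier_coeff f \<xi> * cis (x * of_int \<xi>)) has_sum (2 * pi * complex_of_real (f x))) UNIV"
proof -
  have cf: "continuous_on UNIV f" and cf': "continuous_on UNIV f'"
    using f DERIV_isCont continuous_at_imp_continuous_on by blast+
  obtain B0 B2 where B0: "B0 > 0" "\<And>x. \<bar>f x\<bar> \<le> B0" and B2: "B2 > 0" "\<And>x. \<bar>f'' x\<bar> \<le> B2"
    using periodic_bounded[OF cf p(1)] periodic_bounded[OF c p(3)] by metis
  define C where "C = (B0 + B2) * (2 * pi)"
  have le: "norm (fourier_coeff f \<xi>) \<le> C / (1 + of_int \<xi> ^ 2)" for \<xi>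
  proof -
    have "fourier_coeff f'' \<xi> = \<i> * of_int \<xi> * (\<i> * of_int \<xi> * fourier_coeff f \<xi>)"
      using fourier_coeff_deriv[OF f(2) c p(2)] fourier_coeff_deriv[OF f(1) cf' p(1)] by simp
    then have "norm (fourier_coeff f'' \<xi>) = \<bar>of_int \<xi>\<bar> * (\<bar>of_int \<xi>\<bar> * norm (fourier_coeff f \<xi>))"
      by (simp add: norm_mult)
    then have "norm (fourier_coeff f'' \<xi>) = of_int \<xi> ^ 2 * norm (fourier_coeff f \<xi>)"
      by (metis mult.assoc abs_mult_self_eq power2_eq_square)
    then have "(1 + of_int \<xi> ^ 2) * norm (fourier_coeff f \<xi>) = norm (fourier_coeff f \<xi>) + norm (fourier_coeff f'' \<xi>)"
      by (simp add: distrib_right)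
    also have "\<dots> \<le> C"
      using fourier_coeff_bound[OF cf B0(2), of \<xi>] fourier_coeff_bound[OF c B2(2), of \<xi>]
      by (simp add: C_def distrib_right)
    finally show ?thesis by (simp add: pos_le_divide_eq add_pos_nonneg mult.commute)
  qed
  show summ: "(\<lambda>\<xi>. norm (fourier_coeff f \<xi>)) summable_on UNIV"
    by (rule summable_on_comparison_test[OF summable_on_int_inverse_square[of C]]) (use le in auto)
  have "(\<lambda>\<xi>. fourier_coeff f \<xi> * cis (x * of_int \<xi>)) summable_on UNIV"
    by (rule abs_summable_summable) (use summ in \<open>simp add: norm_mult\<close>)
  then obtain S where S: "((\<lambda>\<xi>. fourier_coeff f \<xi> * cis (x * of_int \<xi>)) has_sum S) UNIV"
    by (auto simp: summable_on_def)
  define g where "g y = f (x + y)" for y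
  have g: "(g has_real_derivative f' (x + y)) (at y)" for y
    unfolding g_def[abs_def] using f(1)[of "x + y"] by (simp add: add.commute[of x] DERIV_shift[symmetric])
  have cg': "continuous_on UNIV (\<lambda>y. f' (x + y))" by (intro continuous_on_compose2[OF cf'] continuous_intros) simp
  have gp: "periodic_2pi g" using p(1) unfolding periodic_2pi_def g_def by (simp add: add.assoc[symmetric])
  have cg: "continuous_on UNIV g" using g DERIV_isCont continuous_at_imp_continuous_on by blast
  define h where "h y = (if cis y = 1 then complex_of_real (f' (x + 0)) / \<i> else complex_of_real (g y - g 0) / (cis y - 1))" for y
  have h: "continuous_on UNIV h" "periodic_2pi h" "\<And>y. (cis y - 1) * h y = complex_of_real (g y - g 0)"
    using difference_quotient_continuous[OF g cg' gp] by (simp_all add: h_def[abs_def])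
  define H where "H \<xi> = integral {0..2*pi} (\<lambda>y. cis (- y * of_int \<xi>) * h y)" for \<xi> :: int
  \<comment> \<open>Multiplying \<open>h\<close> by \<open>cis y - 1\<close> subtracts from the
    coefficients their shift by one index; the constant \<open>g 0\<close> contributes at \<xi> = 0
    only.\<close>
  have coeff: "fourier_coeff f \<xi> * cis (x * of_int \<xi>) = (if \<xi> = 0 then 2 * pi * g 0 else 0) + (H (\<xi> - 1) - H \<xi>)" for \<xi>
  proof -
    have "fourier_coeff f \<xi> = integral {0..2*pi} (\<lambda>y. cis (- (x + y) * of_int \<xi>) * complex_of_real (f (x + y)))"
      unfolding fourier_coeff_def
      by (rule integral_periodic_complex[symmetric])
        (use periodic_cis(2)[of \<xi>] p(1) in \<open>auto simp: periodic_2pi_def intro!: continuous_intros cf\<close>)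
    also have "\<dots> = integral {0..2*pi} (\<lambda>y. cis (- x * of_int \<xi>) * (cis (- y * of_int \<xi>) * complex_of_real (g y)))"
    proof (rule integral_cong)
      fix y
      have "cis (- (x + y) * of_int \<xi>) = cis (- x * of_int \<xi>) * cis (- y * of_int \<xi>)"
        unfolding cis_mult by (simp add: algebra_simps)
      then show "cis (- (x + y) * of_int \<xi>) * complex_of_real (f (x + y))
          = cis (- x * of_int \<xi>) * (cis (- y * of_int \<xi>) * complex_of_real (g y))" by (simp add: g_def)
    qed
    also have "\<dots> = cis (- x * of_int \<xi>) * integral {0..2*pi} (\<lambda>y. cis (- y * of_int \<xi>) * complex_of_real (g y))"
      by simp
    finally have fc: "fourier_coeff f \<xi> = cis (- x * of_int \<xi>) * integral {0..2*pi} (\<lambda>y. cis (- y * of_int \<xi>) * complex_of_real (g y))" .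
    have "cis (- x * of_int \<xi>) * cis (x * of_int \<xi>) = 1" by (simp add: cis_mult)
    then have "fourier_coeff f \<xi> * cis (x * of_int \<xi>) = integral {0..2*pi} (\<lambda>y. cis (- y * of_int \<xi>) * complex_of_real (g y))"
    proof -
      have "a * I * c = I" if "a * c = 1" for a I c :: complex
        using that by (metis mult.assoc mult.commute mult_1_right)
      from this[OF \<open>cis (- x * of_int \<xi>) * cis (x * of_int \<xi>) = 1\<close>] show ?thesis unfolding fc .
    qed
    also have "\<dots> = integral {0..2*pi} (\<lambda>y. complex_of_real (g 0) * cis (y * of_int (- \<xi>))
        + (cis (- y * of_int (\<xi> - 1)) * h y - cis (- y * of_int \<xi>) * h y))"
    proof (rule integral_cong)
      fix y
      have "cis (- y * of_int (\<xi> - 1)) = cis (- y * of_int \<xi>) * cis y"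
        by (simp add: cis_mult algebra_simps)
      then have "cis (- y * of_int (\<xi> - 1)) * h y - cis (- y * of_int \<xi>) * h y = cis (- y * of_int \<xi>) * ((cis y - 1) * h y)"
        by (simp add: algebra_simps)
      also have "\<dots> = cis (- y * of_int \<xi>) * complex_of_real (g y - g 0)" by (simp add: h(3))
      finally show "cis (- y * of_int \<xi>) * complex_of_real (g y) = complex_of_real (g 0) * cis (y * of_int (- \<xi>))
        + (cis (- y * of_int (\<xi> - 1)) * h y - cis (- y * of_int \<xi>) * h y)"
        by (simp add: algebra_simps)
    qed
    also have "\<dots> = complex_of_real (g 0) * integral {0..2*pi} (\<lambda>y. cis (y * of_int (- \<xi>))) + (H (\<xi> - 1) - H \<xi>)"
      unfolding H_def
      by (subst integral_add, (intro integrable_continuous_real continuous_intros continuous_on_subset[OF h(1)]; simp)+,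
          subst integral_diff, (intro integrable_continuous_real continuous_intros continuous_on_subset[OF h(1)]; simp)+)
        simp
    also have "\<dots> = (if \<xi> = 0 then 2 * pi * g 0 else 0) + (H (\<xi> - 1) - H \<xi>)"
      using integral_cis[of "- \<xi>"] by simp
    finally show ?thesis .
  qed
  have partial: "(\<Sum>\<xi>\<in>{- int M..int M}. fourier_coeff f \<xi> * cis (x * of_int \<xi>)) = 2 * pi * g 0 + (H (- int M - 1) - H (int M))" for M
  proof (induct M)
    case 0
    then show ?case using coeff[of 0] by simp
  next
    case (Suc M)
    have "{- int (Suc M)..int (Suc M)} = insert (int (Suc M)) (insert (- int (Suc M)) {- int M..int M})" by auto
    moreover have "int (Suc M) \<noteq> - int (Suc M)" by simp
    ultimately have "(\<Sum>\<xi>\<in>{- int (Suc M)..int (Suc M)}. fourier_coeff f \<xi> * cis (x * of_int \<xi>))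
       = fourier_coeff f (int (Suc M)) * cis (x * of_int (int (Suc M))) + (fourier_coeff f (- int (Suc M)) * cis (x * of_int (- int (Suc M)))
        + (\<Sum>\<xi>\<in>{- int M..int M}. fourier_coeff f \<xi> * cis (x * of_int \<xi>)))"
      by (simp del: of_nat_Suc)
    also have "\<dots> = 2 * pi * g 0 + (H (- int (Suc M) - 1) - H (int (Suc M)))"
    proof -
      have "H (int (Suc M) - 1) = H (int M)" "H (- int (Suc M)) = H (- int M - 1)"
        by (rule arg_cong[of _ _ H], simp)+
      then show ?thesis
        unfolding Suc coeff[of "int (Suc M)"] coeff[of "- int (Suc M)"] by (simp del: of_nat_Suc)
    qed
    finally show ?case .
  qed
  have "(\<lambda>M. H (- int M - 1)) \<longlonglongrightarrow> 0" "(\<lambda>M. H (int M)) \<longlonglongrightarrow> 0"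
  proof -
    have *: "(\<lambda>M. H (s M)) \<longlonglongrightarrow> 0" if s: "\<And>M. \<bar>s M\<bar> \<ge> int M" for s :: "nat \<Rightarrow> int"
    proof (rule LIMSEQ_I)
      fix \<epsilon> :: real assume "0 < \<epsilon>"
      from riemann_lebesgue_bound[OF h(1,2) this, folded H_def]
      obtain N where N: "\<And>\<xi>. \<bar>\<xi>\<bar> \<ge> int N \<Longrightarrow> norm (H \<xi>) < \<epsilon>" by auto
      have "norm (H (s M) - 0) < \<epsilon>" if "M \<ge> N" for M
        using N[of "s M"] s[of M] that by simp
      then show "\<exists>N. \<forall>M\<ge>N. norm (H (s M) - 0) < \<epsilon>" by blast
    qed
    show "(\<lambda>M. H (- int M - 1)) \<longlonglongrightarrow> 0" "(\<lambda>M. H (int M)) \<longlonglongrightarrow> 0"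
      by (rule *, simp)+
  qed
  then have "(\<lambda>M. 2 * pi * g 0 + (H (- int M - 1) - H (int M))) \<longlonglongrightarrow> complex_of_real (2 * pi * g 0) + (0 - 0)"
    by (intro tendsto_intros)
  then have "(\<lambda>M. \<Sum>\<xi>\<in>{- int M..int M}. fourier_coeff f \<xi> * cis (x * of_int \<xi>)) \<longlonglongrightarrow> complex_of_real (2 * pi * g 0)"
    unfolding partial by simp
  with has_sum_symmetric_limit[OF S] have "S = complex_of_real (2 * pi * g 0)" by (rule LIMSEQ_unique)
  with S show "((\<lambda>\<xi>. fourier_coeff f \<xi> * cis (x * of_int \<xi>)) has_sum (2 * pi * complex_of_real (f x))) UNIV"
    by (simp add: g_def)
qed

text \<open>With p and q the convolutions with \<open>Kc\<close> and \<open>Ks\<close>, the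
  relations p' = - q and q' = f - p determine the coefficients of q as the symbol times those of
  \<open>f\<close>. As \<open>f\<close> is C^1, q is C^2 and inversion applies to it.\<close>

theorem CH_nonlocal_conv:
  assumes f: "\<And>x. (f has_real_derivative f' x) (at x)" and c: "continuous_on UNIV f'" and p: "periodic_2pi f" "periodic_2pi f'"
  shows "CH_nonlocal f x = complex_of_real (conv Ks (\<lambda>x. x) f x)"
proof -
  let ?q = "conv Ks (\<lambda>x. x) f" and ?p = "conv Kc (\<lambda>x. x) f"
  have cf: "continuous_on UNIV f" using f DERIV_isCont continuous_at_imp_continuous_on by blast
  have id: "((\<lambda>x::real. x) has_real_derivative 1) (at x)" for x by simp
  have p': "(?p has_real_derivative - ?q x) (at x)" for x
    using conv_Kc_deriv[OF id refl cf p(1), of x] by (simp add: Kc_2pi)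
  have q': "(?q has_real_derivative f x - ?p x) (at x)" for x
    using conv_Ks_deriv[OF id refl cf p(1), of x] by (simp add: Ks_2pi Ks_0)
  have q'': "((\<lambda>x. f x - ?p x) has_real_derivative f' x + ?q x) (at x)" for x
    using DERIV_diff[OF f p'] by simp
  have cq: "continuous_on UNIV ?q" "continuous_on UNIV ?p"
    using q' p' DERIV_isCont continuous_at_imp_continuous_on by blast+
  have per: "periodic_2pi ?q" "periodic_2pi ?p" by (rule conv_periodic[OF id refl cf p(1)])+
  have inv: "((\<lambda>\<xi>. fourier_coeff ?q \<xi> * cis (x * of_int \<xi>)) has_sum (2 * pi * complex_of_real (?q x))) UNIV"
    by (rule fourier_inversion(2)[OF q' q''])
      (use per p in \<open>auto simp: periodic_2pi_def intro!: continuous_intros c cq\<close>)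
  have coeff: "fourier_coeff ?q \<xi> = (- \<i> * of_int \<xi> / (1 + of_int \<xi> ^ 2)) * fourier_coeff f \<xi>" for \<xi>
  proof -
    have "fourier_coeff (\<lambda>x. - ?q x) \<xi> = \<i> * of_int \<xi> * fourier_coeff ?p \<xi>"
      by (rule fourier_coeff_deriv[OF p' _ per(2)]) (intro continuous_intros cq)
    moreover have "fourier_coeff (\<lambda>x. - ?q x) \<xi> = - fourier_coeff ?q \<xi>" by (simp add: fourier_coeff_def)
    ultimately have 1: "fourier_coeff ?q \<xi> = - \<i> * of_int \<xi> * fourier_coeff ?p \<xi>"
      by (metis minus_minus mult_minus_left)
    have "fourier_coeff (\<lambda>x. f x - ?p x) \<xi> = \<i> * of_int \<xi> * fourier_coeff ?q \<xi>"
      by (rule fourier_coeff_deriv[OF q' _ per(1)]) (intro continuous_intros cq cf)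
    moreover have "fourier_coeff (\<lambda>x. f x - ?p x) \<xi> = fourier_coeff f \<xi> - fourier_coeff ?p \<xi>"
      unfolding fourier_coeff_def
      by (subst integral_diff[symmetric])
        (auto simp: right_diff_distrib intro!: integrable_continuous_real continuous_intros
          continuous_on_subset[OF cf] continuous_on_subset[OF cq(2)])
    ultimately have "fourier_coeff f \<xi> - fourier_coeff ?p \<xi> = of_int \<xi> ^ 2 * fourier_coeff ?p \<xi>"
      using 1 by (simp add: power2_eq_square algebra_simps)
    then have "fourier_coeff f \<xi> = (1 + of_int \<xi> ^ 2) * fourier_coeff ?p \<xi>" by (simp add: algebra_simps)
    moreover have "(1 + of_int \<xi> ^ 2 :: complex) \<noteq> 0"
    proof -
      have "Re (1 + of_int \<xi> ^ 2) = 1 + of_int \<xi> ^ 2" by (simp add: power2_eq_square)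
      also have "\<dots> > 0" by (simp add: add_pos_nonneg)
      finally show ?thesis by (metis less_irrefl zero_complex.sel(1))
    qed
    ultimately show ?thesis using 1 by simp
  qed
  show ?thesis
    unfolding CH_nonlocal_def fourier_mult_def coeff[symmetric]
    using infsumI[OF inv] by simp
qed

lemma smooth_fun_diff:
  assumes "smooth_fun f" "smooth_fun g" shows "smooth_fun (\<lambda>x. f x - g x)"
proof -
  have "reg k {0} (\<lambda>_ x. f x + (- 1) * g x)" for k
    by (intro reg_add reg_cmult reg_smooth assms)
  from reg_all_smooth(1)[OF this, of 0] show ?thesis by simp
qed

lemma CH_nonlocal_smooth:
  assumes "H_inf v"
  shows "CH_nonlocal (\<lambda>y. (v y)\<^sup>2 + (deriv v y)\<^sup>2 / 2) x
    = complex_of_real (conv Ks (\<lambda>x. x) (\<lambda>y. (v y)\<^sup>2 + (deriv v y)\<^sup>2 / 2) x)"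
proof -
  have s: "smooth_fun v" "smooth_fun (deriv v)" "smooth_fun (deriv (deriv v))"
    and p: "periodic_2pi v" "periodic_2pi (deriv v)" "periodic_2pi (deriv (deriv v))"
    using assms by (auto simp: H_inf_def intro: smooth_fun_deriv periodic_deriv)
  show ?thesis
  proof (rule CH_nonlocal_conv)
    show "((\<lambda>y. (v y)\<^sup>2 + (deriv v y)\<^sup>2 / 2) has_real_derivative
        2 * v x * deriv v x + deriv v x * deriv (deriv v) x) (at x)" for x
      by (auto intro!: derivative_eq_intros smooth_fun_has_deriv s)
    show "continuous_on UNIV (\<lambda>x. 2 * v x * deriv v x + deriv v x * deriv (deriv v) x)"
      by (intro continuous_intros smooth_fun_continuous s)
  qed (use p in \<open>auto simp: periodic_2pi_def\<close>)
qed

lemma (in ch_flow) CH_solution_u: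
  assumes m0: "smooth_fun m0"
  shows "CH_solution T u0 u"
  unfolding CH_solution_def
proof (intro conjI ballI allI)
  note R = reg_all_smooth[OF reg_u[OF m0]]
  show "u 0 = u0" by (rule u_0)
  show H: "H_inf (u t)" if "t \<in> {0..<T}" for t
    using that R(1)[of t] u_periodic[of t] by (auto simp: H_inf_def)
  show "continuous_on ({0..<T} \<times> UNIV) (\<lambda>(t, x). (deriv ^^ k) (u t) x)" for k
  proof -
    have "jcont {0..T} (\<lambda>t. (deriv ^^ k) (u t))" by (rule R(2))
    then have "jcont {0..<T} (\<lambda>t. (deriv ^^ k) (u t))" by (rule jcont_subset) auto
    then show ?thesis by (simp add: jcont_def)
  qed
  fix t y assume t': "t \<in> {0..<T}"
  then have t: "t \<in> {0..T}" by auto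
  have d: "deriv (u t) y = W t (X t y)" using u_x[OF t] by (rule DERIV_imp_deriv)
  show "\<exists>ut. ((\<lambda>s. u s y) has_real_derivative ut) (at t within {0..<T}) \<and>
      complex_of_real (ut + u t y * deriv (u t) y) = CH_nonlocal (\<lambda>y. (u t y)\<^sup>2 + (deriv (u t) y)\<^sup>2 / 2) y"
  proof (intro exI conjI)
    show "((\<lambda>s. u s y) has_real_derivative B t (X t y) - W t (X t y) * u t y) (at t within {0..<T})"
      by (rule DERIV_subset[OF u_t[OF t]]) auto
    show "complex_of_real (B t (X t y) - W t (X t y) * u t y + u t y * deriv (u t) y)
        = CH_nonlocal (\<lambda>y. (u t y)\<^sup>2 + (deriv (u t) y)\<^sup>2 / 2) y"
      unfolding CH_nonlocal_smooth[OF H[OF t']] B_eulerian[OF t, symmetric] by (simp add: d)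
  qed
qed

section \<open>Uniqueness\<close>

lemma DERIV_continuous:
  fixes f :: "real \<Rightarrow> real"
  shows "(\<And>x. (f has_real_derivative f' x) (at x)) \<Longrightarrow> continuous_on X f"
  by (meson DERIV_continuous_on has_field_derivative_at_within)

text \<open>Restriction to a closed subinterval of \<open>[0, T)\<close>, where periodic jointly
  continuous functions are bounded.\<close>

lemma CH_solution_facts:
  assumes "CH_solution T u0 u" and T1: "T1 < T"
  shows "jcont {0..T1} u" "jcont {0..T1} (\<lambda>t. deriv (u t))" "jcont {0..T1} (\<lambda>t. deriv (deriv (u t)))"
    and "\<And>t. t \<in> {0..T1} \<Longrightarrow> H_inf (u t)"
    and "\<And>t x. t \<in> {0..T1} \<Longrightarrow> ((\<lambda>s. u s x) has_real_derivative
        conv Ks (\<lambda>x. x) (\<lambda>y. (u t y)\<^sup>2 + (deriv (u t) y)\<^sup>2 / 2) x - u t x * deriv (u t) x) (at t within {0..T1})"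
proof -
  note sol = assms(1)[unfolded CH_solution_def]
  have sub: "{0..T1} \<subseteq> {0..<T}" using T1 by auto
  have j: "jcont {0..T1} (\<lambda>t. (deriv ^^ k) (u t))" for k
    by (rule jcont_subset[OF _ sub]) (use sol in \<open>auto simp: jcont_def\<close>)
  show "jcont {0..T1} u" "jcont {0..T1} (\<lambda>t. deriv (u t))" "jcont {0..T1} (\<lambda>t. deriv (deriv (u t)))"
    using j[of 0] j[of 1] j[of 2] by (simp_all add: numeral_2_eq_2)
  show H: "H_inf (u t)" if "t \<in> {0..T1}" for t using sol sub that by blast
  show "((\<lambda>s. u s x) has_real_derivative
        conv Ks (\<lambda>x. x) (\<lambda>y. (u t y)\<^sup>2 + (deriv (u t) y)\<^sup>2 / 2) x - u t x * deriv (u t) x) (at t within {0..T1})"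
    if t: "t \<in> {0..T1}" for t x
  proof -
    obtain ut where ut: "((\<lambda>s. u s x) has_real_derivative ut) (at t within {0..<T})"
      "complex_of_real (ut + u t x * deriv (u t) x) = CH_nonlocal (\<lambda>y. (u t y)\<^sup>2 + (deriv (u t) y)\<^sup>2 / 2) x"
      using sol sub t by blast
    from ut(2) have "ut + u t x * deriv (u t) x = conv Ks (\<lambda>x. x) (\<lambda>y. (u t y)\<^sup>2 + (deriv (u t) y)\<^sup>2 / 2) x"
      unfolding CH_nonlocal_smooth[OF H[OF t]] of_real_eq_iff .
    then have "ut = conv Ks (\<lambda>x. x) (\<lambda>y. (u t y)\<^sup>2 + (deriv (u t) y)\<^sup>2 / 2) x - u t x * deriv (u t) x" by simp
    with DERIV_subset[OF ut(1) sub] show ?thesis by simp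
  qed
qed

lemma jcont_lin:
  assumes "jcont S f" "jcont S g"
  shows "jcont S (\<lambda>t x. f t x + g t x)" "jcont S (\<lambda>t x. f t x - g t x)" "jcont S (\<lambda>t x. f t x * g t x)"
    "jcont S (\<lambda>t x. f t x / 2)"
  using assms unfolding jcont_def case_prod_unfold by (intro continuous_intros; simp)+

lemma DERIV_shift_arg: "(f has_real_derivative d) (at (x + r)) \<Longrightarrow> ((\<lambda>r. f (x + r)) has_real_derivative d) (at r)"
  by (simp add: add.commute[of x] DERIV_shift[symmetric])

text \<open>The term \<open>z_x s_x\<close> costs a derivative of the difference \<open>z\<close>; integrating it by parts against
  the kernel leaves only \<open>z\<close> itself.\<close>

lemma conv_Ks_by_parts:
  assumes z: "\<And>x. (z has_real_derivative z' x) (at x)" "continuous_on UNIV z'" "periodic_2pi z"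
    and b: "\<And>x. (b has_real_derivative b' x) (at x)" "continuous_on UNIV b'" "periodic_2pi b"
  shows "conv Ks (\<lambda>x. x) (\<lambda>x. z' x * b x) x
    = z x * b x - integral {0..2*pi} (\<lambda>r. (Kc r * b (x + r) + Ks r * b' (x + r)) * z (x + r))"
proof -
  have cz: "continuous_on UNIV z" "continuous_on UNIV b"
    by (rule DERIV_continuous[OF z(1)] DERIV_continuous[OF b(1)])+
  have c: "continuous_on X (\<lambda>r. z (x + r))" "continuous_on X (\<lambda>r. z' (x + r))"
      "continuous_on X (\<lambda>r. b (x + r))" "continuous_on X (\<lambda>r. b' (x + r))" for X
    by (intro continuous_on_compose2[OF cz(1)] continuous_on_compose2[OF z(2)] continuous_on_compose2[OF cz(2)]
        continuous_on_compose2[OF b(2)] continuous_intros; simp)+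
  have "((\<lambda>r. Ks r * (z' (x + r) * b (x + r)) + (Kc r * b (x + r) + Ks r * b' (x + r)) * z (x + r))
      has_integral Ks (2 * pi) * (z (x + 2 * pi) * b (x + 2 * pi)) - Ks 0 * (z (x + 0) * b (x + 0))) {0..2*pi}"
    by (rule ftc_real, simp)
      (rule DERIV_cong[OF DERIV_mult[OF Ks_deriv DERIV_mult[OF DERIV_shift_arg[OF z(1)] DERIV_shift_arg[OF b(1)]]]],
        simp add: algebra_simps)
  then have "integral {0..2*pi} (\<lambda>r. Ks r * (z' (x + r) * b (x + r)) + (Kc r * b (x + r) + Ks r * b' (x + r)) * z (x + r))
      = z x * b x"
    using z(3) b(3) by (simp add: integral_unique Ks_2pi Ks_0 periodic_2pi_def)
  moreover have "integral {0..2*pi} (\<lambda>r. Ks r * (z' (x + r) * b (x + r)) + (Kc r * b (x + r) + Ks r * b' (x + r)) * z (x + r))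
    = conv Ks (\<lambda>x. x) (\<lambda>x. z' x * b x) x + integral {0..2*pi} (\<lambda>r. (Kc r * b (x + r) + Ks r * b' (x + r)) * z (x + r))"
    unfolding conv_def
    by (subst integral_add) (auto intro!: integrable_continuous_real continuous_intros c)
  ultimately show ?thesis by simp
qed

lemma conv_id_add:
  assumes "continuous_on UNIV f" "continuous_on UNIV g"
  shows "conv Ks (\<lambda>x. x) (\<lambda>x. f x + c * g x) x = conv Ks (\<lambda>x. x) f x + c * conv Ks (\<lambda>x. x) g x"
proof -
  have c: "continuous_on X (\<lambda>r. f (x + r))" "continuous_on X (\<lambda>r. g (x + r))" for X
    by (intro continuous_on_compose2[OF assms(1)] continuous_on_compose2[OF assms(2)] continuous_intros; simp)+
  have "conv Ks (\<lambda>x. x) (\<lambda>x. f x + c * g x) x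
      = integral {0..2*pi} (\<lambda>r. Ks (x + r - x) * f (x + r) + c * (Ks (x + r - x) * g (x + r)))"
    unfolding conv_def by (simp add: algebra_simps)
  also have "\<dots> = conv Ks (\<lambda>x. x) f x + c * conv Ks (\<lambda>x. x) g x"
    unfolding conv_def
    by (subst integral_add) (auto intro!: integrable_continuous_real continuous_intros c)
  finally show ?thesis .
qed

text \<open>After integration by parts the nonlocal difference is half of \<open>z * s'\<close> plus
  an integral operator on \<open>z\<close> with kernel at most \<open>M * (1 + C)\<close>. The
  product with \<open>2 * z x\<close> is then split by 2ab \<le> a^2 + b^2.\<close>

lemma CH_nonlocal_difference_bound:
  assumes z: "\<And>x. (z has_real_derivative z' x) (at x)" "continuous_on UNIV z'" "periodic_2pi z"
    and s: "\<And>x. (s has_real_derivative s' x) (at x)" "\<And>x. (s' has_real_derivative s'' x) (at x)"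
      "continuous_on UNIV s''" "periodic_2pi s'"
    and M: "\<And>x. \<bar>s x\<bar> \<le> M" "\<And>x. \<bar>s' x\<bar> \<le> M" "\<And>x. \<bar>s'' x\<bar> \<le> M"
    and C: "\<And>r. r \<in> {0..2*pi} \<Longrightarrow> Kc r \<le> C"
  shows "2 * z x * conv Ks (\<lambda>x. x) (\<lambda>x. z x * s x + 1 / 2 * (z' x * s' x)) x
    \<le> M * (z x)\<^sup>2 + M * (1 + C) * (2 * pi * (z x)\<^sup>2 + integral {0..2*pi} (\<lambda>x. (z x)\<^sup>2))"
proof -
  have M0: "0 \<le> M" using M(1)[of 0] by linarith
  have C0: "0 \<le> C" using C[of 0] Kc_pos[of 0] by simp
  have cz: "continuous_on UNIV z" and cs: "continuous_on UNIV s" "continuous_on UNIV s'"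
    by (rule DERIV_continuous[OF z(1)] DERIV_continuous[OF s(1)] DERIV_continuous[OF s(2)])+
  have c: "continuous_on X (\<lambda>r. z (x + r))" "continuous_on X (\<lambda>r. s (x + r))"
      "continuous_on X (\<lambda>r. s' (x + r))" "continuous_on X (\<lambda>r. s'' (x + r))" for X
    by (intro continuous_on_compose2[OF cz] continuous_on_compose2[OF cs(1)] continuous_on_compose2[OF cs(2)]
        continuous_on_compose2[OF s(3)] continuous_intros; simp)+
  define h where "h r = (Ks r * s (x + r) - 1 / 2 * (Kc r * s' (x + r) + Ks r * s'' (x + r))) * z (x + r)" for r
  have "conv Ks (\<lambda>x. x) (\<lambda>x. z x * s x + 1 / 2 * (z' x * s' x)) x
      = conv Ks (\<lambda>x. x) (\<lambda>x. z x * s x) x + 1 / 2 * conv Ks (\<lambda>x. x) (\<lambda>x. z' x * s' x) x"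
    by (rule conv_id_add) (intro continuous_intros cz cs z)+
  also have "conv Ks (\<lambda>x. x) (\<lambda>x. z' x * s' x) x
      = z x * s' x - integral {0..2*pi} (\<lambda>r. (Kc r * s' (x + r) + Ks r * s'' (x + r)) * z (x + r))"
    by (rule conv_Ks_by_parts[OF z s(2,3,4)])
  also have "conv Ks (\<lambda>x. x) (\<lambda>x. z x * s x) x + 1 / 2 * (z x * s' x - integral {0..2*pi} (\<lambda>r. (Kc r * s' (x + r) + Ks r * s'' (x + r)) * z (x + r)))
      = integral {0..2*pi} h + 1 / 2 * z x * s' x"
  proof -
    have "integral {0..2*pi} h = integral {0..2*pi} (\<lambda>r. Ks r * (z (x + r) * s (x + r))
        - 1 / 2 * ((Kc r * s' (x + r) + Ks r * s'' (x + r)) * z (x + r)))"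
      by (simp add: h_def[abs_def] algebra_simps)
    also have "\<dots> = conv Ks (\<lambda>x. x) (\<lambda>x. z x * s x) x
       - 1 / 2 * integral {0..2*pi} (\<lambda>r. (Kc r * s' (x + r) + Ks r * s'' (x + r)) * z (x + r))"
      unfolding conv_def
      by (subst integral_diff) (auto intro!: integrable_continuous_real continuous_intros c)
    finally show ?thesis by (simp add: algebra_simps)
  qed
  finally have eq: "2 * z x * conv Ks (\<lambda>x. x) (\<lambda>x. z x * s x + 1 / 2 * (z' x * s' x)) x
      = integral {0..2*pi} (\<lambda>r. 2 * z x * h r) + (z x)\<^sup>2 * s' x"
    by (simp add: algebra_simps power2_eq_square)
  have "(z x)\<^sup>2 * s' x \<le> (z x)\<^sup>2 * M" using M(2)[of x] by (intro mult_left_mono) auto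
  moreover have "integral {0..2*pi} (\<lambda>r. 2 * z x * h r)
      \<le> integral {0..2*pi} (\<lambda>r. M * (1 + C) * ((z x)\<^sup>2 + (z (x + r))\<^sup>2))"
  proof (rule integral_le)
    show "(\<lambda>r. 2 * z x * h r) integrable_on {0..2 * pi}" unfolding h_def
      by (intro integrable_continuous_real continuous_intros c)
    show "(\<lambda>r. M * (1 + C) * ((z x)\<^sup>2 + (z (x + r))\<^sup>2)) integrable_on {0..2 * pi}"
      by (intro integrable_continuous_real continuous_intros c)
    fix r assume r: "r \<in> {0..2*pi}"
    have "\<bar>Ks r * s (x + r) - 1 / 2 * (Kc r * s' (x + r) + Ks r * s'' (x + r))\<bar>
        \<le> \<bar>Ks r\<bar> * \<bar>s (x + r)\<bar> + 1 / 2 * (\<bar>Kc r\<bar> * \<bar>s' (x + r)\<bar> + \<bar>Ks r\<bar> * \<bar>s'' (x + r)\<bar>)"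
    proof -
      have "\<bar>a - 1 / 2 * (b + c)\<bar> \<le> \<bar>a\<bar> + 1 / 2 * (\<bar>b\<bar> + \<bar>c\<bar>)" for a b c :: real
      proof -
        have "\<bar>1 / 2 * (b + c)\<bar> = 1 / 2 * \<bar>b + c\<bar>" by (simp add: abs_mult)
        also have "\<dots> \<le> 1 / 2 * (\<bar>b\<bar> + \<bar>c\<bar>)" by (intro mult_left_mono abs_triangle_ineq) simp
        finally show ?thesis by (rule order_trans[OF abs_triangle_ineq4 add_left_mono])
      qed
      then show ?thesis unfolding abs_mult[symmetric] .
    qed
    also have "\<dots> \<le> 1 / 2 * M + 1 / 2 * (C * M + 1 / 2 * M)"
      using Ks_bound[of r] C[OF r] less_imp_le[OF Kc_pos[of r]] M(1)[of "x + r"] M(2)[of "x + r"] M(3)[of "x + r"] r M0 C0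
      by (intro add_mono mult_mono mult_left_mono) (simp_all add: abs_of_nonneg)
    also have "\<dots> \<le> M * (1 + C)" using M0 mult_nonneg_nonneg[OF C0 M0] by (simp add: algebra_simps)
    finally have k: "\<bar>Ks r * s (x + r) - 1 / 2 * (Kc r * s' (x + r) + Ks r * s'' (x + r))\<bar> \<le> M * (1 + C)" .
    have "2 * z x * h r \<le> \<bar>Ks r * s (x + r) - 1 / 2 * (Kc r * s' (x + r) + Ks r * s'' (x + r))\<bar> * \<bar>2 * z x * z (x + r)\<bar>"
    proof -
      have "2 * a * (k * b) \<le> \<bar>k\<bar> * \<bar>2 * a * b\<bar>" for a b k :: real
        unfolding abs_mult[symmetric] by (rule order_trans[OF abs_ge_self]) (simp add: mult_ac)
      then show ?thesis unfolding h_def .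
    qed
    also have "\<dots> \<le> (M * (1 + C)) * ((z x)\<^sup>2 + (z (x + r))\<^sup>2)"
    proof (rule mult_mono[OF k])
      have "0 \<le> (\<bar>z x\<bar> - \<bar>z (x + r)\<bar>)\<^sup>2" by simp
      then show "\<bar>2 * z x * z (x + r)\<bar> \<le> (z x)\<^sup>2 + (z (x + r))\<^sup>2"
        by (simp add: power2_diff abs_mult)
    qed (use M0 C0 in auto)
    finally show "2 * z x * h r \<le> M * (1 + C) * ((z x)\<^sup>2 + (z (x + r))\<^sup>2)" .
  qed
  moreover have "integral {0..2*pi} (\<lambda>r. M * (1 + C) * ((z x)\<^sup>2 + (z (x + r))\<^sup>2))
      = M * (1 + C) * (2 * pi * (z x)\<^sup>2 + integral {0..2*pi} (\<lambda>x. (z x)\<^sup>2))"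
  proof -
    have "integral {0..2*pi} (\<lambda>r. (z (x + r))\<^sup>2) = integral {0..2*pi} (\<lambda>x. (z x)\<^sup>2)"
      by (rule integral_periodic) (use z(3) in \<open>auto simp: periodic_2pi_def intro!: continuous_intros cz\<close>)
    then show ?thesis
      by (simp, subst integral_add) (auto intro!: integrable_continuous_real continuous_intros c)
  qed
  ultimately show ?thesis unfolding eq mult.commute[of "(z x)\<^sup>2" M] by linarith
qed

text \<open>An L^2 energy estimate for the difference z. With s the sum of the two solutions the
  transport difference is (z s)_x / 2, so its top-order contribution is an exact derivative and only
  z^2 s_x is left.\<close>

theorem CH_solution_unique:
  assumes u: "CH_solution T u0 u" and v: "CH_solution T u0 v" and t1: "t1 \<in> {0..<T}"
  shows "u t1 = v t1"
proof -
  have T1: "t1 < T" using t1 by simp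
  note U = CH_solution_facts[OF u T1] and V = CH_solution_facts[OF v T1]
  let ?S = "{0..t1}"
  define z where "z t x = u t x - v t x" for t x
  define z' where "z' t x = deriv (u t) x - deriv (v t) x" for t x
  define s where "s t x = u t x + v t x" for t x
  define s' where "s' t x = deriv (u t) x + deriv (v t) x" for t x
  define s'' where "s'' t x = deriv (deriv (u t)) x + deriv (deriv (v t)) x" for t x
  have jz: "jcont ?S z" "jcont ?S z'" unfolding z_def z'_def by (rule jcont_lin(2) U V)+
  have js: "jcont ?S s" "jcont ?S s'" "jcont ?S s''" unfolding s_def s'_def s''_def by (rule jcont_lin(1) U V)+
  have sm: "smooth_fun (u t)" "smooth_fun (deriv (u t))" "smooth_fun (v t)" "smooth_fun (deriv (v t))"
    and pr: "periodic_2pi (u t)" "periodic_2pi (deriv (u t))" "periodic_2pi (deriv (deriv (u t)))"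
      "periodic_2pi (v t)" "periodic_2pi (deriv (v t))" "periodic_2pi (deriv (deriv (v t)))"
    if "t \<in> ?S" for t
    using U(4)[OF that] V(4)[OF that] by (auto simp: H_inf_def intro!: smooth_fun_deriv periodic_deriv)
  have zx: "(z t has_real_derivative z' t x) (at x)" and sx: "(s t has_real_derivative s' t x) (at x)"
    "(s' t has_real_derivative s'' t x) (at x)" if "t \<in> ?S" for t x
    using DERIV_diff[OF sm(1,3)[OF that, THEN smooth_fun_has_deriv], of x]
      DERIV_add[OF sm(1,3)[OF that, THEN smooth_fun_has_deriv], of x]
      DERIV_add[OF sm(2,4)[OF that, THEN smooth_fun_has_deriv], of x]
    by (simp_all only: z_def[abs_def] z'_def s_def[abs_def] s'_def[abs_def] s''_def)
  have pz: "periodic_2pi (z t)" and ps: "periodic_2pi (s t)" "periodic_2pi (s' t)" "periodic_2pi (s'' t)"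
    if "t \<in> ?S" for t
    using pr[OF that] by (simp_all add: z_def s_def s'_def s''_def periodic_2pi_def)
  obtain M0 M1 M2 where M012: "\<And>t x. t \<in> ?S \<Longrightarrow> \<bar>s t x\<bar> \<le> M0" "\<And>t x. t \<in> ?S \<Longrightarrow> \<bar>s' t x\<bar> \<le> M1"
      "\<And>t x. t \<in> ?S \<Longrightarrow> \<bar>s'' t x\<bar> \<le> M2"
    using jcont_bounded[OF js(1)] jcont_bounded[OF js(2)] jcont_bounded[OF js(3)] ps by metis
  define M where "M = max M0 (max M1 M2)"
  have M: "\<bar>s t x\<bar> \<le> M" "\<bar>s' t x\<bar> \<le> M" "\<bar>s'' t x\<bar> \<le> M" if "t \<in> ?S" for t x
    using M012[OF that, of x] by (auto simp: M_def)
  have "bounded (Kc ` {0..2*pi})" by (intro compact_imp_bounded compact_continuous_image continuous_intros) simp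
  then obtain C where "\<And>r. r \<in> {0..2*pi} \<Longrightarrow> \<bar>Kc r\<bar> \<le> C"
    by (meson bounded_real imageI)
  then have C: "Kc r \<le> C" if "r \<in> {0..2*pi}" for r using that abs_le_D1 by blast
  define zt where "zt t x = conv Ks (\<lambda>x. x) (\<lambda>x. z t x * s t x + 1 / 2 * (z' t x * s' t x)) x
      - (z' t x * s t x + z t x * s' t x) / 2" for t x
  have z_t: "((\<lambda>r. z r x) has_real_derivative zt t x) (at t within ?S)" if t: "t \<in> ?S" for t x
  proof -
    let ?f = "\<lambda>w y. (w t y)\<^sup>2 + (deriv (w t) y)\<^sup>2 / 2"
    have c: "continuous_on UNIV (?f u)" "continuous_on UNIV (?f v)"
      by (auto intro!: continuous_intros sm[OF t, THEN smooth_fun_continuous])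
    have "conv Ks (\<lambda>x. x) (?f u) x + (- 1) * conv Ks (\<lambda>x. x) (?f v) x
        = conv Ks (\<lambda>x. x) (\<lambda>x. ?f u x + (- 1) * ?f v x) x"
      by (rule conv_id_add[symmetric, OF c])
    also have "(\<lambda>x. ?f u x + (- 1) * ?f v x) = (\<lambda>x. z t x * s t x + 1 / 2 * (z' t x * s' t x))"
      by (auto simp: z_def s_def z'_def s'_def power2_eq_square algebra_simps)
    finally show ?thesis unfolding z_def
      by (intro DERIV_cong[OF DERIV_diff[OF U(5)[OF t] V(5)[OF t]]])
        (simp add: zt_def, simp add: z_def s_def z'_def s'_def field_simps)
  qed
  have jzt: "jcont ?S zt"
  proof -
    have "jcont ?S (\<lambda>t x. z t x * s t x + 1 / 2 * (z' t x * s' t x))"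
      using jz js unfolding jcont_def case_prod_unfold by (intro continuous_intros)
    moreover have "jcont ?S (\<lambda>t x. x)" unfolding jcont_def case_prod_unfold by (intro continuous_intros)
    ultimately have "jcont ?S (\<lambda>t. conv Ks (\<lambda>x. x) (\<lambda>x. z t x * s t x + 1 / 2 * (z' t x * s' t x)))"
      by (intro conv_jcont) (auto intro: continuous_intros)
    then show ?thesis unfolding zt_def
      using jz js unfolding jcont_def case_prod_unfold by (intro continuous_intros; simp)
  qed
  define D where "D t = integral {0..2*pi} (\<lambda>x. (z t x)\<^sup>2)" for t
  \<comment> \<open>Integrated over a period, the two parts of the nonlocal bound,
    \<open>2 * pi * (z t x)\<^sup>2\<close> and \<open>D t\<close>, give \<open>2 * pi * D t\<close>
    each; \<open>M / 2\<close> comes from transport.\<close>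
  define L where "L = M + M * (1 + C) * (4 * pi) + M / 2"
  have D0: "D t1 = 0"
  proof (rule gronwall_zero[where T=t1 and t=t1 and D=D and D'="\<lambda>t. integral {0..2*pi} (\<lambda>x. 2 * z t x * zt t x)" and C=L])
    have "z 0 x = 0" for x using u v by (simp add: CH_solution_def z_def)
    then show "D 0 = 0" by (simp add: D_def)
    show "t1 \<in> {0..t1}" using t1 by simp
    fix t assume t: "t \<in> ?S"
    have cont: "continuous_on X (z t)" "continuous_on X (z' t)" "continuous_on X (s t)" "continuous_on X (s' t)"
        "continuous_on X (zt t)" for X
      by (rule jcont_section[OF _ t], rule jz js jzt)+
    show "0 \<le> D t" unfolding D_def
      by (intro integral_nonneg integrable_continuous_real continuous_intros cont) simp
    show "(D has_real_derivative integral {0..2*pi} (\<lambda>x. 2 * z t x * zt t x)) (at t within ?S)"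
      unfolding D_def
    proof (rule leibniz_interval)
      show "continuous_on (?S \<times> {0..2*pi}) (\<lambda>(t, x). 2 * z t x * zt t x)"
        unfolding case_prod_unfold by (intro continuous_intros jcont_comp[OF jz(1)] jcont_comp[OF jzt]) auto
      show "continuous_on {0..2*pi} (\<lambda>x. (z t x)\<^sup>2)" if "t \<in> ?S" for t
        by (intro continuous_intros jcont_section[OF jz(1) that])
      show "((\<lambda>t. (z t x)\<^sup>2) has_real_derivative 2 * z t x * zt t x) (at t within ?S)" if "t \<in> ?S" for t x
        using z_t[OF that] by (auto intro!: derivative_eq_intros)
    qed (use t in auto)
    define G where "G x = (z t x)\<^sup>2 * s t x / 2" for x
    define G' where "G' x = z t x * z' t x * s t x + (z t x)\<^sup>2 * s' t x / 2" for x
    have "(G' has_integral G (2 * pi) - G 0) {0..2*pi}"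
      by (rule ftc_real, simp)
        (auto simp: G_def[abs_def] G'_def intro!: derivative_eq_intros zx[OF t] sx[OF t])
    moreover have "G (2 * pi) = G 0"
      using pz[OF t, unfolded periodic_2pi_def, rule_format, of 0] ps(1)[OF t, unfolded periodic_2pi_def, rule_format, of 0]
      by (simp add: G_def)
    ultimately have G': "(G' has_integral 0) {0..2*pi}" by simp
    have sq: "((\<lambda>x. (z t x)\<^sup>2) has_integral D t) {0..2*pi}"
      unfolding D_def by (intro integrable_integral integrable_continuous_real continuous_intros cont)
    have "((\<lambda>x. (M + M * (1 + C) * (2 * pi) + M / 2) * (z t x)\<^sup>2 + M * (1 + C) * D t - G' x) has_integral
        (M + M * (1 + C) * (2 * pi) + M / 2) * D t + M * (1 + C) * D t * (2 * pi - 0) - 0) {0..2*pi}"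
      using has_integral_const_real[of "M * (1 + C) * D t" 0 "2 * pi"]
      by (intro has_integral_diff has_integral_add has_integral_mult_right sq G') (simp add: mult.commute)
    then have h1: "((\<lambda>x. (M + M * (1 + C) * (2 * pi) + M / 2) * (z t x)\<^sup>2 + M * (1 + C) * D t - G' x) has_integral L * D t) {0..2*pi}"
      by (simp add: L_def algebra_simps)
    have h2: "((\<lambda>x. 2 * z t x * zt t x) has_integral integral {0..2*pi} (\<lambda>x. 2 * z t x * zt t x)) {0..2*pi}"
      by (intro integrable_integral integrable_continuous_real continuous_intros cont)
    show "integral {0..2*pi} (\<lambda>x. 2 * z t x * zt t x) \<le> L * D t"
    proof (rule has_integral_le[OF h2 h1])
      fix x assume "x \<in> {0..2*pi}"
      have "2 * z t x * conv Ks (\<lambda>x. x) (\<lambda>x. z t x * s t x + 1 / 2 * (z' t x * s' t x)) x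
          \<le> M * (z t x)\<^sup>2 + M * (1 + C) * (2 * pi * (z t x)\<^sup>2 + D t)"
        unfolding D_def
        by (rule CH_nonlocal_difference_bound[OF zx[OF t] cont(2) pz[OF t] sx[OF t] jcont_section[OF js(3) t] ps(2)[OF t] M[OF t] C])
      moreover have "- (z t x)\<^sup>2 * s' t x / 2 \<le> M / 2 * (z t x)\<^sup>2"
        using mult_left_mono[OF abs_le_D2[OF M(2)[OF t, of x]], of "(z t x)\<^sup>2"] by (simp add: mult.commute)
      moreover have "2 * z t x * zt t x = 2 * z t x * conv Ks (\<lambda>x. x) (\<lambda>x. z t x * s t x + 1 / 2 * (z' t x * s' t x)) x
          - G' x - (z t x)\<^sup>2 * s' t x / 2"
        by (simp add: zt_def G'_def power2_eq_square, simp add: field_simps)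
      ultimately show "2 * z t x * zt t x \<le> (M + M * (1 + C) * (2 * pi) + M / 2) * (z t x)\<^sup>2 + M * (1 + C) * D t - G' x"
        by (simp add: algebra_simps)
    qed
  qed
  have t11: "t1 \<in> ?S" using t1 by simp
  note cz = jcont_section[OF jz(1) t11]
  have zero: "z t1 x = 0" if "x \<in> {0..0 + 2*pi}" for x
  proof -
    have "(z t1 x)\<^sup>2 = 0"
    proof (rule has_integral_0_cbox_imp_0[of 0 "2 * pi" "\<lambda>x. (z t1 x)\<^sup>2"])
      show "((\<lambda>x. (z t1 x)\<^sup>2) has_integral 0) (cbox 0 (2 * pi))"
        using D0 unfolding D_def box_real
        by (metis integrable_integral integrable_continuous_real continuous_on_power cz)
    qed (use that pi_gt_zero[unfolded not_le[symmetric]] in \<open>auto intro!: continuous_intros cz\<close>)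
    then show ?thesis by simp
  qed
  have "z t1 x = 0" for x
    using periodic_attained[OF pz[OF t11], of 0 x] zero by auto
  then show ?thesis by (auto simp: z_def)
qed

section \<open>The conjugate Poisson kernel\<close>

text \<open>The squared modulus of 1 - r e^(iy).\<close>

definition Qr :: "real \<Rightarrow> real \<Rightarrow> real" where
  "Qr r y = 1 - 2 * r * cos y + r\<^sup>2"

text \<open>Pairing with \<open>hk' r\<close> computes \<open>\<pi> |D| r^|D|\<close> at a point.\<close>

definition hk :: "real \<Rightarrow> real \<Rightarrow> real" where
  "hk r y = r * sin y / Qr r y"

definition hk' :: "real \<Rightarrow> real \<Rightarrow> real" where
  "hk' r y = r * ((1 + r\<^sup>2) * cos y - 2 * r) / (Qr r y)\<^sup>2"

lemma Qr_eq: "Qr r y = (1 - r)\<^sup>2 + 4 * r * (sin (y / 2))\<^sup>2"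
proof -
  have "cos y = 1 - 2 * (sin (y / 2))\<^sup>2" using cos_double_sin[of "y / 2"] by simp
  then show ?thesis unfolding Qr_def by (simp only:) (simp add: power2_eq_square algebra_simps)
qed

context
  fixes r :: real assumes r: "0 < r" "r < 1"
begin

lemma Qr_pos: "Qr r y > 0"
proof -
  have "(1 - r)\<^sup>2 > 0" using r by simp
  moreover have "4 * r * (sin (y / 2))\<^sup>2 \<ge> 0" using r by simp
  ultimately show ?thesis unfolding Qr_eq by (rule add_pos_nonneg)
qed

lemma hk_deriv: "(hk r has_real_derivative hk' r y) (at y)"
proof -
  have Q: "Qr r y \<noteq> 0" using Qr_pos[of y] by simp
  have Q': "(Qr r has_real_derivative 2 * r * sin y) (at y)"
    unfolding Qr_def[abs_def] by (auto intro!: derivative_eq_intros)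
  have n: "((\<lambda>y. r * sin y) has_real_derivative r * cos y) (at y)"
    by (auto intro!: derivative_eq_intros)
  have "r * cos y * Qr r y - r * sin y * (2 * r * sin y) = r * ((1 + r\<^sup>2) * cos y - 2 * r)"
    unfolding Qr_def using sin_cos_squared_add[of y] by algebra
  then show ?thesis unfolding hk_def[abs_def] hk'_def
    by (intro DERIV_cong[OF DERIV_divide[OF n Q' Q]]) (simp add: power2_eq_square)
qed

lemma hk_cont: "continuous_on X (hk r)" and hk'_cont: "continuous_on X (hk' r)"
proof -
  have "Qr r y \<noteq> 0" for y using Qr_pos[of y] by simp
  then show "continuous_on X (hk r)" "continuous_on X (hk' r)"
    unfolding hk_def hk'_def Qr_def by (auto intro!: continuous_intros)
qed

lemma hk_periodic: "periodic_2pi (hk r)" "periodic_2pi (hk' r)"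
  by (simp_all add: periodic_2pi_def hk_def hk'_def Qr_def)

text \<open>The geometric series of r^k e^(iky). Its imaginary part is \<open>hk r\<close> and twice
  its real part minus 1 is the Poisson kernel, so both multipliers follow from one integral.\<close>

private definition "E y = 1 / (1 - of_real r * cis y)"

private lemma den: "1 - complex_of_real r * cis y \<noteq> 0"
proof
  assume "1 - complex_of_real r * cis y = 0"
  then have "norm (complex_of_real r * cis y) = 1" by (metis eq_iff_diff_eq_0 norm_one)
  then show False using r by (simp add: norm_mult)
qed

private lemma E_cont: "continuous_on X E"
  unfolding E_def by (intro continuous_intros) (use den in auto)

text \<open>Partial sums are integrated term by term; the remainder is bounded uniformly in y by
  \<open>r ^ n / (1 - r)\<close>.\<close>

private lemma E_integral:
  "integral {0..2*pi} (\<lambda>y. cis (y * of_int m) * E y) = (if m \<le> 0 then 2 * pi * r ^ nat (- m) else 0)"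
proof -
  define I where "I = integral {0..2*pi} (\<lambda>y. cis (y * of_int m) * E y)"
  define c :: complex where "c = (if m \<le> 0 then 2 * pi * r ^ nat (- m) else 0)"
  have close: "norm (I - c) \<le> r ^ n / (1 - r) * (2 * pi)" if n: "n > nat (- m)" for n
  proof -
    define S where "S y = (\<Sum>k<n. (of_real r * cis y) ^ k)" for y
    have Sint: "integral {0..2*pi} (\<lambda>y. cis (y * of_int m) * S y) = c"
    proof -
      have "integral {0..2*pi} (\<lambda>y. cis (y * of_int m) * S y)
          = integral {0..2*pi} (\<lambda>y. \<Sum>k<n. of_real (r ^ k) * cis (y * of_int (m + int k)))"
      proof (rule integral_cong)
        fix y
        have "cis (y * of_int m) * (complex_of_real r * cis y) ^ k = of_real (r ^ k) * cis (y * of_int (m + int k))" for k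
          by (simp add: power_mult_distrib Complex.DeMoivre cis_mult algebra_simps)
        then show "cis (y * of_int m) * S y = (\<Sum>k<n. of_real (r ^ k) * cis (y * of_int (m + int k)))"
          by (simp add: S_def sum_distrib_left)
      qed
      also have "\<dots> = (\<Sum>k<n. of_real (r ^ k) * integral {0..2*pi} (\<lambda>y. cis (y * of_int (m + int k))))"
        by (subst integral_sum) (auto intro!: integrable_continuous_real continuous_intros)
      also have "\<dots> = (\<Sum>k<n. if k = nat (- m) \<and> m \<le> 0 then of_real (2 * pi * r ^ k) else 0)"
        by (rule sum.cong[OF refl]) (unfold integral_cis, auto)
      also have "\<dots> = c"
        using n by (auto simp: c_def sum.delta' if_distrib cong: if_cong)
      finally show ?thesis .
    qed
    have "I - c = integral {0..2*pi} (\<lambda>y. cis (y * of_int m) * (E y - S y))"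
      unfolding I_def Sint[symmetric] right_diff_distrib
      by (subst integral_diff)
        (auto simp: S_def intro!: integrable_continuous_real continuous_intros E_cont)
    also have "norm \<dots> \<le> r ^ n / (1 - r) * (2 * pi - 0)"
    proof (rule integral_bound)
      show "continuous_on {0..2*pi} (\<lambda>y. cis (y * of_int m) * (E y - S y))"
        unfolding S_def by (intro continuous_intros E_cont)
      fix y
      let ?z = "complex_of_real r * cis y"
      have "S y = (1 - ?z ^ n) / (1 - ?z)"
        unfolding S_def using den[of y] by (subst sum_gp_strict) auto
      then have "E y - S y = ?z ^ n / (1 - ?z)" by (simp add: E_def diff_divide_distrib)
      then have "norm (cis (y * of_int m) * (E y - S y)) = r ^ n / norm (1 - ?z)"
        using r by (simp add: norm_mult norm_divide norm_power)
      also have "\<dots> \<le> r ^ n / (1 - r)"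
      proof (rule divide_left_mono)
        show "1 - r \<le> norm (1 - ?z)" using norm_triangle_ineq2[of 1 ?z] r by (simp add: norm_mult)
        show "0 < norm (1 - ?z) * (1 - r)" using r den[of y] by simp
      qed (use r in simp)
      finally show "norm (cis (y * of_int m) * (E y - S y)) \<le> r ^ n / (1 - r)" .
    qed simp
    finally show ?thesis by simp
  qed
  have "(\<lambda>n. r ^ n / (1 - r) * (2 * pi)) \<longlonglongrightarrow> 0 / (1 - r) * (2 * pi)"
    by (intro tendsto_intros LIMSEQ_power_zero) (use r in auto)
  then have "(\<lambda>n. r ^ n / (1 - r) * (2 * pi)) \<longlonglongrightarrow> 0" by simp
  then have "norm (I - c) \<le> 0"
    by (rule LIMSEQ_le_const) (use close in \<open>auto intro!: exI[of _ "nat (- m) + 1"]\<close>)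
  then show ?thesis by (simp add: I_def c_def)
qed

private lemma cnj_E_integral:
  "integral {0..2*pi} (\<lambda>y. cis (y * of_int m) * cnj (E y)) = (if m \<ge> 0 then 2 * pi * r ^ nat m else 0)"
proof -
  have "integral {0..2*pi} (\<lambda>y. cis (y * of_int m) * cnj (E y))
      = integral {0..2*pi} (cnj \<circ> (\<lambda>y. cis (y * of_int (- m)) * E y))"
    by (simp add: o_def cis_cnj)
  also have "\<dots> = cnj (integral {0..2*pi} (\<lambda>y. cis (y * of_int (- m)) * E y))"
    by (rule integral_linear[OF _ bounded_linear_cnj]) (intro integrable_continuous_real continuous_intros E_cont)
  also have "\<dots> = (if m \<ge> 0 then 2 * pi * r ^ nat m else 0)"
    unfolding E_integral by simp
  finally show ?thesis .
qed

private lemma E_parts: "Re (E y) = (1 - r * cos y) / Qr r y" "Im (E y) = hk r y"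
proof -
  have "(Re (1 - of_real r * cis y))\<^sup>2 + (Im (1 - of_real r * cis y))\<^sup>2 = Qr r y"
  proof -
    have "(1 - r * cos y)\<^sup>2 + (- (r * sin y))\<^sup>2 = 1 - 2 * r * cos y + r\<^sup>2"
      using sin_cos_squared_add[of y] by algebra
    then show ?thesis by (simp add: Qr_def)
  qed
  then show "Re (E y) = (1 - r * cos y) / Qr r y" "Im (E y) = hk r y"
    by (simp_all add: E_def Re_divide Im_divide hk_def)
qed

lemma hk_fourier:
  "integral {0..2*pi} (\<lambda>y. cis (y * of_int m) * complex_of_real (hk r y)) = \<i> * pi * complex_of_real (sgn (of_int m)) * r ^ nat \<bar>m\<bar>"
proof -
  have eq: "complex_of_real (hk r y) = (E y - cnj (E y)) / (2 * \<i>)" for y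
    by (simp add: complex_eq_iff E_parts Re_divide Im_divide)
  have "integral {0..2*pi} (\<lambda>y. cis (y * of_int m) * complex_of_real (hk r y))
     = integral {0..2*pi} (\<lambda>y. (cis (y * of_int m) * E y - cis (y * of_int m) * cnj (E y)) / (2 * \<i>))"
    unfolding eq by (simp only: times_divide_eq_right right_diff_distrib)
  also have "\<dots> = (integral {0..2*pi} (\<lambda>y. cis (y * of_int m) * E y) - integral {0..2*pi} (\<lambda>y. cis (y * of_int m) * cnj (E y))) / (2 * \<i>)"
    by (subst integral_diff[symmetric])
      (auto intro!: integrable_continuous_real continuous_intros E_cont)
  also have "\<dots> = \<i> * pi * complex_of_real (sgn (of_int m)) * r ^ nat \<bar>m\<bar>"
    unfolding E_integral cnj_E_integral by (auto simp: sgn_if field_simps)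
  finally show ?thesis .
qed

lemma hk'_fourier:
  "integral {0..2*pi} (\<lambda>y. cis (y * of_int m) * complex_of_real (hk' r y)) = complex_of_real (pi * \<bar>of_int m\<bar> * r ^ nat \<bar>m\<bar>)"
proof -
  have "integral {0..2*pi} (\<lambda>y. cis (- y * of_int (- m)) * complex_of_real (hk' r y)) =
      \<i> * of_int (- m) * integral {0..2*pi} (\<lambda>y. cis (- y * of_int (- m)) * complex_of_real (hk r y))"
    using fourier_coeff_deriv[OF hk_deriv hk'_cont hk_periodic(1), of "- m"]
    unfolding fourier_coeff_def .
  then have "integral {0..2*pi} (\<lambda>y. cis (y * of_int m) * complex_of_real (hk' r y))
      = - (\<i> * of_int m * (\<i> * pi * complex_of_real (sgn (of_int m)) * r ^ nat \<bar>m\<bar>))"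
    using hk_fourier[of m] by simp
  also have "\<dots> = complex_of_real (sgn (of_int m) * of_int m * pi * r ^ nat \<bar>m\<bar>)"
  proof -
    have "- (\<i> * a * (\<i> * b * c * d)) = - (\<i> * \<i>) * (c * a * b * d)" for a b c d :: complex
      unfolding mult_minus_left by (simp only: mult_ac)
    then show ?thesis by simp
  qed
  also have "sgn (real_of_int m) * of_int m = \<bar>of_int m\<bar>" by (simp add: abs_sgn mult.commute)
  finally show ?thesis by (simp add: mult_ac)
qed

definition "poisson y = (1 - r\<^sup>2) / Qr r y"

lemma poisson_nonneg: "0 \<le> poisson y"
proof -
  have "r\<^sup>2 \<le> 1\<^sup>2" using r by (intro power_mono) auto
  then show ?thesis using Qr_pos[of y] by (simp add: poisson_def)
qed

lemma poisson_cont: "continuous_on X poisson"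
proof -
  have "Qr r y \<noteq> 0" for y using Qr_pos[of y] by simp
  then show ?thesis unfolding poisson_def Qr_def by (auto intro!: continuous_intros)
qed

lemma poisson_fourier:
  "integral {0..2*pi} (\<lambda>y. cis (y * of_int m) * complex_of_real (poisson y)) = 2 * pi * complex_of_real (r ^ nat \<bar>m\<bar>)"
proof -
  have "complex_of_real (poisson y) = E y + cnj (E y) - 1" for y
    using Qr_pos[of y] by (simp add: complex_eq_iff E_parts poisson_def field_simps) (simp add: Qr_def algebra_simps)
  then have "integral {0..2*pi} (\<lambda>y. cis (y * of_int m) * complex_of_real (poisson y))
     = integral {0..2*pi} (\<lambda>y. (cis (y * of_int m) * E y + cis (y * of_int m) * cnj (E y)) - cis (y * of_int m))"
    by (simp add: right_diff_distrib distrib_left)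
  also have "\<dots> = (integral {0..2*pi} (\<lambda>y. cis (y * of_int m) * E y) + integral {0..2*pi} (\<lambda>y. cis (y * of_int m) * cnj (E y)))
      - integral {0..2*pi} (\<lambda>y. cis (y * of_int m))"
    by (subst integral_diff, (intro integrable_continuous_real continuous_intros E_cont)+,
        subst integral_add) (auto intro!: integrable_continuous_real continuous_intros E_cont)
  also have "\<dots> = 2 * pi * complex_of_real (r ^ nat \<bar>m\<bar>)"
    unfolding E_integral cnj_E_integral integral_cis by auto
  finally show ?thesis .
qed

end

section \<open>The Fejer kernel and Bernstein's inequality\<close>

definition fejer :: "nat \<Rightarrow> real \<Rightarrow> real" where
  "fejer N y = (cmod (\<Sum>j<N. cis (real j * y)))\<^sup>2 / real N"

lemma fejer_nonneg: "0 \<le> fejer N y"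
  by (simp add: fejer_def)

lemma fejer_cont: "continuous_on X (fejer N)"
  unfolding fejer_def by (cases "N = 0") (auto intro!: continuous_intros)

text \<open>Counts the pairs j, l below \<open>N\<close> with l - j = m, the surviving terms in the
  squared modulus defining the Fejer kernel.\<close>

lemma card_int_shift: "\<bar>m\<bar> \<le> int N \<Longrightarrow> card {j. j < N \<and> 0 \<le> int j + m \<and> int j + m < int N} = N - nat \<bar>m\<bar>"
proof -
  assume m: "\<bar>m\<bar> \<le> int N"
  have "{j. j < N \<and> 0 \<le> int j + m \<and> int j + m < int N} = {nat (- m)..<nat (int N - max m 0)}"
    using m by auto
  then show ?thesis using m by (cases "m \<le> 0") (auto simp: max_def nat_diff_distrib)
qed

lemma fejer_fourier:
  assumes N: "N > 0" and m: "\<bar>m\<bar> \<le> int N"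
  shows "integral {0..2*pi} (\<lambda>y. cis (y * of_int m) * complex_of_real (fejer N y)) = 2 * pi * complex_of_real (1 - \<bar>of_int m\<bar> / N)"
proof -
  have "complex_of_real (fejer N y) = (\<Sum>j<N. \<Sum>l<N. cis (y * of_int (int j - int l))) / of_nat N" for y
  proof -
    have "complex_of_real ((cmod (\<Sum>j<N. cis (real j * y)))\<^sup>2) = (\<Sum>j<N. cis (real j * y)) * cnj (\<Sum>l<N. cis (real l * y))"
      by (rule complex_norm_square)
    also have "\<dots> = (\<Sum>j<N. \<Sum>l<N. cis (real j * y) * cis (- (real l * y)))"
      by (simp add: sum_product cis_cnj cnj_sum)
    finally show ?thesis by (simp add: fejer_def cis_mult algebra_simps)
  qed
  then have "integral {0..2*pi} (\<lambda>y. cis (y * of_int m) * complex_of_real (fejer N y))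
     = integral {0..2*pi} (\<lambda>y. (\<Sum>j<N. \<Sum>l<N. cis (y * of_int (int j + m - int l))) / of_nat N)"
    by (simp add: sum_distrib_left cis_mult algebra_simps)
  also have "\<dots> = (\<Sum>j<N. \<Sum>l<N. integral {0..2*pi} (\<lambda>y. cis (y * of_int (int j + m - int l)))) / of_nat N"
    by (simp, subst integral_sum, simp, intro integrable_continuous_real continuous_intros,
        subst integral_sum) (auto intro!: integrable_continuous_real continuous_intros)
  also have "(\<Sum>j<N. \<Sum>l<N. integral {0..2*pi} (\<lambda>y. cis (y * of_int (int j + m - int l))))
      = (\<Sum>j<N. if 0 \<le> int j + m \<and> int j + m < int N then of_real (2 * pi) else 0)"
  proof (rule sum.cong[OF refl])
    fix j
    have "(\<Sum>l<N. integral {0..2*pi} (\<lambda>y. cis (y * of_int (int j + m - int l))))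
        = (\<Sum>l<N. if l = nat (int j + m) \<and> 0 \<le> int j + m then complex_of_real (2 * pi) else 0)"
      unfolding integral_cis by (rule sum.cong[OF refl]) auto
    also have "\<dots> = (if 0 \<le> int j + m \<and> int j + m < int N then of_real (2 * pi) else 0)"
    proof (cases "0 \<le> int j + m")
      case True
      then show ?thesis by (auto simp: sum.delta' nat_less_iff)
    qed simp
    finally show "(\<Sum>l<N. integral {0..2*pi} (\<lambda>y. cis (y * of_int (int j + m - int l))))
      = (if 0 \<le> int j + m \<and> int j + m < int N then of_real (2 * pi) else 0)" .
  qed
  also have "\<dots> = of_nat (card {j. j < N \<and> 0 \<le> int j + m \<and> int j + m < int N}) * of_real (2 * pi)"
    by (simp add: sum.If_cases Int_def lessThan_def conj_commute)
  also have "\<dots> / of_nat N = 2 * pi * complex_of_real (1 - \<bar>of_int m\<bar> / N)"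
    unfolding card_int_shift[OF m] using N m by (simp add: of_nat_diff nat_le_iff field_simps flip: of_int_abs)
  finally show ?thesis .
qed

text \<open>A nonnegative kernel of mean 1 acts as averaging over translates, which cannot increase
  a supremum. It is used for the Poisson and the Fejer multiplier.\<close>

lemma multiplier_contraction:
  assumes k: "continuous_on UNIV k" "\<And>y. 0 \<le> k y"
    and \<mu>: "\<And>m. m \<in> S \<union> {0} \<Longrightarrow> integral {0..2*pi} (\<lambda>y. cis (y * of_int m) * complex_of_real (k y)) = 2 * pi * complex_of_real (\<mu> m)"
    and \<mu>0: "\<mu> 0 = 1" and S: "finite S"
    and B: "\<And>x. norm (\<Sum>m\<in>S. a m * cis (x * of_int m)) \<le> B"
  shows "norm (\<Sum>m\<in>S. complex_of_real (\<mu> m) * a m * cis (x * of_int m)) \<le> B"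
proof -
  have ck: "continuous_on X k" for X using k(1) continuous_on_subset by blast
  have "2 * pi * (\<Sum>m\<in>S. complex_of_real (\<mu> m) * a m * cis (x * of_int m))
      = (\<Sum>m\<in>S. a m * cis (x * of_int m) * integral {0..2*pi} (\<lambda>y. cis (y * of_int m) * complex_of_real (k y)))"
    unfolding sum_distrib_left by (rule sum.cong[OF refl]) (simp add: \<mu>)
  also have "\<dots> = integral {0..2*pi} (\<lambda>y. \<Sum>m\<in>S. a m * cis (x * of_int m) * (cis (y * of_int m) * complex_of_real (k y)))"
    by (subst integral_sum[OF S]) (auto intro!: integrable_continuous_real continuous_intros ck)
  also have "\<dots> = integral {0..2*pi} (\<lambda>y. (\<Sum>m\<in>S. a m * cis ((x + y) * of_int m)) * complex_of_real (k y))"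
    by (simp add: sum_distrib_right distrib_right cis_mult[symmetric] mult.assoc)
  also have "norm \<dots> \<le> integral {0..2*pi} (\<lambda>y. B * k y)"
    by (rule integral_norm_bound_integral)
      (auto simp: norm_mult k(2) intro!: integrable_continuous_real continuous_intros ck mult_right_mono B)
  also have "\<dots> = B * (2 * pi)"
  proof -
    have "complex_of_real (integral {0..2*pi} k) = integral {0..2*pi} (\<lambda>y. complex_of_real (k y))"
      using integral_linear[OF integrable_continuous_real[OF ck] bounded_linear_of_real[where 'a=complex], of 0 "2 * pi"]
      by (simp add: o_def)
    also have "\<dots> = complex_of_real (2 * pi)" using \<mu>[of 0] \<mu>0 by simp
    finally have "integral {0..2*pi} k = 2 * pi" unfolding of_real_eq_iff .
    then show ?thesis by simp
  qed
  finally have "2 * pi * norm (\<Sum>m\<in>S. complex_of_real (\<mu> m) * a m * cis (x * of_int m)) \<le> B * (2 * pi)"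
    by (simp add: norm_mult)
  then show ?thesis by simp
qed

text \<open>Bernstein's inequality for \<open>|D|\<close>: on frequencies up to \<open>N\<close>, \<open>|m| = N (1 - (1 - |m| / N))\<close>,
  and the second factor is the Fejer multiplier.\<close>

lemma bernstein_hk':
  assumes r: "0 < r" "r < 1" and N: "N > 0" and S: "finite S" "\<And>m. m \<in> S \<Longrightarrow> \<bar>m\<bar> \<le> int N"
    and B: "\<And>x. norm (\<Sum>m\<in>S. a m * cis (x * of_int m)) \<le> B"
  shows "norm (integral {0..2*pi} (\<lambda>y. (\<Sum>m\<in>S. a m * cis ((c + y) * of_int m)) * complex_of_real (hk' r y))) \<le> 2 * pi * N * B"
proof -
  have P: "norm (\<Sum>m\<in>S. complex_of_real (r ^ nat \<bar>m\<bar>) * a m * cis (x * of_int m)) \<le> B" for x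
    by (rule multiplier_contraction[OF poisson_cont[OF r] poisson_nonneg[OF r] poisson_fourier[OF r] _ S(1) B]) simp
  have Fj: "norm (\<Sum>m\<in>S. complex_of_real (1 - \<bar>of_int m\<bar> / N) * (complex_of_real (r ^ nat \<bar>m\<bar>) * a m) * cis (x * of_int m)) \<le> B" for x
    by (rule multiplier_contraction[OF fejer_cont fejer_nonneg fejer_fourier[OF N] _ S(1) P]) (use S(2) in auto)
  have "integral {0..2*pi} (\<lambda>y. (\<Sum>m\<in>S. a m * cis ((c + y) * of_int m)) * complex_of_real (hk' r y))
      = integral {0..2*pi} (\<lambda>y. \<Sum>m\<in>S. a m * cis (c * of_int m) * (cis (y * of_int m) * complex_of_real (hk' r y)))"
    by (simp add: sum_distrib_right distrib_right cis_mult[symmetric] mult.assoc)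
  also have "\<dots> = (\<Sum>m\<in>S. a m * cis (c * of_int m) * complex_of_real (pi * \<bar>of_int m\<bar> * r ^ nat \<bar>m\<bar>))"
    by (subst integral_sum[OF S(1)])
      (auto simp: hk'_fourier[OF r] intro!: integrable_continuous_real continuous_intros hk'_cont[OF r])
  also have "\<dots> = pi * N * ((\<Sum>m\<in>S. complex_of_real (r ^ nat \<bar>m\<bar>) * a m * cis (c * of_int m))
      - (\<Sum>m\<in>S. complex_of_real (1 - \<bar>of_int m\<bar> / N) * (complex_of_real (r ^ nat \<bar>m\<bar>) * a m) * cis (c * of_int m)))"
    unfolding sum_subtractf[symmetric] sum_distrib_left
    by (rule sum.cong[OF refl]) (use N in \<open>simp add: field_simps\<close>)
  also have "norm \<dots> \<le> pi * N * (B + B)"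
    unfolding norm_mult
    by (rule mult_mono[OF _ order_trans[OF norm_triangle_ineq4 add_mono[OF P Fj]]]) (auto simp: norm_mult)
  finally show ?thesis by (simp add: algebra_simps)
qed

section \<open>Littlewood-Paley blocks\<close>

text \<open>The multiplier of the block with index j = k - 1, so that numbering starts at 0 and the
  sums telescope to a dilate of \<open>chi\<close>.\<close>

definition block_mult :: "(real \<Rightarrow> real) \<Rightarrow> nat \<Rightarrow> int \<Rightarrow> real" where
  "block_mult chi k \<xi> = (if k = 0 then chi \<xi> else LP_phi chi (2 powr (- (real k - 1)) * \<xi>))"

lemma dyadic_block_mult:
  "dyadic_block chi (int k - 1) f = fourier_mult (\<lambda>\<xi>. complex_of_real (block_mult chi k \<xi>)) f"
  by (cases "k = 0") (auto simp: dyadic_block_def block_mult_def)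

lemma block_mult_sum: "(\<Sum>k\<le>J. block_mult chi k \<xi>) = chi (\<xi> / 2 ^ J)"
proof (induct J)
  case (Suc J)
  have "2 powr (- (real (Suc J) - 1)) * \<xi> = \<xi> / 2 ^ J"
    by (simp add: powr_minus powr_realpow divide_inverse)
  then have "block_mult chi (Suc J) \<xi> = chi (\<xi> / 2 ^ J / 2) - chi (\<xi> / 2 ^ J)"
    by (simp add: block_mult_def LP_phi_def)
  with Suc show ?case by (simp add: mult.commute)
qed (simp add: block_mult_def)

lemma fourier_mult_finite:
  assumes S: "finite S" and m: "\<And>\<xi>. \<xi> \<notin> S \<Longrightarrow> m \<xi> * fourier_coeff f \<xi> = 0"
  shows "fourier_mult m f x = (\<Sum>\<xi>\<in>S. m \<xi> * fourier_coeff f \<xi> / (2 * pi) * cis (x * of_int \<xi>))"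
proof -
  have "infsum (\<lambda>\<xi>. m \<xi> * fourier_coeff f \<xi> * cis (x * of_int \<xi>)) UNIV
      = infsum (\<lambda>\<xi>. m \<xi> * fourier_coeff f \<xi> * cis (x * of_int \<xi>)) S"
    by (rule infsum_cong_neutral) (use m in auto)
  then show ?thesis using S by (simp add: fourier_mult_def sum_distrib_left field_simps)
qed

context
  fixes chi :: "real \<Rightarrow> real" assumes chi: "LP_cutoff chi"
begin

lemma chi_0: "4 / 3 < \<bar>x\<bar> \<Longrightarrow> chi x = 0" and chi_1: "\<bar>x\<bar> \<le> 3 / 4 \<Longrightarrow> chi x = 1"
  using chi by (auto simp: LP_cutoff_def)

lemma chi_bounded: "\<exists>B. \<forall>x. \<bar>chi x\<bar> \<le> B"
proof -
  have c: "continuous_on {-2..2} chi"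
    using chi by (intro smooth_fun_continuous) (simp add: LP_cutoff_def)
  have "bounded (chi ` {-2..2})" by (intro compact_imp_bounded compact_continuous_image c) simp
  then obtain B where B: "\<And>x. x \<in> {-2..2} \<Longrightarrow> \<bar>chi x\<bar> \<le> B" by (meson bounded_real imageI)
  have "\<bar>chi x\<bar> \<le> B" for x
    using B[of x] B[of 0] chi_0[of x] by (cases "x \<in> {-2..2}") auto
  then show ?thesis by blast
qed

text \<open>A bound for the frequencies of block k: the integers up to 4/3 for k = 0, and otherwise
  \<open>8 / 3 * 2 ^ (k - 1)\<close> rounded up to an integer multiple of the power.\<close>

definition deg :: "nat \<Rightarrow> nat" where "deg k = (if k = 0 then 1 else 3 * 2 ^ (k - 1))"

lemma deg_pos: "deg k > 0"
  by (simp add: deg_def)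

lemma block_mult_supp: "\<not> \<bar>\<xi>\<bar> \<le> int (deg k) \<Longrightarrow> block_mult chi k \<xi> = 0"
proof (cases k)
  case 0
  assume "\<not> \<bar>\<xi>\<bar> \<le> int (deg k)"
  then have "2 \<le> \<bar>real_of_int \<xi>\<bar>" using 0 by (simp add: deg_def)
  then show ?thesis using 0 by (simp add: block_mult_def chi_0)
next
  case (Suc j)
  assume "\<not> \<bar>\<xi>\<bar> \<le> int (deg k)"
  then have "3 * 2 ^ j < \<bar>\<xi>\<bar>" using Suc by (simp add: deg_def)
  then have "real_of_int (3 * 2 ^ j) < real_of_int \<bar>\<xi>\<bar>" by (rule of_int_less_iff[THEN iffD2])
  then have "3 * 2 ^ j < \<bar>real_of_int \<xi>\<bar>" by simp
  then have "3 < \<bar>\<xi> / 2 ^ j\<bar>" by (simp add: abs_divide pos_less_divide_eq)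
  then have "4 / 3 < \<bar>\<xi> / 2 ^ j\<bar>" "4 / 3 < \<bar>\<xi> / 2 ^ j / 2\<bar>"
  proof -
    have "4 / 3 < \<bar>z\<bar> \<and> 4 / 3 < \<bar>z / 2\<bar>" if "3 < \<bar>z\<bar>" for z :: real
      using that by linarith
    then show "4 / 3 < \<bar>\<xi> / 2 ^ j\<bar>" "4 / 3 < \<bar>\<xi> / 2 ^ j / 2\<bar>"
      using \<open>3 < \<bar>\<xi> / 2 ^ j\<bar>\<close> by blast+
  qed
  then have "chi (\<xi> / 2 ^ j) = 0" "chi (\<xi> / 2 ^ j / 2) = 0" by (simp_all only: chi_0)
  moreover have "2 powr (- (real k - 1)) * \<xi> = \<xi> / 2 ^ j"
    using Suc by (simp add: powr_minus powr_realpow divide_inverse)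
  ultimately show ?thesis using Suc by (simp add: block_mult_def LP_phi_def)
qed

text \<open>Origin of the factor 20: Bernstein costs \<open>2 * pi * deg k\<close>, and 6 pi is
  below 20.\<close>

lemma deg_le: "real (deg k) * (2 * pi) \<le> 20 * 2 powr (real k - 1)"
proof (cases k)
  case 0
  then show ?thesis using pi_less_4 pi_approx by (simp add: deg_def powr_minus)
next
  case (Suc j)
  have "6 * pi * 2 ^ j \<le> 20 * 2 ^ j" using pi_approx by (intro mult_right_mono) auto
  then show ?thesis using Suc by (simp add: deg_def powr_realpow)
qed

lemma block_sum_finite:
  "dyadic_block chi (int k - 1) v x = (\<Sum>\<xi>\<in>{- int (deg k)..int (deg k)}.
     complex_of_real (block_mult chi k \<xi>) * fourier_coeff v \<xi> / (2 * pi) * cis (x * of_int \<xi>))"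
  unfolding dyadic_block_mult
  by (rule fourier_mult_finite) (use block_mult_supp[of _ k] in auto)

lemma block_cont: "continuous_on X (dyadic_block chi (int k - 1) v)"
  unfolding block_sum_finite[abs_def] by (intro continuous_intros)

definition "pair r c f = integral {0..2*pi} (\<lambda>y. f (c + y) * complex_of_real (hk' r y))"

lemma block_pair_bound:
  assumes r: "0 < r" "r < 1"
  shows "ennreal (norm (pair r c (dyadic_block chi (int k - 1) v)))
    \<le> 20 * (ennreal (2 powr (real k - 1)) * Linf_norm (dyadic_block chi (int k - 1) v))"
proof (cases "Linf_norm (dyadic_block chi (int k - 1) v) = \<infinity>")
  case True
  then show ?thesis by (simp add: ennreal_mult_eq_top_iff)
next
  case False
  then obtain B where B: "Linf_norm (dyadic_block chi (int k - 1) v) = ennreal B" "0 \<le> B"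
    by (metis ennreal_cases infinity_ennreal_def)
  have le: "norm (dyadic_block chi (int k - 1) v x) \<le> B" for x
  proof -
    have "ennreal (norm (dyadic_block chi (int k - 1) v x)) \<le> ennreal B"
      unfolding B(1)[symmetric] Linf_norm_def by (rule SUP_upper) simp
    then show ?thesis using B(2) by simp
  qed
  have "norm (pair r c (dyadic_block chi (int k - 1) v)) \<le> 2 * pi * deg k * B"
    unfolding pair_def block_sum_finite
    by (rule bernstein_hk'[OF r deg_pos]) (use le in \<open>auto simp: block_sum_finite\<close>)
  also have "\<dots> = (real (deg k) * (2 * pi)) * B" by simp
  also have "\<dots> \<le> 20 * 2 powr (real k - 1) * B" using deg_le B(2) by (intro mult_right_mono)
  finally have "ennreal (norm (pair r c (dyadic_block chi (int k - 1) v))) \<le> ennreal (20 * (2 powr (real k - 1) * B))"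
    by (intro ennreal_leI) simp
  also have "\<dots> = 20 * (ennreal (2 powr (real k - 1)) * ennreal B)"
    using B(2) by (simp add: ennreal_mult)
  finally show ?thesis by (simp add: B(1))
qed

text \<open>The coefficients of \<open>v\<close> are absolutely summable, and
  \<open>chi (\<xi> / 2 ^ J)\<close> equals 1 on any given finite set once J is large; the discarded
  tail enters with weight at most 1 + B, where B bounds \<open>chi\<close>.\<close>

lemma partial_blocks_converge:
  assumes v: "H_inf v" and \<epsilon>: "0 < \<epsilon>"
  shows "\<exists>J. \<forall>x. norm (complex_of_real (v x) - (\<Sum>k\<le>J. dyadic_block chi (int k - 1) v x)) \<le> \<epsilon>"
proof -
  have s: "smooth_fun v" "smooth_fun (deriv v)" "smooth_fun (deriv (deriv v))"
    and p: "periodic_2pi v" "periodic_2pi (deriv v)" "periodic_2pi (deriv (deriv v))"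
    using v by (auto simp: H_inf_def intro: smooth_fun_deriv periodic_deriv)
  note inv = fourier_inversion[OF s(1,2)[THEN smooth_fun_has_deriv] smooth_fun_continuous[OF s(3)] p]
  obtain B where B: "\<And>x. \<bar>chi x\<bar> \<le> B" using chi_bounded by blast
  have B0: "0 \<le> B" using B[of 0] by linarith
  let ?a = "\<lambda>\<xi>. norm (fourier_coeff v \<xi>)"
  define \<delta> where "\<delta> = \<epsilon> / (1 + B)"
  have \<delta>: "0 < \<delta>" using \<epsilon> B0 by (simp add: \<delta>_def)
  from inv(1) have "(sum ?a \<longlongrightarrow> infsum ?a UNIV) (finite_subsets_at_top UNIV)" by (rule infsum_tendsto)
  then have "eventually (\<lambda>X. dist (sum ?a X) (infsum ?a UNIV) < \<delta>) (finite_subsets_at_top UNIV)"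
    using \<delta> by (rule tendstoD)
  then obtain X where X: "finite X" "dist (sum ?a X) (infsum ?a UNIV) < \<delta>"
    unfolding eventually_finite_subsets_at_top by blast
  have aX: "?a summable_on (- X)" by (rule summable_on_subset_banach[OF inv(1)]) simp
  have tail: "infsum ?a (- X) \<le> \<delta>"
  proof -
    have "infsum ?a (UNIV - X) = infsum ?a UNIV - infsum ?a X"
      by (rule infsum_Diff[OF inv(1)]) (use X(1) in auto)
    then show ?thesis using X by (simp add: dist_real_def Compl_eq_Diff_UNIV)
  qed
  obtain K where K: "\<And>\<xi>. \<xi> \<in> X \<Longrightarrow> \<bar>real_of_int \<xi>\<bar> \<le> K"
    using X(1) by (metis Max_ge finite_imageI imageI)
  obtain J where J: "4 / 3 * K < 2 ^ J" using real_arch_pow[of 2 "4 / 3 * K"] by auto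
  have chiX: "chi (\<xi> / 2 ^ J) = 1" if "\<xi> \<in> X" for \<xi> :: int
  proof (rule chi_1)
    have "\<bar>real_of_int \<xi>\<bar> * (4 / 3) \<le> 2 ^ J" using K[OF that] J by linarith
    then show "\<bar>real_of_int \<xi> / 2 ^ J\<bar> \<le> 3 / 4" by (simp add: abs_divide divide_le_eq)
  qed
  show ?thesis
  proof (intro exI[of _ J] allI)
    fix x
    \<comment> \<open>A common frequency bound for the first J + 1 blocks that also exceeds the
      support of \<open>chi (\<xi> / 2 ^ J)\<close>.\<close>
    define D where "D = 3 * 2 ^ J + (1::nat)"
    have degD: "deg k \<le> D" if "k \<le> J" for k
    proof -
      have "(2::nat) ^ (k - 1) \<le> 2 ^ J" by (rule power_increasing) (use that in auto)
      then have "3 * (2::nat) ^ (k - 1) \<le> 3 * 2 ^ J" by (rule mult_le_mono2)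
      then show ?thesis unfolding deg_def D_def by presburger
    qed
    let ?f = "\<lambda>\<xi>. fourier_coeff v \<xi> * cis (x * of_int \<xi>)"
    let ?c = "\<lambda>\<xi>::int. complex_of_real (chi (\<xi> / 2 ^ J))"
    have blocks: "(\<Sum>k\<le>J. dyadic_block chi (int k - 1) v x) = (\<Sum>\<xi>\<in>{- int D..int D}. ?c \<xi> * ?f \<xi>) / (2 * pi)"
    proof -
      have "(\<Sum>k\<le>J. dyadic_block chi (int k - 1) v x) = (\<Sum>k\<le>J. \<Sum>\<xi>\<in>{- int D..int D}.
          complex_of_real (block_mult chi k \<xi>) * fourier_coeff v \<xi> / (2 * pi) * cis (x * of_int \<xi>))"
        unfolding block_sum_finite
      proof (rule sum.cong[OF refl], rule sum.mono_neutral_left)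
        fix k assume "k \<in> {..J}"
        then have "int (deg k) \<le> int D" using degD by simp
        then show "{- int (deg k)..int (deg k)} \<subseteq> {- int D..int D}" by auto
        show "\<forall>\<xi>\<in>{- int D..int D} - {- int (deg k)..int (deg k)}.
            complex_of_real (block_mult chi k \<xi>) * fourier_coeff v \<xi> / (2 * pi) * cis (x * of_int \<xi>) = 0"
        proof
          fix \<xi> assume "\<xi> \<in> {- int D..int D} - {- int (deg k)..int (deg k)}"
          then have "block_mult chi k \<xi> = 0" by (intro block_mult_supp) auto
          then show "complex_of_real (block_mult chi k \<xi>) * fourier_coeff v \<xi> / (2 * pi) * cis (x * of_int \<xi>) = 0" by simp
        qed
      qed simp
      also have "\<dots> = (\<Sum>\<xi>\<in>{- int D..int D}. (\<Sum>k\<le>J. complex_of_real (block_mult chi k \<xi>)) * ?f \<xi> / (2 * pi))"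
        by (subst sum.swap) (simp add: sum_distrib_right sum_divide_distrib mult.assoc)
      finally show ?thesis
        by (simp add: of_real_sum[symmetric] block_mult_sum sum_divide_distrib del: of_real_sum)
    qed
    have big: "?c \<xi> = 0" if "\<xi> \<notin> {- int D..int D}" for \<xi>
    proof -
      have "3 * 2 ^ J < \<bar>\<xi>\<bar>" using that by (auto simp: D_def)
      then have "real_of_int (3 * 2 ^ J) < real_of_int \<bar>\<xi>\<bar>" by (rule of_int_less_iff[THEN iffD2])
      then have "3 < \<bar>\<xi> / 2 ^ J\<bar>" by (simp add: abs_divide pos_less_divide_eq)
      then have "4 / 3 < \<bar>\<xi> / 2 ^ J\<bar>" by linarith
      then show ?thesis by (simp only: chi_0 of_real_0)
    qed
    have sum2: "((\<lambda>\<xi>. ?c \<xi> * ?f \<xi>) has_sum (\<Sum>\<xi>\<in>{- int D..int D}. ?c \<xi> * ?f \<xi>)) UNIV"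
      by (rule has_sum_finite_neutralI) (use big in auto)
    have "((\<lambda>\<xi>. ?f \<xi> - ?c \<xi> * ?f \<xi>) has_sum (2 * pi * complex_of_real (v x) - (\<Sum>\<xi>\<in>{- int D..int D}. ?c \<xi> * ?f \<xi>))) UNIV"
    proof -
      have "((\<lambda>\<xi>. - (?c \<xi> * ?f \<xi>)) has_sum - (\<Sum>\<xi>\<in>{- int D..int D}. ?c \<xi> * ?f \<xi>)) UNIV"
        unfolding has_sum_uminus minus_minus by (rule sum2)
      from has_sum_add[OF inv(2)[of x] this] show ?thesis by simp
    qed
    then have hs: "((\<lambda>\<xi>. ?f \<xi> - ?c \<xi> * ?f \<xi>) has_sum (2 * pi * complex_of_real (v x) - (\<Sum>\<xi>\<in>{- int D..int D}. ?c \<xi> * ?f \<xi>))) (- X)"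
      by (rule has_sum_cong_neutral[THEN iffD1, rotated -1]) (use chiX in auto)
    have "norm (2 * pi * complex_of_real (v x) - (\<Sum>\<xi>\<in>{- int D..int D}. ?c \<xi> * ?f \<xi>)) \<le> infsum (\<lambda>\<xi>. (1 + B) * ?a \<xi>) (- X)"
    proof (rule norm_infsum_le[OF hs has_sum_infsum])
      show "(\<lambda>\<xi>. (1 + B) * ?a \<xi>) summable_on - X" by (rule summable_on_cmult_right[OF aX])
      fix \<xi> :: int
      have "?f \<xi> - ?c \<xi> * ?f \<xi> = complex_of_real (1 - chi (\<xi> / 2 ^ J)) * ?f \<xi>" by (simp add: left_diff_distrib)
      then have "norm (?f \<xi> - ?c \<xi> * ?f \<xi>) = \<bar>1 - chi (\<xi> / 2 ^ J)\<bar> * ?a \<xi>" by (simp only: norm_mult norm_of_real norm_cis mult_1_right)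
      also have "\<dots> \<le> (1 + B) * ?a \<xi>" using B[of "\<xi> / 2 ^ J"] by (intro mult_right_mono) auto
      finally show "norm (?f \<xi> - ?c \<xi> * ?f \<xi>) \<le> (1 + B) * ?a \<xi>" .
    qed
    also have "\<dots> = (1 + B) * infsum ?a (- X)" by (rule infsum_cmult_right') 
    also have "\<dots> \<le> (1 + B) * \<delta>" using tail B0 by (intro mult_left_mono) auto
    also have "\<dots> = \<epsilon>" using B0 by (simp add: \<delta>_def)
    finally have 1: "norm (2 * pi * complex_of_real (v x) - (\<Sum>\<xi>\<in>{- int D..int D}. ?c \<xi> * ?f \<xi>)) \<le> \<epsilon>" .
    have "complex_of_real (v x) - (\<Sum>k\<le>J. dyadic_block chi (int k - 1) v x)
        = (2 * pi * complex_of_real (v x) - (\<Sum>\<xi>\<in>{- int D..int D}. ?c \<xi> * ?f \<xi>)) / (2 * pi)"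
      unfolding blocks by (simp add: field_simps)
    also have "norm \<dots> \<le> \<epsilon> / (2 * pi)"
    proof -
      have "cmod (complex_of_real (2 * pi)) = 2 * pi" unfolding norm_of_real by simp
      then show ?thesis using divide_right_mono[OF 1, of "2 * pi"] by (simp only: norm_divide) simp
    qed
    also have "\<dots> \<le> \<epsilon>" using \<epsilon> pi_ge_two by (simp add: divide_le_eq)
    finally show "norm (complex_of_real (v x) - (\<Sum>k\<le>J. dyadic_block chi (int k - 1) v x)) \<le> \<epsilon>" .
  qed
qed

text \<open>Finite sums of blocks converge uniformly to \<open>v\<close>, and for fixed r the kernel
  \<open>hk' r\<close> is bounded, so the pairing passes to the limit. The block bounds are
  independent of r and c.\<close>

theorem besov_controls_hilbert:
  assumes v: "H_inf v" and r: "0 < r" "r < 1"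
  shows "ennreal \<bar>integral {0..2*pi} (\<lambda>y. v (c + y) * hk' r y)\<bar> \<le> 20 * besov_1_inf_1 chi v"
proof -
  have cv: "continuous_on X v" for X using v by (intro smooth_fun_continuous) (simp add: H_inf_def)
  have cvc: "continuous_on X (\<lambda>y. v (c + y))" for X by (intro continuous_on_compose2[OF cv[of UNIV]] continuous_intros) auto
  have bc: "continuous_on X (\<lambda>y. dyadic_block chi (int k - 1) v (c + y))" for X k
    by (intro continuous_on_compose2[OF block_cont[of UNIV]] continuous_intros) auto
  have norm_eq: "\<bar>integral {0..2*pi} (\<lambda>y. v (c + y) * hk' r y)\<bar> = norm (pair r c (\<lambda>x. complex_of_real (v x)))"
  proof -
    have "pair r c (\<lambda>x. complex_of_real (v x)) = complex_of_real (integral {0..2*pi} (\<lambda>y. v (c + y) * hk' r y))"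
      using integral_linear[OF integrable_continuous_real[of 0 "2*pi" "\<lambda>y. v (c + y) * hk' r y"] bounded_linear_of_real[where 'a=complex]]
      by (simp add: pair_def o_def continuous_on_mult cvc hk'_cont[OF r])
    then show ?thesis by simp
  qed
  obtain M where M: "M > 0" "\<And>y. \<bar>hk' r y\<bar> \<le> M"
    using periodic_bounded[OF hk'_cont[OF r] hk_periodic(2)[OF r]] by blast
  have approx: "ennreal (norm (pair r c (\<lambda>x. complex_of_real (v x)))) \<le> 20 * besov_1_inf_1 chi v + ennreal \<epsilon>" if \<epsilon>: "\<epsilon> > 0" for \<epsilon>
  proof -
    define \<delta> where "\<delta> = \<epsilon> / (M * (2 * pi))"
    have \<delta>: "\<delta> > 0" using \<epsilon> M(1) by (simp add: \<delta>_def)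
    obtain J where J: "\<And>x. norm (complex_of_real (v x) - (\<Sum>k\<le>J. dyadic_block chi (int k - 1) v x)) \<le> \<delta>"
      using partial_blocks_converge[OF v \<delta>] by blast
    let ?S = "\<lambda>x. \<Sum>k\<le>J. dyadic_block chi (int k - 1) v x"
    have "pair r c (\<lambda>x. complex_of_real (v x)) - (\<Sum>k\<le>J. pair r c (dyadic_block chi (int k - 1) v))
        = integral {0..2*pi} (\<lambda>y. (complex_of_real (v (c + y)) - ?S (c + y)) * complex_of_real (hk' r y))"
    proof -
      have "(\<Sum>k\<le>J. pair r c (dyadic_block chi (int k - 1) v)) = integral {0..2*pi} (\<lambda>y. ?S (c + y) * complex_of_real (hk' r y))"
        unfolding pair_def sum_distrib_right
        by (rule integral_sum[symmetric]) (auto intro!: integrable_continuous_real continuous_intros bc hk'_cont[OF r])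
      then show ?thesis unfolding pair_def left_diff_distrib
        by (subst integral_diff)
          (auto intro!: integrable_continuous_real continuous_intros bc cvc hk'_cont[OF r])
    qed
    also have "norm \<dots> \<le> \<delta> * M * (2 * pi - 0)"
      by (rule integral_bound)
        (auto intro!: continuous_intros bc cvc hk'_cont[OF r] mult_mono J M less_imp_le[OF \<delta>] simp: norm_mult)
    also have "\<dots> = \<epsilon>" using M(1) by (simp add: \<delta>_def)
    finally have "norm (pair r c (\<lambda>x. complex_of_real (v x))) \<le> norm (\<Sum>k\<le>J. pair r c (dyadic_block chi (int k - 1) v)) + \<epsilon>"
      using norm_triangle_sub by (smt (verit))
    also have "\<dots> \<le> (\<Sum>k\<le>J. norm (pair r c (dyadic_block chi (int k - 1) v))) + \<epsilon>"
      by (intro add_right_mono norm_sum)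
    finally have "ennreal (norm (pair r c (\<lambda>x. complex_of_real (v x))))
        \<le> ennreal ((\<Sum>k\<le>J. norm (pair r c (dyadic_block chi (int k - 1) v))) + \<epsilon>)" by (rule ennreal_leI)
    also have "\<dots> = (\<Sum>k\<le>J. ennreal (norm (pair r c (dyadic_block chi (int k - 1) v)))) + ennreal \<epsilon>"
      using \<epsilon> by (subst ennreal_plus) (auto intro!: sum_nonneg simp: sum_ennreal)
    also have "(\<Sum>k\<le>J. ennreal (norm (pair r c (dyadic_block chi (int k - 1) v))))
        \<le> (\<Sum>k\<le>J. 20 * (ennreal (2 powr (real k - 1)) * Linf_norm (dyadic_block chi (int k - 1) v)))"
      by (intro sum_mono block_pair_bound r)
    also have "\<dots> = 20 * (\<Sum>k\<le>J. ennreal (2 powr (real k - 1)) * Linf_norm (dyadic_block chi (int k - 1) v))"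
      by (simp add: sum_distrib_left)
    also have "\<dots> \<le> 20 * besov_1_inf_1 chi v"
      unfolding besov_1_inf_1_def by (intro mult_left_mono sum_le_suminf) auto
    finally show ?thesis by (simp add: add_right_mono)
  qed
  show ?thesis unfolding norm_eq by (rule ennreal_le_epsilon) (use approx in auto)
qed

end

section \<open>The initial datum\<close>

text \<open>The Fourier series of the sawtooth (pi - x) / 2, with Abel weights and cut off at
  frequency M.\<close>

definition saw :: "nat \<Rightarrow> real \<Rightarrow> real \<Rightarrow> real" where
  "saw M r x = (\<Sum>k=1..M. r ^ k / real k * sin (real k * x))"

definition saw' :: "nat \<Rightarrow> real \<Rightarrow> real \<Rightarrow> real" where
  "saw' M r x = (\<Sum>k=1..M. r ^ k * cos (real k * x))"

lemma saw_deriv: "(saw M r has_real_derivative saw' M r x) (at x)"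
  unfolding saw_def[abs_def] saw'_def
  by (rule DERIV_sum) (auto intro!: derivative_eq_intros)

lemma periodic_sin_cos: "sin (real k * (x + 2 * pi)) = sin (real k * x)" "cos (real k * (x + 2 * pi)) = cos (real k * x)"
proof -
  have "real k * (x + 2 * pi) = real k * x + 2 * real k * pi" by (simp add: algebra_simps)
  then show "sin (real k * (x + 2 * pi)) = sin (real k * x)" "cos (real k * (x + 2 * pi)) = cos (real k * x)"
    by (simp_all add: sin_add cos_add)
qed

lemma saw_periodic: "periodic_2pi (saw M r)"
  unfolding periodic_2pi_def saw_def periodic_sin_cos by simp

lemma saw_odd: "saw M r (- x) = - saw M r x"
  by (simp add: saw_def sum_negf)

lemma saw'_bound: assumes "0 \<le> r" "r \<le> 1" shows "\<bar>saw' M r x\<bar> \<le> M"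
proof -
  have "\<bar>saw' M r x\<bar> \<le> (\<Sum>k=1..M. 1)"
    unfolding saw'_def
    by (rule order_trans[OF sum_abs sum_mono]) (use assms in \<open>auto simp: abs_mult intro!: mult_le_one power_le_one\<close>)
  then show ?thesis by simp
qed

text \<open>The full series is \<open>- Im (Ln (1 - r e^(ix)))\<close>, bounded by \<open>\<pi>/2\<close> as \<open>1 - z\<close> lies in the right
  half plane; the choice of \<open>r\<close> makes the tail at most 1.\<close>

lemma saw_bound:
  assumes M: "M \<ge> 1" and r: "r = real M / (real M + 1)"
  shows "\<bar>saw M r x\<bar> \<le> 3"
proof -
  have r01: "0 < r" "r < 1" using M by (auto simp: r divide_simps)
  define z where "z = of_real r * cis x"
  have z: "norm z = r" using r01 by (simp add: z_def norm_mult)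
  define f where "f k = z ^ k / of_nat k" for k
  have "(\<lambda>n. (-1) ^ Suc n / of_nat n * (- z) ^ n) sums Ln (1 + (- z))"
    by (rule Ln_series) (use z r01 in simp)
  moreover have "(-1) ^ Suc n / of_nat n * (- z) ^ n = - f n" for n
  proof -
    have "(- z) ^ n = (-1) ^ n * z ^ n" by (rule power_minus)
    moreover have "(-1) ^ n * (-1) ^ n = (1 :: complex)" by (simp flip: power_add add: mult_2[symmetric])
    ultimately show ?thesis by (simp add: f_def mult.assoc[symmetric])
  qed
  ultimately have "(\<lambda>n. - f n) sums Ln (1 - z)" by simp
  from sums_minus[OF this] have sums: "f sums - Ln (1 - z)" by simp
  have "norm (f k) \<le> r ^ k" for k
    using r01 by (cases "k = 0") (auto simp: f_def norm_divide norm_power z divide_le_eq mult_le_cancel_left1)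
  have tail_le: "norm (f (k + (M + 1))) \<le> r ^ (M + 1) / (M + 1) * r ^ k" for k
  proof -
    have "norm (f (k + (M + 1))) = r ^ (k + (M + 1)) / real (k + (M + 1))"
      by (simp only: f_def norm_divide norm_power z norm_of_nat)
    also have "\<dots> = r ^ (M + 1) * r ^ k / real (k + (M + 1))" by (simp add: power_add mult_ac)
    also have "\<dots> \<le> r ^ (M + 1) * r ^ k / real (M + 1)"
      using r01 by (intro divide_left_mono) auto
    finally show ?thesis by simp
  qed
  have geo: "summable (\<lambda>k. r ^ (M + 1) / (M + 1) * r ^ k)"
    using r01 by (intro summable_mult summable_geometric) simp
  have "norm (suminf (\<lambda>k. f (k + (M + 1)))) \<le> suminf (\<lambda>k. r ^ (M + 1) / (M + 1) * r ^ k)"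
    by (rule norm_suminf_le[OF tail_le geo])
  also have "\<dots> = r ^ (M + 1) / (M + 1) * (1 / (1 - r))"
    using r01 by (subst suminf_mult) (auto intro!: summable_geometric simp: suminf_geometric)
  also have "\<dots> = r ^ (M + 1)"
  proof -
    have "1 - r = 1 / (real M + 1)" by (simp add: r field_simps)
    then show ?thesis by (simp add: add.commute)
  qed
  also have "\<dots> \<le> 1" using r01 by (intro power_le_one) auto
  finally have tail: "norm (suminf (\<lambda>k. f (k + (M + 1)))) \<le> 1" .
  have "- Ln (1 - z) = suminf (\<lambda>k. f (k + (M + 1))) + (\<Sum>k<M+1. f k)"
    using suminf_split_initial_segment[OF sums_summable[OF sums], of "M + 1"] sums_unique[OF sums] by simp
  moreover have "Im (\<Sum>k<M+1. f k) = saw M r x"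
  proof -
    have "(\<Sum>k<M+1. f k) = (\<Sum>k=1..M. f k)"
      by (rule sum.mono_neutral_right) (auto simp: f_def)
    moreover have "Im (f k) = r ^ k / real k * sin (real k * x)" for k
    proof -
      have "f k = complex_of_real (r ^ k / real k) * cis (real k * x)"
        by (simp add: f_def z_def power_mult_distrib Complex.DeMoivre)
      then show ?thesis by simp
    qed
    ultimately show ?thesis by (simp add: saw_def)
  qed
  moreover have "\<bar>Im (Ln (1 - z))\<bar> < pi / 2"
  proof -
    have "Re z < 1" using complex_Re_le_cmod[of z] z r01 by simp
    then have "0 < Re (1 - z)" by simp
    moreover from this have "1 - z \<noteq> 0" by auto
    ultimately show ?thesis using Re_Ln_pos_lt by blast
  qed
  ultimately show ?thesis
    using abs_Im_le_cmod[of "suminf (\<lambda>k. f (k + (M + 1)))"] tail pi_less_4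
    by (smt (verit) field_sum_of_halves minus_complex.sel(2) plus_complex.sel(2) uminus_complex.sel(2))
qed

lemma hk_sin:
  assumes r: "0 < r" "r < 1"
  shows "integral {0..2*pi} (\<lambda>y. sin (real k * y) * hk r y) = (if k = 0 then 0 else pi * r ^ k)"
proof -
  have "integral {0..2*pi} (\<lambda>y. sin (real k * y) * hk r y)
      = integral {0..2*pi} (Im \<circ> (\<lambda>y. cis (y * of_int (int k)) * complex_of_real (hk r y)))"
    by (simp add: o_def mult.commute)
  also have "\<dots> = Im (integral {0..2*pi} (\<lambda>y. cis (y * of_int (int k)) * complex_of_real (hk r y)))"
    by (rule integral_linear[OF _ bounded_linear_Im])
      (intro integrable_continuous_real continuous_intros hk_cont[OF r])
  also have "\<dots> = (if k = 0 then 0 else pi * r ^ k)"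
    unfolding hk_fourier[OF r]
    by (simp add: sgn_if del: of_real_power flip: of_real_power of_real_mult)
  finally show ?thesis .
qed

text \<open>By orthogonality the pairing is the sum of pi r^(2k) / k, comparable to a harmonic sum
  as long as r^k stays away from 0.\<close>

lemma hk_saw_lower:
  assumes M: "M \<ge> 1" and r: "r = real M / (real M + 1)"
  shows "2 / 5 * ln (real M + 1) \<le> integral {0..2*pi} (\<lambda>y. saw M r y * hk r y)"
proof -
  have r01: "0 < r" "r < 1" using M by (auto simp: r divide_simps)
  have "integral {0..2*pi} (\<lambda>y. saw M r y * hk r y)
      = integral {0..2*pi} (\<lambda>y. \<Sum>k=1..M. r ^ k / real k * (sin (real k * y) * hk r y))"
    by (simp add: saw_def sum_distrib_right mult.assoc)
  also have "\<dots> = (\<Sum>k=1..M. r ^ k / real k * integral {0..2*pi} (\<lambda>y. sin (real k * y) * hk r y))"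
    by (subst integral_sum) (auto intro!: integrable_continuous_real continuous_intros hk_cont[OF r01])
  also have "\<dots> = (\<Sum>k=1..M. pi * (r ^ k * r ^ k) / real k)"
    by (rule sum.cong) (auto simp: hk_sin[OF r01])
  also have "\<dots> \<ge> (\<Sum>k=1..M. 2 / 5 * inverse (real k))"
  proof (rule sum_mono)
    fix k assume k: "k \<in> {1..M}"
    \<comment> \<open>The second role of r = M / (M + 1): the reciprocal of \<open>r ^ M\<close> is
      (1 + 1/M)^M, at most e. Then pi / e^2 exceeds 2/5.\<close>
    have rM: "exp (- 1) \<le> r ^ M"
    proof -
      have "(1 + 1 / real M) ^ M \<le> exp (1 / real M) ^ M"
        by (intro power_mono exp_ge_add_one_self) (use M in auto)
      also have "\<dots> = exp 1" using M by (simp add: exp_of_nat_mult[symmetric])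
      finally have "inverse (exp 1) \<le> inverse ((1 + 1 / real M) ^ M)"
        using M by (intro le_imp_inverse_le) (auto intro!: zero_less_power add_pos_pos)
      also have "\<dots> = r ^ M" using M by (simp add: r power_inverse[symmetric] field_simps)
      finally show ?thesis by (simp add: exp_minus)
    qed
    have rk: "exp (- 1) \<le> r ^ k"
      by (rule order_trans[OF rM power_decreasing]) (use k r01 in auto)
    have e1: "inverse 2.72 \<le> exp (- 1 :: real)"
      unfolding exp_minus by (rule le_imp_inverse_le) (use e_less_272 in auto)
    have p: "3.14 \<le> pi" using pi_approx by simp
    have "2 / 5 \<le> 3.14 * (inverse 2.72 * inverse (2.72 :: real))" by simp
    also have "\<dots> \<le> pi * (exp (- 1) * exp (- 1))"
      by (rule mult_mono[OF p mult_mono[OF e1 e1]]) simp_all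
    also have "\<dots> \<le> pi * (r ^ k * r ^ k)"
      using rk by (intro mult_left_mono mult_mono) (auto intro: order_trans[of 0 "exp (- 1)"])
    finally have "2 / 5 * inverse (real k) \<le> pi * (r ^ k * r ^ k) * inverse (real k)"
      by (rule mult_right_mono) simp
    then show "2 / 5 * inverse (real k) \<le> pi * (r ^ k * r ^ k) / real k" by (simp only: divide_inverse)
  qed
  also have "(\<Sum>k=1..M. 2 / 5 * inverse (real k)) = 2 / 5 * harm M"
    by (simp add: harm_def sum_distrib_left)
  finally have "2 / 5 * harm M \<le> integral {0..2*pi} (\<lambda>y. saw M r y * hk r y)" by simp
  moreover have "ln (real M + 1) \<le> harm M" by (rule ln_le_harm)
  ultimately show ?thesis by linarith
qed

lemma integral_odd_periodic:
  fixes f :: "real \<Rightarrow> real"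
  assumes c: "continuous_on UNIV f" and p: "periodic_2pi f" and o: "\<And>x. f (- x) = - f x"
  shows "integral {0..2*pi} f = 0"
proof -
  note A = antider_deriv[OF c]
  have "((\<lambda>x. antider f x - antider f (- x)) has_real_derivative 0) (at x)" for x
  proof -
    have "((\<lambda>x. antider f (- x)) has_real_derivative f (- x) * (- 1)) (at x)"
      by (rule DERIV_chain2[OF A]) (auto intro!: derivative_eq_intros)
    from DERIV_diff[OF A[of x] this] show ?thesis by (simp add: o)
  qed
  from DERIV_isconst_all[OF allI[OF this], of pi 0] have even: "antider f pi = antider f (- pi)" by simp
  have "((\<lambda>s. f (- pi + s)) has_integral antider f (- pi + 2 * pi) - antider f (- pi + 0)) {0..2*pi}"
    by (rule ftc_real, simp, rule DERIV_shift_arg[OF A])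
  then have "integral {0..2*pi} (\<lambda>s. f (- pi + s)) = 0" using even by (simp add: integral_unique)
  then show ?thesis using integral_periodic[OF c p, of "- pi"] by simp
qed

lemma oscillatory_integral_bound:
  fixes g :: "real \<Rightarrow> real"
  assumes g: "\<And>x. (g has_real_derivative g' x) (at x)" and c: "continuous_on UNIV g'"
    and B: "\<And>x. \<bar>g' x\<bar> \<le> B" and k: "k \<ge> (1::nat)"
  shows "\<bar>integral {0..2*pi} (\<lambda>x. cos (2 * real k * x) * g x)\<bar> \<le> pi * B / real k"
proof -
  have cg: "continuous_on X g" for X by (rule DERIV_continuous[OF g])
  have cg': "continuous_on X g'" for X using c continuous_on_subset by blast
  have d: "((\<lambda>x. sin (2 * real k * x) / (2 * real k)) has_real_derivative cos (2 * real k * x)) (at x)" for x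
    using k by (auto intro!: derivative_eq_intros)
  have "((\<lambda>x. cos (2 * real k * x) * g x + sin (2 * real k * x) / (2 * real k) * g' x) has_integral
      sin (2 * real k * (2 * pi)) / (2 * real k) * g (2 * pi) - sin (2 * real k * 0) / (2 * real k) * g 0) {0..2*pi}"
    by (rule ftc_real, simp, rule DERIV_cong[OF DERIV_mult[OF d g]]) (simp add: mult.commute)
  moreover have "sin (2 * real k * (2 * pi)) = 0"
    using periodic_sin_cos(1)[of "2 * k" 0] by simp
  ultimately have "integral {0..2*pi} (\<lambda>x. cos (2 * real k * x) * g x + sin (2 * real k * x) / (2 * real k) * g' x) = 0"
    by (simp add: integral_unique)
  moreover have "integral {0..2*pi} (\<lambda>x. cos (2 * real k * x) * g x + sin (2 * real k * x) / (2 * real k) * g' x)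
    = integral {0..2*pi} (\<lambda>x. cos (2 * real k * x) * g x) + integral {0..2*pi} (\<lambda>x. sin (2 * real k * x) / (2 * real k) * g' x)"
    by (rule integral_add) (use k in \<open>auto intro!: integrable_continuous_real continuous_intros cg cg'\<close>)
  ultimately have eq: "integral {0..2*pi} (\<lambda>x. cos (2 * real k * x) * g x) = - integral {0..2*pi} (\<lambda>x. sin (2 * real k * x) / (2 * real k) * g' x)"
    by simp
  have "norm (integral {0..2*pi} (\<lambda>x. sin (2 * real k * x) / (2 * real k) * g' x)) \<le> 1 / (2 * real k) * B * (2 * pi - 0)"
  proof (rule integral_bound)
    fix x
    have "\<bar>sin (2 * real k * x)\<bar> / (2 * real k) * \<bar>g' x\<bar> \<le> 1 / (2 * real k) * B"
      using k B[of x] by (intro mult_mono divide_right_mono) auto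
    then show "norm (sin (2 * real k * x) / (2 * real k) * g' x) \<le> 1 / (2 * real k) * B"
      by (simp add: abs_mult)
  qed (use k in \<open>auto intro!: continuous_intros cg'\<close>)
  then show ?thesis unfolding eq by (simp add: mult.commute)
qed

lemma hk_odd: "hk r (- y) = - hk r y"
  by (simp add: hk_def Qr_def)

text \<open>The constant 3 provides the cross term \<open>6 * saw\<close> in the squared amplitude;
  \<open>saw\<^sup>2\<close> alone is even and pairs to zero with the odd kernel. The factor 1 / L
  makes the slope of size \<epsilon>.\<close>

definition datum :: "real \<Rightarrow> nat \<Rightarrow> nat \<Rightarrow> real \<Rightarrow> real \<Rightarrow> real" where
  "datum \<epsilon> L M r x = \<epsilon> / real L * (sin (real L * x) * (3 + saw M r x))"

definition datum' :: "real \<Rightarrow> nat \<Rightarrow> nat \<Rightarrow> real \<Rightarrow> real \<Rightarrow> real" where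
  "datum' \<epsilon> L M r x = \<epsilon> * (cos (real L * x) * (3 + saw M r x)) + \<epsilon> / real L * (sin (real L * x) * saw' M r x)"

lemma datum_deriv: "L \<ge> 1 \<Longrightarrow> (datum \<epsilon> L M r has_real_derivative datum' \<epsilon> L M r x) (at x)"
  unfolding datum_def[abs_def] datum'_def
  by (auto intro!: derivative_eq_intros saw_deriv simp: field_simps)

lemma reg_sin_cos: "reg k S (\<lambda>_ x. sin (a * x)) \<and> reg k S (\<lambda>_ x. cos (a * x))"
proof (induct k)
  case 0
  show ?case unfolding reg.simps jcont_def case_prod_unfold by (intro conjI continuous_intros)
next
  case (Suc k)
  have j: "jcont S (\<lambda>_ x. sin (a * x))" "jcont S (\<lambda>_ x. cos (a * x))"
    unfolding jcont_def case_prod_unfold by (intro continuous_intros)+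
  have c: "reg k S (\<lambda>_ x. a * cos (a * x))" and s: "reg k S (\<lambda>_ x. - a * sin (a * x))"
    by (intro reg_cmult; use Suc in simp)+
  show ?case
    by (intro conjI reg_SucI[OF c _ j(1)] reg_SucI[OF s _ j(2)]) (auto intro!: derivative_eq_intros)
qed

lemma reg_sum: "finite I \<Longrightarrow> (\<And>i. i \<in> I \<Longrightarrow> reg k S (f i)) \<Longrightarrow> reg k S (\<lambda>t x. \<Sum>i\<in>I. f i t x)"
  by (induct I rule: finite_induct) (auto intro: reg_const reg_add)

lemma datum_H_inf: "H_inf (datum \<epsilon> L M r)"
proof -
  have "reg k {0} (\<lambda>_. datum \<epsilon> L M r)" for k
    unfolding datum_def saw_def
    by (intro reg_cmult reg_mult reg_add reg_sum reg_const conjunct1[OF reg_sin_cos]) auto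
  from reg_all_smooth(1)[OF this, of 0] have "smooth_fun (datum \<epsilon> L M r)" by simp
  moreover have "periodic_2pi (datum \<epsilon> L M r)"
    using saw_periodic[of M r] by (simp add: periodic_2pi_def datum_def periodic_sin_cos)
  ultimately show ?thesis by (simp add: H_inf_def)
qed

text \<open>The squared cosine averages to 1/2, and half of 6 * 2/5 gives 6/5. The oscillating
  remainder and all terms with \<open>saw'\<close> are O(1 / L) with a constant depending on M, so L
  has to be chosen after M.\<close>

lemma datum_energy:
  assumes M: "M \<ge> 1" and r: "r = real M / (real M + 1)"
  shows "\<exists>C. \<forall>\<epsilon> L. L \<ge> 1 \<longrightarrow>
    \<epsilon>\<^sup>2 * (6 / 5 * ln (real M + 1) - C / real L) \<le> integral {0..2*pi} (\<lambda>x. (datum' \<epsilon> L M r x)\<^sup>2 * hk r x)"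
proof -
  have r01: "0 < r" "r < 1" using M by (auto simp: r divide_simps)
  let ?s = "saw M r" and ?s' = "saw' M r"
  have cs: "continuous_on X ?s" "continuous_on X ?s'" for X
    using DERIV_continuous[OF saw_deriv] unfolding saw'_def by (auto intro!: continuous_intros)
  note ck = hk_cont[OF r01] and ck' = hk'_cont[OF r01]
  define g where "g x = (3 + ?s x)\<^sup>2 * hk r x" for x
  define g' where "g' x = 2 * (3 + ?s x) * ?s' x * hk r x + (3 + ?s x)\<^sup>2 * hk' r x" for x
  have g: "(g has_real_derivative g' x) (at x)" for x
    unfolding g_def[abs_def] g'_def by (auto intro!: derivative_eq_intros saw_deriv hk_deriv[OF r01])
  have cg': "continuous_on X g'" for X unfolding g'_def by (intro continuous_intros cs ck ck')
  have cg: "continuous_on X g" for X unfolding g_def by (intro continuous_intros cs ck)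
  have ps': "periodic_2pi ?s'" unfolding periodic_2pi_def saw'_def periodic_sin_cos by simp
  have "periodic_2pi g'"
    using saw_periodic[of M r] ps' hk_periodic[OF r01] by (simp add: periodic_2pi_def g'_def)
  then obtain B where B: "\<And>x. \<bar>g' x\<bar> \<le> B" using periodic_bounded[OF cg'] by blast
  obtain K where K: "K > 0" "\<And>x. \<bar>hk r x\<bar> \<le> K" using periodic_bounded[OF ck hk_periodic(1)[OF r01]] by blast
  have g_low: "12 / 5 * ln (real M + 1) \<le> integral {0..2*pi} g"
  proof -
    \<comment> \<open>Oddness of the kernel removes \<open>9 + saw\<^sup>2\<close>, leaving the
      cross term only.\<close>
    have "integral {0..2*pi} (\<lambda>x. (9 + (?s x)\<^sup>2) * hk r x) = 0"
      by (rule integral_odd_periodic)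
        (use saw_periodic[of M r] hk_periodic[OF r01] in \<open>auto simp: periodic_2pi_def saw_odd hk_odd intro!: continuous_intros cs ck\<close>)
    moreover have "integral {0..2*pi} g = integral {0..2*pi} (\<lambda>x. (9 + (?s x)\<^sup>2) * hk r x + 6 * (?s x * hk r x))"
      by (rule integral_cong) (simp add: g_def power2_eq_square algebra_simps)
    moreover have "\<dots> = integral {0..2*pi} (\<lambda>x. (9 + (?s x)\<^sup>2) * hk r x) + integral {0..2*pi} (\<lambda>x. 6 * (?s x * hk r x))"
      by (rule integral_add) (intro integrable_continuous_real continuous_intros cs ck)+
    ultimately show ?thesis using hk_saw_lower[OF M r] by simp
  qed
  \<comment> \<open>The first part is the integration by parts of the oscillating term; the second
    bounds \<open>R\<close>, using that the amplitude is at most 6 and \<open>saw'\<close> at most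
    M.\<close>
  define C where "C = pi * B / 2 + (12 * real M + (real M)\<^sup>2) * K * (2 * pi)"
  show ?thesis
  proof (intro exI[of _ C] allI impI)
    fix \<epsilon> :: real and L :: nat assume L: "L \<ge> 1"
    let ?c = "\<lambda>x. cos (real L * x)" and ?d = "\<lambda>x. sin (real L * x)"
    define R where "R x = (2 * ?c x * ?d x * (3 + ?s x) * ?s' x / real L + (?d x * ?s' x)\<^sup>2 / (real L)\<^sup>2) * hk r x" for x
    have cR: "continuous_on X R" for X unfolding R_def using L by (intro continuous_intros cs ck) auto
    have "integral {0..2*pi} (\<lambda>x. (datum' \<epsilon> L M r x)\<^sup>2 * hk r x)
        = integral {0..2*pi} (\<lambda>x. \<epsilon>\<^sup>2 * (1 / 2 * g x + 1 / 2 * (cos (2 * real L * x) * g x) + R x))"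
    proof (rule integral_cong)
      fix x
      have "cos (2 * real L * x) = 2 * (?c x)\<^sup>2 - 1" using cos_double_cos[of "real L * x"] by (simp add: mult.assoc)
      then have c2: "1 / 2 * g x + 1 / 2 * (cos (2 * real L * x) * g x) = (?c x)\<^sup>2 * g x"
        by (simp only:) (simp add: algebra_simps)
      have "datum' \<epsilon> L M r x = \<epsilon> * (?c x * (3 + ?s x) + ?d x * ?s' x / real L)"
        by (simp add: datum'_def algebra_simps)
      then have "(datum' \<epsilon> L M r x)\<^sup>2 * hk r x = \<epsilon>\<^sup>2 * ((?c x * (3 + ?s x) + ?d x * ?s' x / real L)\<^sup>2 * hk r x)"
        by (simp add: power_mult_distrib)
      also have "(?c x * (3 + ?s x) + ?d x * ?s' x / real L)\<^sup>2 * hk r x = (?c x)\<^sup>2 * g x + R x"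
      proof -
        have "(c * h + d * s / l)\<^sup>2 * k = c\<^sup>2 * (h\<^sup>2 * k) + (2 * c * d * h * s / l + (d * s)\<^sup>2 / l\<^sup>2) * k"
          for c h d s l k :: real
          by (simp add: power2_sum power_mult_distrib power_divide algebra_simps)
        then show ?thesis unfolding g_def R_def .
      qed
      finally show "(datum' \<epsilon> L M r x)\<^sup>2 * hk r x = \<epsilon>\<^sup>2 * (1 / 2 * g x + 1 / 2 * (cos (2 * real L * x) * g x) + R x)"
        using c2 by simp
    qed
    also have "\<dots> = \<epsilon>\<^sup>2 * (1 / 2 * integral {0..2*pi} g + 1 / 2 * integral {0..2*pi} (\<lambda>x. cos (2 * real L * x) * g x) + integral {0..2*pi} R)"
      by (simp, subst integral_add, (intro integrable_continuous_real continuous_intros cg cR; simp)+,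
          subst integral_add) (auto intro!: integrable_continuous_real continuous_intros cg)
    also have "\<dots> \<ge> \<epsilon>\<^sup>2 * (6 / 5 * ln (real M + 1) - C / real L)"
    proof (rule mult_left_mono)
      have 1: "\<bar>integral {0..2*pi} (\<lambda>x. cos (2 * real L * x) * g x)\<bar> \<le> pi * B / real L"
        by (rule oscillatory_integral_bound[OF g cg' B L])
      have 2: "norm (integral {0..2*pi} R) \<le> (12 * real M + (real M)\<^sup>2) / real L * K * (2 * pi - 0)"
      proof (rule integral_bound)
        fix x
        have s: "\<bar>3 + ?s x\<bar> \<le> 6" using saw_bound[OF M r, of x] by linarith
        have s': "\<bar>?s' x\<bar> \<le> M" using saw'_bound[of r M x] r01 by simp
        have "\<bar>2 * ?c x * ?d x * (3 + ?s x) * ?s' x\<bar> \<le> 2 * 1 * 1 * 6 * real M"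
          unfolding abs_mult by (intro mult_mono s s') auto
        then have a: "\<bar>2 * ?c x * ?d x * (3 + ?s x) * ?s' x / real L\<bar> \<le> 12 * real M / real L"
          using L by (simp add: abs_divide divide_right_mono)
        have "\<bar>?d x * ?s' x\<bar> \<le> 1 * real M" unfolding abs_mult by (intro mult_mono s') auto
        then have "(?d x * ?s' x)\<^sup>2 \<le> (real M)\<^sup>2" by (intro abs_le_square_iff[THEN iffD1]) simp
        then have "(?d x * ?s' x)\<^sup>2 / (real L)\<^sup>2 \<le> (real M)\<^sup>2 / (real L)\<^sup>2" by (rule divide_right_mono) simp
        also have "\<dots> \<le> (real M)\<^sup>2 / real L"
          using L by (intro divide_left_mono) (auto simp: power2_eq_square)
        finally have b: "\<bar>(?d x * ?s' x)\<^sup>2 / (real L)\<^sup>2\<bar> \<le> (real M)\<^sup>2 / real L" by simp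
        have "\<bar>2 * ?c x * ?d x * (3 + ?s x) * ?s' x / real L + (?d x * ?s' x)\<^sup>2 / (real L)\<^sup>2\<bar> \<le> (12 * real M + (real M)\<^sup>2) / real L"
          using abs_triangle_ineq[of "2 * ?c x * ?d x * (3 + ?s x) * ?s' x / real L" "(?d x * ?s' x)\<^sup>2 / (real L)\<^sup>2"] a b
          by (simp add: add_divide_distrib)
        then show "norm (R x) \<le> (12 * real M + (real M)\<^sup>2) / real L * K"
          unfolding R_def real_norm_def abs_mult[of _ "hk r x"] by (intro mult_mono K) auto
      qed (auto intro!: cR)
      have "C / real L = 1 / 2 * (pi * B / real L) + (12 * real M + (real M)\<^sup>2) / real L * K * (2 * pi - 0)"
        using L by (simp add: C_def field_simps)
      then show "6 / 5 * ln (real M + 1) - C / real L \<le> 1 / 2 * integral {0..2*pi} g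
          + 1 / 2 * integral {0..2*pi} (\<lambda>x. cos (2 * real L * x) * g x) + integral {0..2*pi} R"
      proof -
        have "6 / 5 * l - c \<le> 1 / 2 * i1 + 1 / 2 * i2 + i3"
          if "c = 1 / 2 * e1 + e2" "\<bar>i2\<bar> \<le> e1" "\<bar>i3\<bar> \<le> e2" "12 / 5 * l \<le> i1" for c e1 e2 i1 i2 i3 l :: real
          using that by linarith
        from this[OF \<open>C / real L = _\<close> 1 2[unfolded real_norm_def] g_low] show ?thesis .
      qed
    qed simp
    finally show "\<epsilon>\<^sup>2 * (6 / 5 * ln (real M + 1) - C / real L) \<le> integral {0..2*pi} (\<lambda>x. (datum' \<epsilon> L M r x)\<^sup>2 * hk r x)" .
  qed
qed

section \<open>Spectrum, size and Besov norm of the datum\<close>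

lemma fourier_coeff_cmult: "fourier_coeff (\<lambda>x. c * f x) \<xi> = complex_of_real c * fourier_coeff f \<xi>"
proof -
  have "fourier_coeff (\<lambda>x. c * f x) \<xi> = integral {0..2*pi} (\<lambda>x. complex_of_real c * (cis (- x * of_int \<xi>) * complex_of_real (f x)))"
    unfolding fourier_coeff_def by (rule integral_cong) simp
  then show ?thesis unfolding fourier_coeff_def by simp
qed

lemma fourier_coeff_add:
  assumes "continuous_on UNIV f" "continuous_on UNIV g"
  shows "fourier_coeff (\<lambda>x. f x + g x) \<xi> = fourier_coeff f \<xi> + fourier_coeff g \<xi>"
proof -
  have "fourier_coeff (\<lambda>x. f x + g x) \<xi> = integral {0..2*pi} (\<lambda>x. cis (- x * of_int \<xi>) * complex_of_real (f x)
      + cis (- x * of_int \<xi>) * complex_of_real (g x))"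
    unfolding fourier_coeff_def by (rule integral_cong) (simp add: distrib_left)
  also have "\<dots> = fourier_coeff f \<xi> + fourier_coeff g \<xi>"
    unfolding fourier_coeff_def
    by (rule integral_add)
      (intro integrable_continuous_real continuous_intros continuous_on_subset[OF assms(1)] continuous_on_subset[OF assms(2)]; simp)+
  finally show ?thesis .
qed

lemma fourier_coeff_sum_zero:
  assumes "finite I" "\<And>i. i \<in> I \<Longrightarrow> continuous_on UNIV (f i)" "\<And>i. i \<in> I \<Longrightarrow> fourier_coeff (f i) \<xi> = 0"
  shows "fourier_coeff (\<lambda>x. \<Sum>i\<in>I. f i x) \<xi> = 0"
  using assms
proof (induct I rule: finite_induct)
  case empty
  then show ?case by (simp add: fourier_coeff_def)
next
  case (insert i I)
  have "fourier_coeff (\<lambda>x. f i x + (\<Sum>i\<in>I. f i x)) \<xi> = fourier_coeff (f i) \<xi> + fourier_coeff (\<lambda>x. \<Sum>i\<in>I. f i x) \<xi>"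
    by (rule fourier_coeff_add) (use insert in \<open>auto intro!: continuous_intros\<close>)
  with insert show ?case by simp
qed

lemma fourier_coeff_sin_cos:
  assumes "\<bar>\<xi>\<bar> \<noteq> int m"
  shows "fourier_coeff (\<lambda>x. cos (real m * x)) \<xi> = 0" "fourier_coeff (\<lambda>x. sin (real m * x)) \<xi> = 0"
proof -
  have z: "integral {0..2*pi} (\<lambda>x. cis (x * of_int (int m - \<xi>))) = 0" "integral {0..2*pi} (\<lambda>x. cis (x * of_int (- int m - \<xi>))) = 0"
    using assms unfolding integral_cis by auto
  have i: "(\<lambda>x. cis (x * of_int j)) integrable_on {0..2*pi}" for j :: int
    by (intro integrable_continuous_real continuous_intros)
  have p: "cis (- x * of_int \<xi>) * cis (real m * x) = cis (x * of_int (int m - \<xi>))"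
    "cis (- x * of_int \<xi>) * cis (- (real m * x)) = cis (x * of_int (- int m - \<xi>))" for x
    unfolding cis_mult by (rule arg_cong[of _ _ cis], simp add: algebra_simps)+
  have "complex_of_real (cos (real m * x)) = (cis (real m * x) + cis (- (real m * x))) / 2" for x
    by (simp add: complex_eq_iff)
  then have "fourier_coeff (\<lambda>x. cos (real m * x)) \<xi> = integral {0..2*pi} (\<lambda>x. (cis (x * of_int (int m - \<xi>)) + cis (x * of_int (- int m - \<xi>))) / 2)"
    unfolding fourier_coeff_def by (simp only: times_divide_eq_right distrib_left p)
  also have "\<dots> = 0" using integral_add[OF i[of "int m - \<xi>"] i[of "- int m - \<xi>"]] z by simp
  finally show "fourier_coeff (\<lambda>x. cos (real m * x)) \<xi> = 0" .
  have "complex_of_real (sin (real m * x)) = (cis (real m * x) - cis (- (real m * x))) / (2 * \<i>)" for x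
    by (simp add: complex_eq_iff Re_divide Im_divide)
  then have "fourier_coeff (\<lambda>x. sin (real m * x)) \<xi> = integral {0..2*pi} (\<lambda>x. (cis (x * of_int (int m - \<xi>)) - cis (x * of_int (- int m - \<xi>))) / (2 * \<i>))"
    unfolding fourier_coeff_def by (simp only: times_divide_eq_right right_diff_distrib p)
  also have "\<dots> = 0" using integral_diff[OF i[of "int m - \<xi>"] i[of "- int m - \<xi>"]] z by simp
  finally show "fourier_coeff (\<lambda>x. sin (real m * x)) \<xi> = 0" .
qed

text \<open>Products of sin(Lx) with sin(kx) split into cosines of frequencies L - k and L + k with
  k at most M.\<close>

lemma datum_spectrum:
  assumes "M \<le> L" "\<not> (int (L - M) \<le> \<bar>\<xi>\<bar> \<and> \<bar>\<xi>\<bar> \<le> int (L + M))"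
  shows "fourier_coeff (datum \<epsilon> L M r) \<xi> = 0"
proof -
  have prod: "sin (real L * x) * (r ^ k / real k * sin (real k * x))
      = r ^ k / real k / 2 * (cos (real (L - k) * x) + (- 1) * cos (real (L + k) * x))" if "k \<in> {1..M}" for k x
  proof -
    have "real (L - k) * x = real L * x - real k * x" "real (L + k) * x = real L * x + real k * x"
      using that assms(1) by (simp_all add: of_nat_diff algebra_simps)
    then show ?thesis by (simp add: cos_diff cos_add)
  qed
  have "datum \<epsilon> L M r = (\<lambda>x. \<epsilon> / real L * (3 * sin (real L * x) + (\<Sum>k=1..M. r ^ k / real k / 2 * (cos (real (L - k) * x) + (- 1) * cos (real (L + k) * x)))))"
  proof
    fix x
    have "sin (real L * x) * saw M r x = (\<Sum>k=1..M. r ^ k / real k / 2 * (cos (real (L - k) * x) + (- 1) * cos (real (L + k) * x)))"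
      unfolding saw_def sum_distrib_left by (rule sum.cong[OF refl prod])
    then show "datum \<epsilon> L M r x = \<epsilon> / real L * (3 * sin (real L * x) + (\<Sum>k=1..M. r ^ k / real k / 2 * (cos (real (L - k) * x) + (- 1) * cos (real (L + k) * x))))"
      by (simp add: datum_def distrib_left mult.commute)
  qed
  moreover have "fourier_coeff (\<lambda>x. 3 * sin (real L * x)) \<xi> = 0"
    unfolding fourier_coeff_cmult by (subst fourier_coeff_sin_cos(2)) (use assms in auto)
  moreover have "fourier_coeff (\<lambda>x. \<Sum>k=1..M. r ^ k / real k / 2 * (cos (real (L - k) * x) + (- 1) * cos (real (L + k) * x))) \<xi> = 0"
  proof (rule fourier_coeff_sum_zero)
    fix k assume k: "k \<in> {1..M}"
    have "\<bar>\<xi>\<bar> \<noteq> int (L - k)" "\<bar>\<xi>\<bar> \<noteq> int (L + k)" using assms k by auto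
    then have "fourier_coeff (\<lambda>x. cos (real (L - k) * x)) \<xi> = 0" "fourier_coeff (\<lambda>x. cos (real (L + k) * x)) \<xi> = 0"
      by (simp_all only: fourier_coeff_sin_cos not_False_eq_True)
    then show "fourier_coeff (\<lambda>x. r ^ k / real k / 2 * (cos (real (L - k) * x) + (- 1) * cos (real (L + k) * x))) \<xi> = 0"
      unfolding fourier_coeff_cmult
      by (subst fourier_coeff_add) (simp_all only: fourier_coeff_cmult, auto intro!: continuous_intros)
  qed (auto intro!: continuous_intros)
  ultimately show ?thesis
    by (simp only: fourier_coeff_cmult, subst fourier_coeff_add) (auto intro!: continuous_intros)
qed

lemma datum_bound:
  assumes M: "M \<ge> 1" and r: "r = real M / (real M + 1)" and L: "L \<ge> 1" and \<epsilon>: "0 \<le> \<epsilon>"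
  shows "\<bar>datum \<epsilon> L M r x\<bar> \<le> 6 * \<epsilon> / real L"
proof -
  have "\<bar>sin (real L * x)\<bar> * \<bar>3 + saw M r x\<bar> \<le> 1 * 6"
    using saw_bound[OF M r, of x] by (intro mult_mono) auto
  then have "\<epsilon> / real L * (\<bar>sin (real L * x)\<bar> * \<bar>3 + saw M r x\<bar>) \<le> \<epsilon> / real L * 6"
    using \<epsilon> by (intro mult_left_mono) auto
  then show ?thesis using \<epsilon> by (simp add: datum_def abs_mult mult.commute)
qed

text \<open>6 comes from the amplitude \<open>3 + saw\<close> and 1 from \<open>saw' / L\<close>,
  which needs L at least M.\<close>

lemma datum'_bound:
  assumes M: "M \<ge> 1" and r: "r = real M / (real M + 1)" and L: "L \<ge> M" and \<epsilon>: "0 \<le> \<epsilon>"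
  shows "\<bar>datum' \<epsilon> L M r x\<bar> \<le> 7 * \<epsilon>"
proof -
  have r01: "0 \<le> r" "r \<le> 1" using M by (auto simp: r divide_simps)
  have "\<bar>cos (real L * x)\<bar> * \<bar>3 + saw M r x\<bar> \<le> 1 * 6"
    using saw_bound[OF M r, of x] by (intro mult_mono) auto
  then have a: "\<bar>\<epsilon> * (cos (real L * x) * (3 + saw M r x))\<bar> \<le> \<epsilon> * 6"
    using \<epsilon> unfolding abs_mult by (intro mult_mono) auto
  have "\<bar>sin (real L * x)\<bar> * \<bar>saw' M r x\<bar> \<le> 1 * real M"
    using saw'_bound[OF r01, of M x] by (intro mult_mono) auto
  also have "\<dots> \<le> real L" using L by simp
  finally have "\<epsilon> / real L * (\<bar>sin (real L * x)\<bar> * \<bar>saw' M r x\<bar>) \<le> \<epsilon> / real L * real L"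
    using \<epsilon> by (intro mult_left_mono) auto
  then have b: "\<bar>\<epsilon> / real L * (sin (real L * x) * saw' M r x)\<bar> \<le> \<epsilon>"
    using \<epsilon> L M by (simp add: abs_mult)
  show ?thesis unfolding datum'_def using abs_triangle_ineq[of "\<epsilon> * (cos (real L * x) * (3 + saw M r x))" "\<epsilon> / real L * (sin (real L * x) * saw' M r x)"] a b
    by linarith
qed

text \<open>\<open>45 / 32\<close> lies in \<open>(4/3, 3/2)\<close>, where \<open>\<phi> = 1\<close>: with \<open>L = 45 * 2^p\<close> the datum is its own
  dyadic block.\<close>

lemma datum_besov:
  assumes chi: "LP_cutoff chi" and M: "M \<ge> 1" and r: "r = real M / (real M + 1)" and Mp: "M \<le> 2 ^ p" and \<epsilon>: "0 \<le> \<epsilon>"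
  shows "besov_1_inf_1 chi (datum \<epsilon> (45 * 2 ^ p) M r) \<le> ennreal (5 * \<epsilon>)"
proof -
  define L :: nat where "L = 45 * 2 ^ p"
  have L: "L \<ge> 1" by (simp add: L_def)
  have MleL: "M \<le> L" using Mp by (simp add: L_def)
  let ?v = "datum \<epsilon> L M r"
  \<comment> \<open>The margin for the cutoff: 44/32 is above 4/3 and 46/64 is below 3/4, so on the
    spectrum \<open>chi (\<xi> / 2 ^ J)\<close> jumps from 0 to 1 between J = p + 5 and p +
    6.\<close>
  have band: "44 * 2 ^ p \<le> \<bar>real_of_int \<xi>\<bar> \<and> \<bar>real_of_int \<xi>\<bar> \<le> 46 * 2 ^ p" if "fourier_coeff ?v \<xi> \<noteq> 0" for \<xi>
  proof -
    have "int (L - M) \<le> \<bar>\<xi>\<bar>" "\<bar>\<xi>\<bar> \<le> int (L + M)" using datum_spectrum[OF MleL] that by blast+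
    then have "real (L - M) \<le> \<bar>real_of_int \<xi>\<bar>" "\<bar>real_of_int \<xi>\<bar> \<le> real (L + M)"
      by linarith+
    moreover have "real M \<le> 2 ^ p" using Mp by (metis of_nat_le_iff of_nat_numeral of_nat_power)
    moreover have "real (L - M) = 45 * 2 ^ p - real M" "real (L + M) = 45 * 2 ^ p + real M"
      using MleL by (simp_all add: L_def of_nat_diff)
    ultimately show ?thesis by linarith
  qed
  have chiJ: "chi (\<xi> / 2 ^ J) = (if J \<le> p + 5 then 0 else 1)" if "fourier_coeff ?v \<xi> \<noteq> 0" for \<xi> J
  proof (cases "J \<le> p + 5")
    case True
    have "(2::real) ^ J \<le> 2 ^ (p + 5)" by (rule power_increasing) (use True in auto)
    then have "44 / 32 * 2 ^ J \<le> \<bar>real_of_int \<xi>\<bar>" using band[OF that] by (simp add: power_add)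
    moreover have "4 / 3 * 2 ^ J < 44 / 32 * (2::real) ^ J" by simp
    ultimately have "4 / 3 * 2 ^ J < \<bar>real_of_int \<xi>\<bar>" by linarith
    then have "4 / 3 < \<bar>\<xi> / 2 ^ J\<bar>" by (simp add: abs_divide pos_less_divide_eq)
    then show ?thesis using True by (simp only: chi_0[OF chi] if_True)
  next
    case False
    have "(2::real) ^ (p + 6) \<le> 2 ^ J" by (rule power_increasing) (use False in auto)
    then have "\<bar>real_of_int \<xi>\<bar> \<le> 46 / 64 * 2 ^ J" using band[OF that] by (simp add: power_add)
    moreover have "46 / 64 * 2 ^ J \<le> 3 / 4 * (2::real) ^ J" by simp
    ultimately have "\<bar>real_of_int \<xi>\<bar> \<le> 3 / 4 * 2 ^ J" by linarith
    then have "\<bar>\<xi> / 2 ^ J\<bar> \<le> 3 / 4" by (simp add: abs_divide pos_divide_le_eq)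
    then show ?thesis using False by (simp only: chi_1[OF chi] if_False)
  qed
  have mult: "block_mult chi k \<xi> = (if k = p + 6 then 1 else 0)" if "fourier_coeff ?v \<xi> \<noteq> 0" for k \<xi>
  proof (cases k)
    case 0
    then show ?thesis using block_mult_sum[of chi \<xi> 0] chiJ[OF that, of 0] by simp
  next
    case (Suc J)
    have "block_mult chi (Suc J) \<xi> = chi (\<xi> / 2 ^ Suc J) - chi (\<xi> / 2 ^ J)"
      unfolding block_mult_sum[symmetric] by simp
    then show ?thesis unfolding Suc chiJ[OF that] by (auto split: if_splits)
  qed
  have H: "H_inf ?v" by (rule datum_H_inf)
  have block: "dyadic_block chi (int k - 1) ?v x = (if k = p + 6 then complex_of_real (?v x) else 0)" for k x
  proof -
    have m: "complex_of_real (block_mult chi k \<xi>) * fourier_coeff ?v \<xi> = (if k = p + 6 then fourier_coeff ?v \<xi> else 0)" for \<xi>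
      using mult[of \<xi> k] by (cases "fourier_coeff ?v \<xi> = 0") auto
    have s: "smooth_fun ?v" "smooth_fun (deriv ?v)" "smooth_fun (deriv (deriv ?v))"
      and p: "periodic_2pi ?v" "periodic_2pi (deriv ?v)" "periodic_2pi (deriv (deriv ?v))"
      using H by (auto simp: H_inf_def intro: smooth_fun_deriv periodic_deriv)
    note inv = fourier_inversion(2)[OF s(1,2)[THEN smooth_fun_has_deriv] smooth_fun_continuous[OF s(3)] p, of x]
    show ?thesis
      unfolding dyadic_block_mult fourier_mult_def m using infsumI[OF inv] by simp
  qed
  have "besov_1_inf_1 chi ?v = (\<Sum>k\<in>{p + 6}. ennreal (2 powr (real k - 1)) * Linf_norm (dyadic_block chi (int k - 1) ?v))"
    unfolding besov_1_inf_1_def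
  proof (rule suminf_finite)
    fix k assume k: "k \<notin> {p + 6}"
    have "dyadic_block chi (int k - 1) ?v = (\<lambda>x. 0)" using k block by auto
    then show "ennreal (2 powr (real k - 1)) * Linf_norm (dyadic_block chi (int k - 1) ?v) = 0"
      by (simp add: Linf_norm_def)
  qed simp
  also have "\<dots> = ennreal (2 ^ (p + 5)) * Linf_norm (dyadic_block chi (int (p + 6) - 1) ?v)"
    by (simp add: powr_realpow[symmetric] add.commute)
  also have "\<dots> \<le> ennreal (2 ^ (p + 5)) * ennreal (6 * \<epsilon> / real L)"
    unfolding Linf_norm_def block
    by (intro mult_left_mono SUP_least ennreal_leI) (use datum_bound[OF M r L \<epsilon>] in auto)
  also have "\<dots> = ennreal (2 ^ (p + 5) * (6 * \<epsilon> / real L))"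
    using \<epsilon> by (subst ennreal_mult) auto
  also have "2 ^ (p + 5) * (6 * \<epsilon> / real L) = 64 / 15 * \<epsilon>"
    by (simp add: L_def power_add)
  also have "ennreal (64 / 15 * \<epsilon>) \<le> ennreal (5 * \<epsilon>)" using \<epsilon> by (intro ennreal_leI) simp
  finally show ?thesis by (simp add: L_def)
qed

section \<open>Norm inflation\<close>

text \<open>The symmetric period places the near-singularity of the kernel at the centre, where
  distances to it are |x|.\<close>

lemma integral_symmetric_period:
  fixes f :: "real \<Rightarrow> real"
  assumes c: "continuous_on UNIV f" and p: "periodic_2pi f"
  shows "integral {-pi..pi} f = integral {0..2*pi} f"
proof -
  note A = antider_deriv[OF c]
  have "(f has_integral antider f pi - antider f (- pi)) {-pi..pi}" by (rule ftc_real[OF _ A]) simp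
  moreover have "(f has_integral antider f (2 * pi) - antider f 0) {0..2*pi}" by (rule ftc_real[OF _ A]) simp
  ultimately show ?thesis using antider_shift[OF c p, of "- pi"] by (simp add: integral_unique)
qed

text \<open>With six percent distortion y / 2 may exceed pi / 2, where sine decreases. The cubic
  Taylor bound still gives sin z \<ge> 53/100 z up to z = 167/100, and 53/100 times 47/100 exceeds
  1/5.\<close>

lemma sin_half_lower:
  assumes x: "0 \<le> x" "x \<le> pi" and y: "47 / 50 * x \<le> y" "y \<le> 53 / 50 * x"
  shows "x / 5 \<le> sin (y / 2)"
proof -
  define z where "z = y / 2"
  have z: "47 / 100 * x \<le> z" "0 \<le> z" "z \<le> 167 / 100"
    using x y pi_approx by (simp_all add: z_def)
  have "z - z ^ 3 / 6 \<le> sin z"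
  proof -
    have c: "1 - w\<^sup>2 / 2 \<le> cos w" if "0 \<le> w" for w :: real
    proof -
      have "1 - 0\<^sup>2 / 2 - cos (0::real) \<ge> 1 - w\<^sup>2 / 2 - cos w"
      proof (rule DERIV_nonpos_imp_nonincreasing[OF that])
        fix v :: real assume "0 \<le> v"
        then have "sin v \<le> v" by (rule sin_x_le_x)
        then show "\<exists>D. ((\<lambda>w. 1 - w\<^sup>2 / 2 - cos w) has_real_derivative D) (at v) \<and> D \<le> 0"
          by (intro exI[of _ "- v + sin v"]) (auto intro!: derivative_eq_intros)
      qed
      then show ?thesis by simp
    qed
    have "0 - 0 ^ 3 / 6 - sin (0::real) \<ge> z - z ^ 3 / 6 - sin z"
    proof (rule DERIV_nonpos_imp_nonincreasing[OF z(2)])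
      fix v :: real assume "0 \<le> v"
      from c[OF this] show "\<exists>D. ((\<lambda>w. w - w ^ 3 / 6 - sin w) has_real_derivative D) (at v) \<and> D \<le> 0"
        by (intro exI[of _ "1 - v\<^sup>2 / 2 - cos v"]) (auto intro!: derivative_eq_intros)
    qed
    then show ?thesis by simp
  qed
  moreover have "z * (53 / 100) \<le> z - z ^ 3 / 6"
  proof -
    have "z\<^sup>2 \<le> (167 / 100)\<^sup>2" using z by (intro power_mono) auto
    then have "z * (z\<^sup>2 / 6) \<le> z * (47 / 100)" using z by (intro mult_left_mono) (auto simp: power2_eq_square)
    then show ?thesis by (simp add: power3_eq_cube power2_eq_square algebra_simps)
  qed
  ultimately show ?thesis using z x by (simp add: z_def)
qed

section \<open>The kernel at distorted arguments\<close>

context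
  fixes r :: real assumes r: "1 / 2 \<le> r" "r < 1"
begin

private lemma r01: "0 < r" "r < 1" using r by auto

lemma Qr_lower:
  assumes x: "\<bar>x\<bar> \<le> pi" and y: "\<bar>y - x\<bar> \<le> 3 / 50 * \<bar>x\<bar>"
  shows "(1 - r)\<^sup>2 + x\<^sup>2 / 16 \<le> Qr r y"
proof -
  have y': "y - x \<le> 3 / 50 * \<bar>x\<bar>" "- (y - x) \<le> 3 / 50 * \<bar>x\<bar>" using y unfolding abs_le_iff by blast+
  have "\<bar>x\<bar> / 5 \<le> \<bar>sin (y / 2)\<bar>"
  proof (cases "0 \<le> x")
    case True
    have "47 / 50 * x \<le> y" "y \<le> 53 / 50 * x" using y' unfolding abs_of_nonneg[OF True] by linarith+
    then have "x / 5 \<le> sin (y / 2)" using x True by (intro sin_half_lower) auto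
    then show ?thesis using True by simp
  next
    case False
    then have n: "\<bar>x\<bar> = - x" by simp
    have "47 / 50 * (- x) \<le> - y" "- y \<le> 53 / 50 * (- x)" using y' unfolding n by linarith+
    then have "(- x) / 5 \<le> sin ((- y) / 2)" using x False by (intro sin_half_lower) auto
    then show ?thesis using False by simp
  qed
  then have "(\<bar>x\<bar> / 5)\<^sup>2 \<le> (\<bar>sin (y / 2)\<bar>)\<^sup>2" by (rule power_mono) simp
  then have "x\<^sup>2 / 25 \<le> (sin (y / 2))\<^sup>2" by (simp add: power_divide)
  then have "4 * (1 / 2) * (x\<^sup>2 / 25) \<le> 4 * r * (sin (y / 2))\<^sup>2"
    using r by (intro mult_mono) auto
  moreover have "x\<^sup>2 / 16 \<le> 4 * (1 / 2) * (x\<^sup>2 / 25)" by simp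
  ultimately show ?thesis unfolding Qr_eq by linarith
qed

text \<open>In terms of q = sin(y/2)^2 the numerator is (1 - r)^2 - 2 (1 + r^2) q and
  \<open>Qr\<close> is (1 - r)^2 + 4 r q; for r at least 1/2 the former is dominated through 1 + r^2
  \<le> 4 r.\<close>

lemma hk'_upper: "\<bar>hk' r y\<bar> \<le> 2 / Qr r y"
proof -
  have Q: "Qr r y > 0" by (rule Qr_pos[OF r01])
  have "r * r \<le> 1 * r" using r by (intro mult_right_mono) auto
  then have r4: "1 + r\<^sup>2 \<le> 4 * r" using r unfolding power2_eq_square by linarith
  let ?q = "(sin (y / 2))\<^sup>2"
  have cos: "cos y = 1 - 2 * ?q" using cos_double_sin[of "y / 2"] by simp
  have num: "(1 + r\<^sup>2) * cos y - 2 * r = (1 - r)\<^sup>2 - 2 * (1 + r\<^sup>2) * ?q"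
    unfolding cos by (simp add: power2_eq_square algebra_simps)
  have m: "2 * ((1 + r\<^sup>2) * ?q) \<le> 2 * (4 * (r * ?q))"
    using mult_right_mono[OF r4, of ?q] by simp
  have p: "0 \<le> (1 + r\<^sup>2) * ?q" "0 \<le> r * ?q" using r by (auto intro!: mult_nonneg_nonneg add_nonneg_nonneg)
  have gen: "\<bar>a - 2 * b\<bar> \<le> 2 * (a + 4 * c)" if "2 * b \<le> 2 * (4 * c)" "0 \<le> b" "0 \<le> c" "0 \<le> a" for a b c :: real
    using that by (smt (verit))
  have "\<bar>(1 + r\<^sup>2) * cos y - 2 * r\<bar> \<le> 2 * Qr r y"
    unfolding num Qr_eq using gen[OF m p zero_le_power2[of "1 - r"]] by (simp only: mult.assoc)
  then have "r * \<bar>(1 + r\<^sup>2) * cos y - 2 * r\<bar> \<le> 1 * (2 * Qr r y)"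
    using r by (intro mult_mono) auto
  then have "\<bar>hk' r y\<bar> \<le> 2 * Qr r y / (Qr r y)\<^sup>2"
    unfolding hk'_def abs_divide abs_mult using r by (simp add: divide_right_mono)
  then show ?thesis using Q by (simp add: power2_eq_square)
qed

text \<open>A majorant of \<open>hk r\<close> that survives distorting the argument by up to six percent, with integral \<open>O(ln M)\<close>.\<close>

definition "wt x = \<bar>x\<bar> / ((1 - r)\<^sup>2 + x\<^sup>2 / 16)"

lemma wt_den: "(1 - r)\<^sup>2 + x\<^sup>2 / 16 > 0"
  using r by (intro add_pos_nonneg) auto

lemma hk_upper:
  assumes x: "\<bar>x\<bar> \<le> pi" and y: "\<bar>y - x\<bar> \<le> 3 / 50 * \<bar>x\<bar>"
  shows "\<bar>hk r y\<bar> \<le> 53 / 50 * wt x"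
proof -
  have "\<bar>r * sin y\<bar> \<le> 1 * \<bar>y\<bar>" unfolding abs_mult using r abs_sin_x_le_abs_x[of y] by (intro mult_mono) auto
  also have "\<dots> \<le> 53 / 50 * \<bar>x\<bar>" using y by linarith
  finally have "\<bar>r * sin y\<bar> / Qr r y \<le> 53 / 50 * \<bar>x\<bar> / ((1 - r)\<^sup>2 + x\<^sup>2 / 16)"
    by (intro frac_le Qr_lower[OF x y] wt_den) auto
  then show ?thesis using Qr_pos[OF r01, of y] by (simp add: hk_def wt_def)
qed

text \<open>Mean value theorem: between x and y the derivative is at most twice the inverse
  denominator of \<open>wt\<close>, and the distance is \<open>\<beta> * \<bar>x\<bar>\<close>.
  Replacing the distorted kernel by the true one thus costs a factor \<beta> times the logarithmic
  weight.\<close>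

lemma hk_close:
  assumes x: "\<bar>x\<bar> \<le> pi" and y: "\<bar>y - x\<bar> \<le> \<beta> * \<bar>x\<bar>" and \<beta>: "\<beta> \<le> 3 / 50"
  shows "\<bar>hk r y - hk r x\<bar> \<le> 2 * \<beta> * wt x"
proof -
  define S where "S = {min x y..max x y}"
  have "norm (hk r y - hk r x) \<le> 2 / ((1 - r)\<^sup>2 + x\<^sup>2 / 16) * norm (y - x)"
  proof (rule field_differentiable_bound)
    show "convex S" "x \<in> S" "y \<in> S" by (auto simp: S_def)
    show "(hk r has_field_derivative hk' r z) (at z within S)" for z
      by (rule DERIV_subset[OF hk_deriv[OF r01]]) simp
    fix z assume "z \<in> S"
    then have "\<bar>z - x\<bar> \<le> \<bar>y - x\<bar>" by (auto simp: S_def min_def max_def split: if_splits)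
    also have "\<dots> \<le> 3 / 50 * \<bar>x\<bar>" using y mult_right_mono[OF \<beta>, of "\<bar>x\<bar>"] by simp
    finally have "2 / Qr r z \<le> 2 / ((1 - r)\<^sup>2 + x\<^sup>2 / 16)"
      by (intro frac_le Qr_lower[OF x] wt_den) auto
    then show "norm (hk' r z) \<le> 2 / ((1 - r)\<^sup>2 + x\<^sup>2 / 16)" using hk'_upper[of z] by simp
  qed
  also have "\<dots> \<le> 2 / ((1 - r)\<^sup>2 + x\<^sup>2 / 16) * (\<beta> * \<bar>x\<bar>)"
    using y wt_den[of x] by (intro mult_left_mono) auto
  finally show ?thesis by (simp add: wt_def mult_ac)
qed

lemma wt_abs: "\<bar>x\<bar> * wt x \<le> 16"
proof -
  have "x\<^sup>2 \<le> 16 * ((1 - r)\<^sup>2 + x\<^sup>2 / 16)" by simp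
  then have "x\<^sup>2 / ((1 - r)\<^sup>2 + x\<^sup>2 / 16) \<le> 16" using wt_den[of x] by (simp add: pos_divide_le_eq)
  then show ?thesis by (simp add: wt_def power2_eq_square)
qed

lemma wt_integral: "(wt has_integral 16 * ln (1 + pi\<^sup>2 / (16 * (1 - r)\<^sup>2))) {-pi..pi}"
proof -
  let ?G = "\<lambda>x. 8 * ln ((1 - r)\<^sup>2 + x\<^sup>2 / 16)"
  have G: "(?G has_real_derivative x / ((1 - r)\<^sup>2 + x\<^sup>2 / 16)) (at x)" for x
  proof -
    have "8 * (1 / D * (x / 8)) = x / D" if "D > 0" for D :: real using that by simp
    note eq = this[OF wt_den[of x]]
    have d: "((\<lambda>x. (1 - r)\<^sup>2 + x\<^sup>2 / 16) has_real_derivative x / 8) (at x)"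
      by (auto intro!: derivative_eq_intros)
    show ?thesis by (rule DERIV_cong[OF DERIV_cmult[OF DERIV_chain2[OF DERIV_ln_divide[OF wt_den[of x]] d]] eq])
  qed
  have "((\<lambda>x. x / ((1 - r)\<^sup>2 + x\<^sup>2 / 16)) has_integral ?G pi - ?G 0) {0..pi}"
    by (rule ftc_real[OF _ G]) simp
  then have 1: "(wt has_integral ?G pi - ?G 0) {0..pi}"
    by (rule has_integral_eq[rotated]) (simp add: wt_def)
  have "((\<lambda>x. - (x / ((1 - r)\<^sup>2 + x\<^sup>2 / 16))) has_integral - (?G 0 - ?G (- pi))) {-pi..0}"
    by (rule has_integral_neg, rule ftc_real[OF _ G]) simp
  then have 2: "(wt has_integral - (?G 0 - ?G (- pi))) {-pi..0}"
    by (rule has_integral_eq[rotated]) (simp add: wt_def)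
  have "(wt has_integral - (?G 0 - ?G (- pi)) + (?G pi - ?G 0)) {-pi..pi}"
    by (rule has_integral_combine[OF _ _ 2 1]) auto
  moreover
  have "ln (1 + pi\<^sup>2 / (16 * (1 - r)\<^sup>2)) = ln ((1 - r)\<^sup>2 + pi\<^sup>2 / 16) - ln ((1 - r)\<^sup>2)"
  proof -
    have "1 + pi\<^sup>2 / (16 * (1 - r)\<^sup>2) = ((1 - r)\<^sup>2 + pi\<^sup>2 / 16) / (1 - r)\<^sup>2"
      using r by (simp add: add_divide_distrib)
    then show ?thesis using wt_den[of pi] r by (simp add: ln_div)
  qed
  then have "- (?G 0 - ?G (- pi)) + (?G pi - ?G 0) = 16 * ln (1 + pi\<^sup>2 / (16 * (1 - r)\<^sup>2))" by simp
  ultimately show ?thesis by (simp only:)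
qed

end

text \<open>1 - r = 1 / (M + 1), so the logarithm is at most that of 1 + (M + 1)^2, which lies below
  (M + 1)^3; 48 = 16 * 3.\<close>

lemma wt_integral_le:
  assumes M: "M \<ge> 1" and r: "r = real M / (real M + 1)"
  shows "16 * ln (1 + pi\<^sup>2 / (16 * (1 - r)\<^sup>2)) \<le> 48 * ln (real M + 1)"
proof -
  have d: "1 - r = 1 / (real M + 1)" using M by (simp add: r field_simps)
  have pi2: "pi\<^sup>2 \<le> 4\<^sup>2" using pi_less_4 by (intro power_mono) auto
  have "pi\<^sup>2 / (16 * (1 - r)\<^sup>2) = pi\<^sup>2 / 16 * (real M + 1)\<^sup>2" by (simp add: d power_divide)
  also have "\<dots> \<le> 1 * (real M + 1)\<^sup>2" using pi2 by (intro mult_right_mono) auto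
  finally have "1 + pi\<^sup>2 / (16 * (1 - r)\<^sup>2) \<le> 1 + (real M + 1)\<^sup>2" by simp
  also have "\<dots> \<le> (real M + 1) ^ 3"
  proof -
    have "1 \<le> (real M + 1)\<^sup>2" by (rule one_le_power) simp
    moreover have "2 * (real M + 1)\<^sup>2 \<le> (real M + 1) * (real M + 1)\<^sup>2" using M by (intro mult_right_mono) auto
    moreover have "(real M + 1) ^ 3 = (real M + 1) * (real M + 1)\<^sup>2"
      by (simp add: power3_eq_cube power2_eq_square mult.assoc)
    ultimately show ?thesis by linarith
  qed
  finally have "ln (1 + pi\<^sup>2 / (16 * (1 - r)\<^sup>2)) \<le> ln ((real M + 1) ^ 3)"
    by (subst ln_le_cancel_iff) (auto intro!: add_pos_nonneg)
  also have "\<dots> = 3 * ln (real M + 1)" by (subst ln_realpow) auto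
  finally show ?thesis by simp
qed

section \<open>Expansion of the slope along the flow and its pairing with the kernel\<close>

context ch_flow_bd
begin

context
  fixes t assumes t: "t \<in> {0..T}"
begin

lemma A_near: "\<bar>A t x - x\<bar> \<le> 6 * e * t * \<bar>x\<bar>"
proof -
  have "norm ((A t x - x) - (A t 0 - 0)) \<le> 6 * e * t * norm (x - 0)"
    by (rule field_differentiable_bound[where S=UNIV and f'="\<lambda>x. V t x - 1"])
      (use V_near[OF t] in \<open>auto intro!: derivative_eq_intros A_x[OF t]\<close>)
  then show ?thesis by (simp add: A_def)
qed

text \<open>In the variable y = \<open>A t x\<close> the left side is the integral of u_x(\<eta> t 0
  + y) against \<open>hk r y\<close>; integration by parts moves the derivative to the kernel, the
  form that \<open>besov_controls_hilbert\<close> bounds.\<close>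

lemma hilbert_lagrangian:
  assumes r: "0 < r" "r < 1"
  shows "integral {-pi..pi} (\<lambda>x. W t x * V t x * hk r (A t x)) = - integral {0..2*pi} (\<lambda>y. u t (\<eta> t 0 + y) * hk' r y)"
proof -
  define h where "h y = u t (\<eta> t 0 + y) * hk' r y" for y
  have cu: "continuous_on UNIV (u t)" by (rule DERIV_continuous[OF u_x[OF t]])
  have ch: "continuous_on UNIV h" unfolding h_def
    by (intro continuous_intros hk'_cont[OF r] continuous_on_compose2[OF cu]) auto
  have ph: "periodic_2pi h"
    using u_periodic[OF t] hk_periodic(2)[OF r] by (simp add: periodic_2pi_def h_def add.assoc[symmetric])
  note H = antider_deriv[OF ch]
  have uA: "u t (\<eta> t 0 + A t x) = U t x" for x
    using u_\<eta>[OF t, of x] by (simp add: \<eta>_def A_def)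
  have A1: "A t pi = A t (- pi) + 2 * pi" using A_2pi[OF t, of "- pi"] by simp
  have "((\<lambda>x. W t x * V t x * hk r (A t x) + h (A t x) * V t x) has_integral
      U t pi * hk r (A t pi) - U t (- pi) * hk r (A t (- pi))) {-pi..pi}"
    by (rule ftc_real, simp, rule DERIV_cong[OF DERIV_mult[OF U_x[OF t] DERIV_chain2[OF hk_deriv[OF r] A_x[OF t]]]])
      (simp add: h_def uA)
  moreover have "U t pi * hk r (A t pi) = U t (- pi) * hk r (A t (- pi))"
    using U_per[OF t, unfolded periodic_2pi_def, rule_format, of "- pi"]
      hk_periodic(1)[OF r, unfolded periodic_2pi_def, rule_format, of "A t (- pi)"] by (simp add: A1)
  ultimately have 1: "((\<lambda>x. W t x * V t x * hk r (A t x) + h (A t x) * V t x) has_integral 0) {-pi..pi}" by simp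
  have "((\<lambda>x. h (A t x) * V t x) has_integral antider h (A t pi) - antider h (A t (- pi))) {-pi..pi}"
    by (rule ftc_real) (auto intro!: DERIV_chain2[OF H] A_x[OF t])
  then have 2: "((\<lambda>x. h (A t x) * V t x) has_integral antider h (2 * pi)) {-pi..pi}"
    using antider_shift[OF ch ph, of "A t (- pi)"] by (simp add: A1)
  have "(h has_integral antider h (2 * pi) - antider h 0) {0..2*pi}" by (rule ftc_real[OF _ H]) simp
  then have "integral {0..2*pi} h = antider h (2 * pi)" by (simp add: integral_unique)
  moreover have "((\<lambda>x. W t x * V t x * hk r (A t x)) has_integral 0 - antider h (2 * pi)) {-pi..pi}"
    using has_integral_diff[OF 1 2] by simp
  ultimately show ?thesis by (simp add: integral_unique h_def[abs_def])
qed

end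

text \<open>The part of the growth rate of \<open>W * V\<close> that varies slowly in \<open>x\<close>; its value at \<open>0\<close> is lost to the kernel.\<close>

definition "g t x = (U t x)\<^sup>2 - P t x"

context
  fixes t assumes t: "t \<in> {0..T}"
begin

lemma g_le: "\<bar>g t x\<bar> \<le> 6 * e\<^sup>2"
proof -
  have "(U t x)\<^sup>2 \<le> (2 * e)\<^sup>2"
    by (rule abs_le_square_iff[THEN iffD1]) (use U_le[OF t, of x] e in simp)
  then have "(U t x)\<^sup>2 \<le> 4 * e\<^sup>2" by (simp add: power_mult_distrib)
  moreover have "0 \<le> (U t x)\<^sup>2" "0 \<le> e\<^sup>2" by simp_all
  ultimately show ?thesis using P_nonneg[OF t, of x] P_le[OF t, of x] unfolding g_def abs_le_iff by linarith
qed

text \<open>The derivative is \<open>V * (2 * U * W + B)\<close>, at most 53/50 times 28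
  \<open>e\<^sup>2\<close>. No derivative of the slope occurs, so the bound does not see the
  oscillation of the datum.\<close>

lemma g_lipschitz: "\<bar>g t x - g t 0\<bar> \<le> 30 * e\<^sup>2 * \<bar>x\<bar>"
proof -
  have d: "(g t has_real_derivative 2 * U t x * (W t x * V t x) + V t x * B t x) (at x)" for x
    unfolding g_def[abs_def] by (auto intro!: derivative_eq_intros U_x[OF t] P_x[OF t])
  have b: "\<bar>2 * U t x * (W t x * V t x) + V t x * B t x\<bar> \<le> 30 * e\<^sup>2" for x
  proof -
    have "\<bar>2 * U t x * W t x + B t x\<bar> \<le> 2 * \<bar>U t x\<bar> * \<bar>W t x\<bar> + \<bar>B t x\<bar>"
      using abs_triangle_ineq[of "2 * U t x * W t x" "B t x"] by (simp add: abs_mult)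
    also have "\<dots> \<le> 2 * (2 * e) * (2 * e) + 20 * e\<^sup>2"
      using U_le[OF t, of x] W_le[OF t, of x] B_le[OF t, of x] e by (intro add_mono mult_mono) auto
    finally have "\<bar>2 * U t x * W t x + B t x\<bar> \<le> 28 * e\<^sup>2" by (simp add: power2_eq_square)
    then have "V t x * \<bar>2 * U t x * W t x + B t x\<bar> \<le> 53 / 50 * (28 * e\<^sup>2)"
      using V_le[OF t, of x] V_pos[of t x] by (intro mult_mono) auto
    moreover have "2 * U t x * (W t x * V t x) + V t x * B t x = V t x * (2 * U t x * W t x + B t x)"
      by (simp add: algebra_simps)
    ultimately have "\<bar>2 * U t x * (W t x * V t x) + V t x * B t x\<bar> \<le> 53 / 50 * (28 * e\<^sup>2)"
      using V_pos[of t x] by (simp add: abs_mult)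
    also have "\<dots> \<le> 30 * e\<^sup>2" by simp
    finally show ?thesis .
  qed
  have "norm (g t x - g t 0) \<le> 30 * e\<^sup>2 * norm (x - 0)"
    by (rule field_differentiable_bound[where S=UNIV]) (use d b in auto)
  then show ?thesis by simp
qed

text \<open>The rate is compared with its value at time 0, with \<open>g\<close> frozen at x = 0.
  The errors are halves of 26 and 22 from the quadratic term, 36 from replacing \<open>V\<close> by
  1 in \<open>g * V\<close>, and the Lipschitz bound, whose factor |x| will cancel the kernel
  singularity.\<close>

lemma rate_expansion:
  "\<bar>(F t x - P t x) * V t x - ((u0' x)\<^sup>2 / 2 + g t 0)\<bar> \<le> 60 * e ^ 3 * t + 30 * e\<^sup>2 * \<bar>x\<bar>"
proof -
  have t0: "0 \<le> t" using t by simp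
  have e3: "e ^ 3 = e\<^sup>2 * e" by (simp add: power3_eq_cube power2_eq_square)
  have WV: "\<bar>W t x * V t x\<bar> \<le> 2 * e * (53 / 50)"
    unfolding abs_mult using W_le[OF t, of x] V_le[OF t, of x] V_pos[of t x] e by (intro mult_mono) auto
  have a: "\<bar>(W t x * V t x)\<^sup>2 - (u0' x)\<^sup>2\<bar> \<le> 22 * e ^ 3 * t"
  proof -
    have "(W t x * V t x)\<^sup>2 - (u0' x)\<^sup>2 = (W t x * V t x - u0' x) * (W t x * V t x + u0' x)"
      by (simp add: power2_eq_square algebra_simps)
    then have "\<bar>(W t x * V t x)\<^sup>2 - (u0' x)\<^sup>2\<bar> = \<bar>W t x * V t x - u0' x\<bar> * \<bar>W t x * V t x + u0' x\<bar>"
      by (simp only: abs_mult)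
    also have "\<dots> \<le> (7 * e\<^sup>2 * t) * (22 / 7 * e)"
    proof (rule mult_mono[OF WV_near[OF t]])
      show "\<bar>W t x * V t x + u0' x\<bar> \<le> 22 / 7 * e" using WV u0_le(2)[of x] e by linarith
    qed (use t0 in auto)
    finally show ?thesis by (simp add: e3 mult_ac)
  qed
  have W2: "(W t x)\<^sup>2 \<le> (2 * e)\<^sup>2"
    by (rule abs_le_square_iff[THEN iffD1]) (use W_le[OF t, of x] e in simp)
  have b: "\<bar>(W t x)\<^sup>2 * V t x - (W t x * V t x)\<^sup>2\<bar> \<le> 26 * e ^ 3 * t"
  proof -
    have "(W t x)\<^sup>2 * V t x - (W t x * V t x)\<^sup>2 = (W t x)\<^sup>2 * V t x * (1 - V t x)"
      by (simp add: power2_eq_square algebra_simps)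
    then have "\<bar>(W t x)\<^sup>2 * V t x - (W t x * V t x)\<^sup>2\<bar> = (W t x)\<^sup>2 * V t x * \<bar>V t x - 1\<bar>"
      using V_pos[of t x] by (simp add: abs_mult abs_minus_commute)
    also have "\<dots> \<le> (2 * e)\<^sup>2 * (53 / 50) * (6 * e * t)"
      using W2 V_le[OF t, of x] V_pos[of t x] V_near[OF t, of x] e t0 by (intro mult_mono) auto
    also have "\<dots> \<le> 26 * e ^ 3 * t" using e t0 by (simp add: e3 power_mult_distrib)
    finally show ?thesis .
  qed
  have c: "\<bar>g t x * V t x - g t x\<bar> \<le> 36 * e ^ 3 * t"
  proof -
    have "\<bar>g t x * V t x - g t x\<bar> = \<bar>g t x\<bar> * \<bar>V t x - 1\<bar>"
      by (simp add: abs_mult[symmetric] algebra_simps)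
    also have "\<dots> \<le> 6 * e\<^sup>2 * (6 * e * t)"
      using g_le V_near[OF t, of x] e by (intro mult_mono) auto
    finally show ?thesis by (simp add: e3 mult_ac)
  qed
  \<comment> \<open>\<open>W\<^sup>2 * V\<close> is reached through \<open>(W * V)\<^sup>2\<close>,
    because \<open>W * V\<close> is the quantity known to stay near \<open>u0'\<close>.\<close>
  have id: "(a + b / 2 - p) * v - (q / 2 + g0)
      = (b * v - y) / 2 + (y - q) / 2 + ((a - p) * v - (a - p)) + ((a - p) - g0)" for a b p v q g0 y :: real
    by (simp add: field_simps)
  have eq: "(F t x - P t x) * V t x - ((u0' x)\<^sup>2 / 2 + g t 0)
      = ((W t x)\<^sup>2 * V t x - (W t x * V t x)\<^sup>2) / 2 + ((W t x * V t x)\<^sup>2 - (u0' x)\<^sup>2) / 2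
        + (g t x * V t x - g t x) + (g t x - g t 0)"
    unfolding F_def g_def[of t x] by (rule id)
  have "\<bar>b / 2 + a / 2 + c + d\<bar> \<le> B / 2 + A / 2 + C + D"
    if "\<bar>b\<bar> \<le> B" "\<bar>a\<bar> \<le> A" "\<bar>c\<bar> \<le> C" "\<bar>d\<bar> \<le> D" for a b c d A B C D :: real
    using that by linarith
  note bnd = this[OF b a c g_lipschitz[of x]]
  show ?thesis unfolding eq by (rule order_trans[OF bnd]) simp
qed

end

lemma g_j: "jcont {0..T} g"
  using U_j P_j unfolding jcont_def g_def case_prod_unfold by (intro continuous_intros; simp)

lemma WV_expansion:
  assumes t: "t \<in> {0..T}"
  shows "\<bar>W t x * V t x - (u0' x + t / 2 * (u0' x)\<^sup>2 + integral {0..t} (\<lambda>s. g s 0))\<bar>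
    \<le> 60 * e ^ 3 * t\<^sup>2 + 30 * e\<^sup>2 * t * \<bar>x\<bar>"
proof -
  have "(\<lambda>s. g s 0) integrable_on {0..t}"
    by (intro integrable_continuous_real continuous_on_subset[OF jcont_time[OF g_j]]) (use t in auto)
  then have G: "((\<lambda>s. g s 0) has_integral integral {0..t} (\<lambda>s. g s 0)) {0..t}" by (rule integrable_integral)
  have c: "((\<lambda>s. (u0' x)\<^sup>2 / 2) has_integral t * ((u0' x)\<^sup>2 / 2)) {0..t}"
    using has_integral_const_real[of "(u0' x)\<^sup>2 / 2" 0 t] t by simp
  have "norm (W t x * V t x - W 0 x * V 0 x - (t * ((u0' x)\<^sup>2 / 2) + integral {0..t} (\<lambda>s. g s 0)))
      \<le> (60 * e ^ 3 * t + 30 * e\<^sup>2 * \<bar>x\<bar>) * measure lborel {0..t}"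
  proof (rule has_integral_bound_real[OF _ finite.emptyI has_integral_diff[OF WV_integral[OF t] has_integral_add[OF c G]]])
    show "0 \<le> 60 * e ^ 3 * t + 30 * e\<^sup>2 * \<bar>x\<bar>" using e t by simp
    fix s assume s: "s \<in> {0..t} - {}"
    have "60 * e ^ 3 * s \<le> 60 * e ^ 3 * t" using s e by (intro mult_left_mono) auto
    moreover have "\<bar>(F s x - P s x) * V s x - ((u0' x)\<^sup>2 / 2 + g s 0)\<bar> \<le> 60 * e ^ 3 * s + 30 * e\<^sup>2 * \<bar>x\<bar>"
      by (rule rate_expansion) (use s t in auto)
    ultimately show "norm ((F s x - P s x) * V s x - ((u0' x)\<^sup>2 / 2 + g s 0)) \<le> 60 * e ^ 3 * t + 30 * e\<^sup>2 * \<bar>x\<bar>"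
      by simp
  qed
  also have "\<dots> = 60 * e ^ 3 * t\<^sup>2 + 30 * e\<^sup>2 * t * \<bar>x\<bar>"
    using t by (simp add: algebra_simps power2_eq_square)
  finally show ?thesis by (simp add: algebra_simps)
qed

lemma hilbert_inflation:
  assumes M: "M \<ge> 1" and r: "r = real M / (real M + 1)" and t: "t \<in> {0..T}"
    and K: "\<And>y. \<bar>hk' r y\<bar> \<le> K" and small: "\<And>x. \<bar>u0 x\<bar> * K \<le> 1 / 7"
    and E: "E \<le> integral {0..2*pi} (\<lambda>x. (u0' x)\<^sup>2 * hk r x)"
  shows "t / 2 * E - 7000 * (e ^ 3 * t\<^sup>2 * ln (real M + 1)) - 3300 * (e\<^sup>2 * t) - 1
    \<le> \<bar>integral {0..2*pi} (\<lambda>y. u t (\<eta> t 0 + y) * hk' r y)\<bar>"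
proof -
  have r01: "0 < r" "r < 1" and rh: "1 / 2 \<le> r" using M by (auto simp: r divide_simps)
  have t0: "0 \<le> t" using t by simp
  let ?S = "{-pi..pi}"
  define J where "J = integral ?S (wt r)"
  have Ji: "(wt r has_integral J) ?S"
    unfolding J_def by (rule integrable_integral[OF has_integral_integrable[OF wt_integral[OF rh r01(2)]]])
  have J: "J \<le> 48 * ln (real M + 1)"
    using integral_unique[OF wt_integral[OF rh r01(2)]] wt_integral_le[OF M r] by (simp add: J_def)
  define k where "k = integral {0..t} (\<lambda>s. g s 0)"
  define \<beta> where "\<beta> = 6 * e * t"
  have \<beta>: "\<beta> \<le> 3 / 50" using et[OF t] by (simp add: \<beta>_def)
  define h where "h x = hk r (A t x)" for x
  define R where "R x = W t x * V t x - (u0' x + t / 2 * (u0' x)\<^sup>2 + k)" for x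
  have near: "\<bar>A t x - x\<bar> \<le> \<beta> * \<bar>x\<bar>" for x using A_near[OF t, of x] by (simp add: \<beta>_def)
  have near': "\<bar>A t x - x\<bar> \<le> 3 / 50 * \<bar>x\<bar>" for x
    by (rule order_trans[OF near mult_right_mono[OF \<beta>]]) simp
  have hu: "\<bar>h x\<bar> \<le> 53 / 50 * wt r x" if "x \<in> ?S" for x
    unfolding h_def by (rule hk_upper[OF rh r01(2) _ near']) (use that in auto)
  have hc: "\<bar>h x - hk r x\<bar> \<le> 2 * \<beta> * wt r x" if "x \<in> ?S" for x
    unfolding h_def by (rule hk_close[OF rh r01(2) _ near \<beta>]) (use that in auto)
  have cu: "continuous_on X u0" "continuous_on X u0'" for X
    using DERIV_continuous[OF u0(1)] DERIV_continuous[OF u0(2)] by auto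
  have cW: "continuous_on X (W t)" "continuous_on X (V t)" "continuous_on X (A t)" for X
    using jcont_section[OF W_j t] jcont_section[OF V_j t] jcont_section[OF A_j t] by auto
  have ch: "continuous_on X h" "continuous_on X (\<lambda>x. hk' r (A t x))" for X
    unfolding h_def
    by (rule continuous_on_compose2[OF hk_cont[OF r01] cW(3) subset_UNIV],
        rule continuous_on_compose2[OF hk'_cont[OF r01] cW(3) subset_UNIV])
  have cR: "continuous_on X R" for X unfolding R_def by (intro continuous_intros cu cW)
  have hi: "(f has_integral integral ?S f) ?S" if "continuous_on ?S f" for f :: "real \<Rightarrow> real"
    by (rule integrable_integral[OF integrable_continuous_real[OF that]])
  have bound: "\<bar>integral ?S f\<bar> \<le> I"
    if "continuous_on ?S f" "(B has_integral I) ?S" "\<And>x. x \<in> ?S \<Longrightarrow> \<bar>f x\<bar> \<le> B x" for f B :: "real \<Rightarrow> real" and I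
  proof -
    have "norm (integral ?S f) \<le> integral ?S B"
      by (rule integral_norm_bound_integral)
        (use that integrable_continuous_real[OF that(1)] has_integral_integrable[OF that(2)] in auto)
    then show ?thesis using integral_unique[OF that(2)] by simp
  qed

  have A1: "A t pi = A t (- pi) + 2 * pi" using A_2pi[OF t, of "- pi"] by simp
  \<comment> \<open>\<open>u0'\<close> itself is not small, so the derivative is moved to the kernel
    and the factor 1 / L in \<open>u0\<close> is used through \<open>small\<close>; the total is
    \<open>2 * pi / 7 < 1\<close>.\<close>
  define IA where "IA = integral ?S (\<lambda>x. u0' x * h x)"
  have IA: "\<bar>IA\<bar> \<le> 1"
  proof -
    have "((\<lambda>x. u0' x * h x + u0 x * (hk' r (A t x) * V t x)) has_integral
        u0 pi * hk r (A t pi) - u0 (- pi) * hk r (A t (- pi))) ?S"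
      by (rule ftc_real, simp, rule DERIV_cong[OF DERIV_mult[OF u0(1) DERIV_chain2[OF hk_deriv[OF r01] A_x[OF t]]]])
        (simp add: h_def mult_ac)
    moreover have "u0 pi * hk r (A t pi) = u0 (- pi) * hk r (A t (- pi))"
      using u0(4)[unfolded periodic_2pi_def, rule_format, of "- pi"]
        hk_periodic(1)[OF r01, unfolded periodic_2pi_def, rule_format, of "A t (- pi)"] by (simp add: A1)
    ultimately have s: "((\<lambda>x. u0' x * h x + u0 x * (hk' r (A t x) * V t x)) has_integral 0) ?S" by simp
    have c: "continuous_on ?S (\<lambda>x. u0 x * (hk' r (A t x) * V t x))" by (intro continuous_intros cu cW ch)
    have "(V t has_integral A t pi - A t (- pi)) ?S" by (rule ftc_real[OF _ A_x[OF t]]) simp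
    then have VI: "((\<lambda>x. 1 / 7 * V t x) has_integral 1 / 7 * (2 * pi)) ?S"
      using has_integral_mult_right[of "V t" "2 * pi" ?S "1 / 7"] by (simp add: A1)
    have "\<bar>u0 x * (hk' r (A t x) * V t x)\<bar> \<le> 1 / 7 * V t x" for x
    proof -
      have "\<bar>u0 x\<bar> * \<bar>hk' r (A t x)\<bar> \<le> 1 / 7"
        by (rule order_trans[OF mult_left_mono[OF K] small]) simp
      then have "\<bar>u0 x\<bar> * \<bar>hk' r (A t x)\<bar> * V t x \<le> 1 / 7 * V t x"
        using V_pos[of t x] by (intro mult_right_mono) auto
      then show ?thesis using V_pos[of t x] by (simp add: abs_mult mult.assoc)
    qed
    then have "\<bar>integral ?S (\<lambda>x. u0 x * (hk' r (A t x) * V t x))\<bar> \<le> 1 / 7 * (2 * pi)"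
      by (intro bound[OF c VI])
    moreover have "IA = - integral ?S (\<lambda>x. u0 x * (hk' r (A t x) * V t x))"
      using integral_unique[OF has_integral_diff[OF s hi[OF c]]] by (simp add: IA_def)
    ultimately show ?thesis using pi_approx by simp
  qed

  \<comment> \<open>Undoing the distortion in the signal costs \<open>2 * \<beta> * J\<close>, by a
    factor of order e t smaller than the pairing of size ln M.\<close>
  define IB where "IB = integral ?S (\<lambda>x. (u0' x)\<^sup>2 * h x)"
  have IB: "E - e\<^sup>2 * (2 * \<beta> * J) \<le> IB"
  proof -
    have c0: "continuous_on X (\<lambda>x. (u0' x)\<^sup>2 * hk r x)" for X by (intro continuous_intros cu hk_cont[OF r01])
    have "periodic_2pi (\<lambda>x. (u0' x)\<^sup>2 * hk r x)"
      using u0(5) hk_periodic(1)[OF r01] by (simp add: periodic_2pi_def)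
    then have E': "E \<le> integral ?S (\<lambda>x. (u0' x)\<^sup>2 * hk r x)"
      using E integral_symmetric_period[OF c0] by simp
    have c: "continuous_on ?S (\<lambda>x. (u0' x)\<^sup>2 * h x)" by (intro continuous_intros cu ch)
    have d: "integral ?S (\<lambda>x. (u0' x)\<^sup>2 * (h x - hk r x)) = IB - integral ?S (\<lambda>x. (u0' x)\<^sup>2 * hk r x)"
      using integral_unique[OF has_integral_diff[OF hi[OF c] hi[OF c0]]] by (simp add: IB_def right_diff_distrib)
    have "\<bar>integral ?S (\<lambda>x. (u0' x)\<^sup>2 * (h x - hk r x))\<bar> \<le> e\<^sup>2 * (2 * \<beta> * J)"
    proof (rule bound)
      show "continuous_on ?S (\<lambda>x. (u0' x)\<^sup>2 * (h x - hk r x))" by (intro continuous_intros cu ch hk_cont[OF r01])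
      show "((\<lambda>x. e\<^sup>2 * (2 * \<beta> * wt r x)) has_integral e\<^sup>2 * (2 * \<beta> * J)) ?S" by (intro has_integral_mult_right Ji)
      fix x assume x: "x \<in> ?S"
      have "(u0' x)\<^sup>2 \<le> e\<^sup>2" by (rule abs_le_square_iff[THEN iffD1]) (use u0_le(2)[of x] e in simp)
      then have "(u0' x)\<^sup>2 * \<bar>h x - hk r x\<bar> \<le> e\<^sup>2 * (2 * \<beta> * wt r x)"
        using hc[OF x] by (intro mult_mono) auto
      then show "\<bar>(u0' x)\<^sup>2 * (h x - hk r x)\<bar> \<le> e\<^sup>2 * (2 * \<beta> * wt r x)" by (simp add: abs_mult)
    qed
    then show ?thesis using E' unfolding d by linarith
  qed

  \<comment> \<open>The undistorted kernel is odd and annihilates constants; only the distortion is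
    left.\<close>
  define IC where "IC = integral ?S h"
  have IC: "\<bar>IC\<bar> \<le> 2 * \<beta> * J"
  proof -
    have "integral ?S (hk r) = 0"
      using integral_symmetric_period[OF hk_cont[OF r01] hk_periodic(1)[OF r01]]
        integral_odd_periodic[OF hk_cont[OF r01] hk_periodic(1)[OF r01] hk_odd] by simp
    then have "IC = integral ?S (\<lambda>x. h x - hk r x)"
      using integral_unique[OF has_integral_diff[OF hi[OF ch(1)] hi[OF hk_cont[OF r01]]]] by (simp add: IC_def)
    also have "\<bar>\<dots>\<bar> \<le> 2 * \<beta> * J"
      by (rule bound[OF _ has_integral_mult_right[OF Ji] hc]) (auto intro!: continuous_intros ch hk_cont[OF r01])
    finally show ?thesis .
  qed

  have k: "\<bar>k\<bar> \<le> 6 * e\<^sup>2 * t"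
  proof -
    have "(\<lambda>s. g s 0) integrable_on {0..t}"
      by (intro integrable_continuous_real continuous_on_subset[OF jcont_time[OF g_j]]) (use t in auto)
    then have "norm k \<le> 6 * e\<^sup>2 * measure lborel {0..t}" unfolding k_def
      by (intro has_integral_bound_real[OF _ finite.emptyI integrable_integral]) (use g_le t in auto)
    then show ?thesis using t0 by simp
  qed

  define ID where "ID = integral ?S (\<lambda>x. R x * h x)"
  define a where "a = 60 * e ^ 3 * t\<^sup>2"
  define b where "b = 30 * e\<^sup>2 * t"
  have ab: "0 \<le> a" "0 \<le> b" using e t0 by (auto simp: a_def b_def)
  \<comment> \<open>The part of the remainder with |x| meets
    \<open>\<bar>x\<bar> * wt r x \<le> 16\<close> and so carries no logarithm; only the part cubic
    in e does.\<close>
  have ID: "\<bar>ID\<bar> \<le> a * (53 / 50 * J) + 2 * pi * (b * (53 / 50 * 16))"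
  proof -
    have "((\<lambda>x::real. b * (53 / 50 * 16)) has_integral (pi - - pi) *\<^sub>R (b * (53 / 50 * 16))) ?S"
      by (rule has_integral_const_real[THEN has_integral_eq_rhs]) simp
    then have c: "((\<lambda>x::real. b * (53 / 50 * 16)) has_integral 2 * pi * (b * (53 / 50 * 16))) ?S" by simp
    show ?thesis unfolding ID_def
    proof (rule bound[OF _ has_integral_add[OF has_integral_mult_right[OF has_integral_mult_right[OF Ji]] c]])
      show "continuous_on ?S (\<lambda>x. R x * h x)" by (intro continuous_intros cR ch)
      fix x assume x: "x \<in> ?S"
      have "\<bar>R x\<bar> * \<bar>h x\<bar> \<le> (a + b * \<bar>x\<bar>) * (53 / 50 * wt r x)"
        using WV_expansion[OF t, of x] hu[OF x] ab by (intro mult_mono) (auto simp: R_def k_def a_def b_def)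
      also have "\<dots> = a * (53 / 50 * wt r x) + b * (53 / 50 * (\<bar>x\<bar> * wt r x))" by (simp add: algebra_simps)
      also have "\<dots> \<le> a * (53 / 50 * wt r x) + b * (53 / 50 * 16)"
        using wt_abs[OF rh r01(2), of x] ab by (intro add_left_mono mult_left_mono) auto
      finally show "\<bar>R x * h x\<bar> \<le> a * (53 / 50 * wt r x) + b * (53 / 50 * 16)" by (simp add: abs_mult)
    qed
  qed

  have "((\<lambda>x. u0' x * h x + t / 2 * ((u0' x)\<^sup>2 * h x) + k * h x + R x * h x) has_integral
      IA + t / 2 * IB + k * IC + ID) ?S"
    unfolding IA_def IB_def IC_def ID_def
    by (intro has_integral_add has_integral_mult_right hi continuous_intros cu ch cR)
  moreover have "(\<lambda>x. u0' x * h x + t / 2 * ((u0' x)\<^sup>2 * h x) + k * h x + R x * h x)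
      = (\<lambda>x. W t x * V t x * hk r (A t x))"
    by (auto simp: fun_eq_iff R_def h_def algebra_simps)
  ultimately have tot: "IA + t / 2 * IB + k * IC + ID = - integral {0..2*pi} (\<lambda>y. u t (\<eta> t 0 + y) * hk' r y)"
    using hilbert_lagrangian[OF t r01] by (simp add: integral_unique)
  define X where "X = e ^ 3 * t\<^sup>2"
  define Y where "Y = e\<^sup>2 * t"
  have X0: "0 \<le> X" and Y0: "0 \<le> Y" using e t0 by (auto simp: X_def Y_def)
  have e3: "e ^ 3 = e * e\<^sup>2" by (simp add: power3_eq_cube power2_eq_square)
  have "t / 2 * (E - e\<^sup>2 * (2 * \<beta> * J)) \<le> t / 2 * IB" using IB t0 by (intro mult_left_mono) auto
  moreover have "t / 2 * (E - e\<^sup>2 * (2 * \<beta> * J)) = t / 2 * E - 6 * (X * J)"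
    by (simp add: \<beta>_def X_def e3 power2_eq_square algebra_simps)
  ultimately have 1: "t / 2 * E - 6 * (X * J) \<le> t / 2 * IB" by simp
  have "\<bar>k * IC\<bar> \<le> 6 * e\<^sup>2 * t * (2 * \<beta> * J)"
    unfolding abs_mult using k IC t0 by (intro mult_mono) auto
  also have "\<dots> = 72 * (X * J)" by (simp add: \<beta>_def X_def e3 power2_eq_square algebra_simps)
  finally have 2: "\<bar>k * IC\<bar> \<le> 72 * (X * J)" .
  have "a * (53 / 50 * J) = 318 / 5 * (X * J)" by (simp add: a_def X_def)
  moreover have "2 * pi * (b * (53 / 50 * 16)) = 30 * 53 / 50 * 32 * pi * Y" by (simp add: b_def Y_def)
  moreover have "30 * 53 / 50 * 32 * pi * Y \<le> 3300 * Y" using pi_approx Y0 by (intro mult_right_mono) auto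
  ultimately have 3: "\<bar>ID\<bar> \<le> 318 / 5 * (X * J) + 3300 * Y" using ID by linarith
  have "X * J \<le> X * (48 * ln (real M + 1))" using J X0 by (rule mult_left_mono)
  moreover have "0 \<le> X * ln (real M + 1)" using X0 by simp
  \<comment> \<open>6 + 72 + 318/5 = 141.6, and multiplied by 48 this stays below 7000.\<close>
  moreover have "I \<ge> TE - 7000 * XL - 3300 * Y - 1"
    if "IA + IB + kIC + ID = - I'" "I = \<bar>I'\<bar>" "TE - 6 * XJ \<le> IB" "\<bar>kIC\<bar> \<le> 72 * XJ" "\<bar>ID\<bar> \<le> 318 / 5 * XJ + 3300 * Y"
      "\<bar>IA\<bar> \<le> 1" "XJ \<le> 48 * XL" "0 \<le> XL" for I I' TE XL Y IA IB kIC ID XJ :: real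
    using that by linarith
  note this[OF tot refl 1 2 3 IA]
  ultimately show ?thesis by (simp add: X_def Y_def mult.assoc)
qed

end

text \<open>Size, time and target are independent: the gain \<epsilon>^2 t ln M grows with M at
  fixed \<epsilon> and t, while the norm of the datum does not depend on M.\<close>

theorem norm_inflation:
  assumes chi: "LP_cutoff chi" and \<epsilon>: "0 < \<epsilon>" and \<tau>: "0 < \<tau>" and K: "0 \<le> K"
  shows "\<exists>u0 T. H_inf u0 \<and> besov_1_inf_1 chi u0 \<le> ennreal (5 * \<epsilon>) \<and> T > 0 \<and> (\<exists>u. CH_solution T u0 u) \<and>
    (\<forall>u. CH_solution T u0 u \<longrightarrow> (\<exists>t0. 0 < t0 \<and> t0 \<le> \<tau> \<and> t0 < T \<and> besov_1_inf_1 chi (u t0) \<ge> ennreal K))"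
proof -
  \<comment> \<open>With e = 7 \<epsilon> the logarithmic error has coefficient 7000 * 343 *
    \<epsilon> t = 2401000 \<epsilon> t; the power 10^8 brings it below 1/10, against the gain
    3/5.\<close>
  define t where "t = min \<tau> (1 / 10 ^ 8 / \<epsilon>)"
  have t: "0 < t" "t \<le> \<tau>" using \<epsilon> \<tau> by (auto simp: t_def)
  have "\<epsilon> * t \<le> \<epsilon> * (1 / 10 ^ 8 / \<epsilon>)" using \<epsilon> by (intro mult_left_mono) (auto simp: t_def)
  then have \<epsilon>t: "\<epsilon> * t \<le> 1 / 10 ^ 8" using \<epsilon> by simp
  have e2t: "0 < \<epsilon>\<^sup>2 * t" using \<epsilon> t by simp
  \<comment> \<open>The threshold for ln(M + 1), obtained by solving the final inequality: half of
    \<epsilon>^2 t ln(M + 1) must exceed 20 K + 1 plus (161700 + 1/2) \<epsilon>^2 t, where 161700 =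
    3300 * 49.\<close>
  define a where "a = 2 * (20 * K + 1) / (\<epsilon>\<^sup>2 * t) + 323401"
  define M where "M = nat \<lceil>exp a\<rceil>"
  have Ma: "exp a \<le> real M" unfolding M_def by (rule real_nat_ceiling_ge)
  then have M: "M \<ge> 1" using exp_gt_zero[of a] by (cases M) auto
  define \<Lambda> where "\<Lambda> = ln (real M + 1)"
  have "ln (exp a) \<le> \<Lambda>" unfolding \<Lambda>_def using Ma by (subst ln_le_cancel_iff) auto
  then have \<Lambda>: "a \<le> \<Lambda>" by simp
  define r where "r = real M / (real M + 1)"
  have r01: "0 < r" "r < 1" and rh: "1 / 2 \<le> r" using M by (auto simp: r_def divide_simps)
  define H where "H = 2 / (1 - r)\<^sup>2"
  have H: "\<bar>hk' r y\<bar> \<le> H" for y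
  proof -
    have "2 / Qr r y \<le> 2 / (1 - r)\<^sup>2" using r01 by (intro frac_le) (auto simp: Qr_eq)
    then show ?thesis using hk'_upper[OF rh r01(2), of y] by (simp add: H_def)
  qed
  have H0: "0 \<le> H" by (simp add: H_def)
  obtain C where C: "\<And>\<epsilon> L. L \<ge> 1 \<Longrightarrow>
      \<epsilon>\<^sup>2 * (6 / 5 * ln (real M + 1) - C / real L) \<le> integral {0..2*pi} (\<lambda>x. (datum' \<epsilon> L M r x)\<^sup>2 * hk r x)"
    using datum_energy[OF M r_def] by blast
  \<comment> \<open>Three demands on L = 45 * 2^p: the spectrum stays in the band (M), the energy
    loss C / L is at most 1, and \<open>\<bar>u0 x\<bar> * H\<close> is at most 1/7. Both C and H
    depend on M.\<close>
  obtain p where p: "real M + \<bar>C\<bar> + 42 * \<epsilon> * H < 2 ^ p" using real_arch_pow[of 2] by auto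
  have "0 \<le> 42 * \<epsilon> * H" using \<epsilon> H0 by simp
  with p have p3: "real M \<le> 2 ^ p" "\<bar>C\<bar> \<le> 2 ^ p" "42 * \<epsilon> * H \<le> 2 ^ p" by linarith+
  have "real M \<le> real (2 ^ p)" using p3(1) by simp
  then have Mp: "M \<le> 2 ^ p" by (simp only: of_nat_le_iff)
  define L :: nat where "L = 45 * 2 ^ p"
  have L: "real L = 45 * 2 ^ p" by (simp add: L_def)
  have L1: "L \<ge> 1" "L \<ge> M" using Mp by (simp_all add: L_def)
  have Lp: "real L > 0" using L1 by simp
  define u0 where "u0 = datum \<epsilon> L M r"
  define u0' where "u0' = datum' \<epsilon> L M r"
  have S: "H_inf u0" unfolding u0_def by (rule datum_H_inf)
  then have s: "smooth_fun u0" and per: "periodic_2pi u0" by (auto simp: H_inf_def)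
  have u0'_eq: "deriv u0 = u0'"
    unfolding u0_def u0'_def by (rule ext, rule DERIV_imp_deriv, rule datum_deriv[OF L1(1)])
  have s': "smooth_fun u0'" and per': "periodic_2pi u0'"
    using smooth_fun_deriv[OF s] periodic_deriv[OF per] by (simp_all add: u0'_eq)
  have s'': "smooth_fun (deriv u0')" and per'': "periodic_2pi (deriv u0')"
    using smooth_fun_deriv[OF s'] periodic_deriv[OF per'] by simp_all
  define e where "e = 7 * \<epsilon>"
  have e: "0 < e" "e * (2 * t) \<le> 1 / 100" using \<epsilon> \<epsilon>t by (auto simp: e_def)
  have b0: "\<bar>u0 x\<bar> \<le> 6 * \<epsilon> / real L" for x
    unfolding u0_def using datum_bound[OF M r_def L1(1)] \<epsilon> by simp
  have b0': "\<bar>u0 x\<bar> \<le> e" for x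
  proof -
    have "6 * \<epsilon> / real L \<le> 6 * \<epsilon> / 1" using L1 \<epsilon> by (intro divide_left_mono) auto
    then show ?thesis using b0[of x] \<epsilon> by (simp add: e_def)
  qed
  have b1: "\<bar>u0' x\<bar> \<le> e" for x
    unfolding u0'_def e_def using datum'_bound[OF M r_def L1(2)] \<epsilon> by simp
  have small: "\<bar>u0 x\<bar> * H \<le> 1 / 7" for x
  proof -
    have "\<bar>u0 x\<bar> * H \<le> 6 * \<epsilon> / real L * H" using b0 H0 by (rule mult_right_mono)
    also have "\<dots> = 42 * \<epsilon> * H / (7 * real L)" by simp
    also have "\<dots> \<le> real L / (7 * real L)" 
    proof (rule divide_right_mono)
      show "42 * \<epsilon> * H \<le> real L" by (rule order_trans[OF p3(3)]) (simp add: L)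
    qed (use Lp in simp)
    finally show ?thesis using Lp by simp
  qed
  define E where "E = \<epsilon>\<^sup>2 * (6 / 5 * \<Lambda> - 1)"
  have E: "E \<le> integral {0..2*pi} (\<lambda>x. (u0' x)\<^sup>2 * hk r x)"
  proof -
    have "C / real L \<le> 1" using p3(2) L Lp by (simp add: divide_le_eq)
    then have "E \<le> \<epsilon>\<^sup>2 * (6 / 5 * ln (real M + 1) - C / real L)"
      unfolding E_def \<Lambda>_def by (intro mult_left_mono) auto
    then show ?thesis using C[OF L1(1), of \<epsilon>] by (simp add: u0'_def)
  qed
  \<comment> \<open>The lifetime 2 t places t strictly inside the half-open interval on which
    solutions live.\<close>
  obtain l where "ch_flow_bd (2 * t) u0 u0' (deriv u0') (\<lambda>x. u0 x - deriv u0' x) l e"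
    using flow_exists[of "2 * t" u0 u0' "deriv u0'" e] t e b0' b1 per per' per''
      smooth_fun_has_deriv[OF s] smooth_fun_has_deriv[OF s'] smooth_fun_continuous[OF s''] u0'_eq by auto
  then interpret Z: ch_flow_bd "2 * t" u0 u0' "deriv u0'" "\<lambda>x. u0 x - deriv u0' x" l e .
  have sol: "CH_solution (2 * t) u0 Z.u" by (rule Z.CH_solution_u[OF smooth_fun_diff[OF s s'']])
  have tT: "t \<in> {0..2 * t}" "t \<in> {0..<2 * t}" using t by auto
  have low: "20 * K \<le> t / 2 * E - 7000 * (e ^ 3 * t\<^sup>2 * ln (real M + 1)) - 3300 * (e\<^sup>2 * t) - 1"
  proof -
    define Y where "Y = \<epsilon>\<^sup>2 * t"
    have Y: "0 < Y" using e2t by (simp add: Y_def)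
    have a0: "0 \<le> a" using K e2t by (simp add: a_def)
    have 1: "t / 2 * E = 3 / 5 * (Y * \<Lambda>) - Y / 2" by (simp add: E_def Y_def algebra_simps)
    have "7000 * (e ^ 3 * t\<^sup>2 * \<Lambda>) = 2401000 * (\<epsilon> * t) * (Y * \<Lambda>)"
      by (simp add: e_def Y_def power_mult_distrib power2_eq_square power3_eq_cube mult_ac)
    also have "\<dots> \<le> 1 / 10 * (Y * \<Lambda>)" using \<epsilon>t Y \<Lambda> a0 by (intro mult_right_mono) auto
    finally have 2: "7000 * (e ^ 3 * t\<^sup>2 * \<Lambda>) \<le> 1 / 10 * (Y * \<Lambda>)" .
    have 3: "3300 * (e\<^sup>2 * t) = 161700 * Y" by (simp add: e_def Y_def power_mult_distrib)
    have "Y * a \<le> Y * \<Lambda>" using \<Lambda> Y by simp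
    moreover have "Y * a = 2 * (20 * K + 1) + 323401 * Y"
    proof -
      have "Y * (x / Y + 323401) = x + 323401 * Y" for x using Y by (simp add: distrib_left)
      then show ?thesis unfolding a_def Y_def .
    qed
    ultimately have 4: "2 * (20 * K + 1) + 323401 * Y \<le> Y * \<Lambda>" by simp
    have "20 * K \<le> TE - A - B - 1"
      if "TE = 3 / 5 * X - Y / 2" "A \<le> 1 / 10 * X" "B = 161700 * Y" "2 * (20 * K + 1) + 323401 * Y \<le> X" for TE A B X
      using that by (simp add: field_simps)
    from this[OF 1 2 3 4] show ?thesis unfolding \<Lambda>_def .
  qed
  have big: "besov_1_inf_1 chi (Z.u t) \<ge> ennreal K"
  proof -
    have "ennreal (20 * K) \<le> ennreal \<bar>integral {0..2*pi} (\<lambda>y. Z.u t (Z.\<eta> t 0 + y) * hk' r y)\<bar>"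
      by (intro ennreal_leI order_trans[OF low Z.hilbert_inflation[OF M r_def tT(1) H small E]])
    also have "\<dots> \<le> 20 * besov_1_inf_1 chi (Z.u t)"
      by (rule besov_controls_hilbert[OF chi _ r01]) (use sol tT(2) in \<open>auto simp: CH_solution_def\<close>)
    finally have "20 * ennreal K \<le> 20 * besov_1_inf_1 chi (Z.u t)" using K by (simp add: ennreal_mult)
    then show ?thesis by (simp add: ennreal_mult_le_mult_iff)
  qed
  show ?thesis
  proof (rule exI[of _ u0], rule exI[of _ "2 * t"], intro conjI allI impI)
    show "besov_1_inf_1 chi u0 \<le> ennreal (5 * \<epsilon>)"
      unfolding u0_def L_def using datum_besov[OF chi M r_def Mp] \<epsilon> by simp
    fix u assume "CH_solution (2 * t) u0 u"
    then have "u t = Z.u t" by (rule CH_solution_unique[OF _ sol tT(2)])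
    then show "\<exists>t0. 0 < t0 \<and> t0 \<le> \<tau> \<and> t0 < 2 * t \<and> besov_1_inf_1 chi (u t0) \<ge> ennreal K"
      using t big by (intro exI[of _ t]) simp
  qed (use S t sol in auto)
qed

theorem theorem1p1:
  fixes chi :: "real \<Rightarrow> real"
  assumes "LP_cutoff chi"
  shows "\<exists>N::nat. \<forall>n::nat. n \<ge> N \<longrightarrow>
    (\<exists>u0 T. H_inf u0 \<and>
       besov_1_inf_1 chi u0 \<le> ennreal (1 / ln (ln (real n))) \<and>
       T > 0 \<and> (\<exists>u. CH_solution T u0 u) \<and>
       (\<forall>u. CH_solution T u0 u \<longrightarrow>
          (\<exists>t0. 0 < t0 \<and> t0 \<le> 1 / ln (real n) \<and> t0 < T \<and>
                besov_1_inf_1 chi (u t0) \<ge> ennreal (ln (ln (real n))))))"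
\<comment> \<open>Beyond e^e one has ln ln n \<ge> 1 and ln n > 0, so \<open>norm_inflation\<close>
  applies with \<epsilon> = 1 / (5 ln ln n), \<tau> = 1 / ln n and K = ln ln n.\<close>
proof (intro exI[of _ "nat \<lceil>exp (exp 1 :: real)\<rceil>"] allI impI)
  fix n :: nat assume "n \<ge> nat \<lceil>exp (exp 1 :: real)\<rceil>"
  then have "real (nat \<lceil>exp (exp 1 :: real)\<rceil>) \<le> real n" by (simp only: of_nat_le_iff)
  with real_nat_ceiling_ge have "exp (exp 1) \<le> real n" by (rule order_trans)
  then have "exp 1 \<le> ln (real n)" using less_le_trans[OF exp_gt_zero] ln_ge_iff by blast
  then have n: "0 < ln (real n)" "1 \<le> ln (ln (real n))"
    using less_le_trans[OF exp_gt_zero] ln_ge_iff by blast+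
  have pos: "0 < 1 / (5 * x)" "0 < 1 / y" "0 \<le> x" if "0 < y" "1 \<le> x" for x y :: real
    using that by auto
  note norm_inflation[OF assms pos[OF n]]
  moreover have "5 * (1 / (5 * ln (ln (real n)))) = 1 / ln (ln (real n))" by simp
  ultimately show "\<exists>u0 T. H_inf u0 \<and>
       besov_1_inf_1 chi u0 \<le> ennreal (1 / ln (ln (real n))) \<and>
       T > 0 \<and> (\<exists>u. CH_solution T u0 u) \<and>
       (\<forall>u. CH_solution T u0 u \<longrightarrow>
          (\<exists>t0. 0 < t0 \<and> t0 \<le> 1 / ln (real n) \<and> t0 < T \<and>
                besov_1_inf_1 chi (u t0) \<ge> ennreal (ln (ln (real n)))))"
    by (simp only:)
qed

end
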